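(* Let $[n]=A_0\sqcup I_1\sqcup\dots\sqcup I_r$ be a partition in which each $I_i$ is a cyclic interval. Then, as schemes, $V(A_0;I_1,\dots,I_r)_{\mathrm{red}}=V(A_0;I_1,\dots,I_r)'$. In other words, the boundary of colliding configurations $V(A_0;I_1,\dots,I_r)_{\mathrm{red}}$ is cut out as a subscheme of $\mathrm{Gr}(3,n)$ by the vanishing of the Plücker coordinates defining the positroid variety $\Pi(A_0;I_1,\dots,I_r)$ (namely $p_J$ for all $J$ with $J\cap A_0\ne\emptyset$ or $|J\cap I_i|\ge2$ for some $i$) together with the vanishing of the maximal ($6\times6$) minors of $\tilde\theta(M)$.
   Context: Over $\mathbb C$. The ABCT variety $V(3,n)\subset\mathrm{Gr}(3,n)$ is the Zariski closure of the image of the rational map $\mathrm{Gr}(2,n)\dashrightarrow\mathrm{Gr}(3,n)$ applying $(a,b)^T\mapsto(a^2,ab,b^2)^T$ to each column of a $2\times n$ matrix. It is known to be a reduced irreducible scheme, equal scheme-theoretically to $\{[M]:\mathrm{rk}\,\theta(M)<6\}$, where $\theta(M)$ is the $6\times n$ matrix whose $j$-th column is $(x_{1j}^2,x_{2j}^2,x_{3j}^2,x_{1j}x_{2j},x_{1j}x_{3j},x_{2j}x_{3j})^T$ for $M=(x_{ij})$. $\Pi(A_0;I_1,\dots,I_r)=\{[M]\in\mathrm{Gr}(3,n):\mathrm{rk}\,M_{A_0}=0,\ \mathrm{rk}\,M_{I_i}\le1\text{ for all }i\}$, where $M_I$ is the submatrix of columns in $I$ (a positroid variety, reduced, cut out scheme-theoretically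 by the Plücker coordinates listed). $V(A_0;I_1,\dots,I_r)$ is the scheme-theoretic intersection $\Pi(A_0;I_1,\dots,I_r)\cap V(3,n)$, and the subscript $\mathrm{red}$ denotes the reduced subscheme. $\tilde\theta(M)$ is obtained from $\theta(M)$ by appending, for each $i\in[r]$ and each pair $a\neq b$ in $I_i$, the column $(x_{1a}x_{1b},x_{2a}x_{2b},x_{3a}x_{3b},x_{1a}x_{2b},x_{1a}x_{3b},x_{2a}x_{3b})^T$. $V(A_0;I_1,\dots,I_r)'$ is the closed subscheme of $V(A_0;I_1,\dots,I_r)$ defined by the vanishing of the $6\times6$ minors of $\tilde\theta(M)$. *)

theory Defs
  imports
    "HOL-Library.Poly_Mapping"
    "HOL-Library.Disjoint_Sets"
    "HOL-Algebra.Ideal"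
    "Jordan_Normal_Form.DL_Rank_Submatrix"
begin

text \<open>
  Rows of a \<open>3 \<times> n\<close> matrix are indexed by \<open>{..<3}\<close> and columns by \<open>{..<n}\<close>, so \<open>{..<n}\<close>
  plays the role of \<open>[n]\<close>.

  A closed subscheme of \<open>Gr(3,n)\<close> over the complex numbers is an ideal sheaf on the standard affine
  cover \<open>U\<^sub>J = {p\<^sub>J \<noteq> 0}\<close>, \<open>J\<close> running over the 3-subsets of \<open>{..<n}\<close>.  Every point of \<open>U\<^sub>J\<close> has a
  unique representing matrix whose columns in \<open>J\<close> form the identity, so \<open>U\<^sub>J\<close> is the affine space
  whose coordinate ring is the polynomial ring in the entries outside the columns in \<open>J\<close>.
  A closed subscheme is represented by the family of its ideals in these coordinate rings.
\<close>

section \<open>Polynomials in matrix entries\<close>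

type_synonym mpoly = "((nat \<times> nat) \<Rightarrow>\<^sub>0 nat) \<Rightarrow>\<^sub>0 complex"

definition xvar :: "nat \<Rightarrow> nat \<Rightarrow> mpoly" where
  "xvar i j = Poly_Mapping.single (Poly_Mapping.single (i, j) 1) 1"

definition polys_in :: "(nat \<times> nat) set \<Rightarrow> mpoly set" where
  "polys_in X = {f. \<forall>m \<in> Poly_Mapping.keys f. Poly_Mapping.keys m \<subseteq> X}"

definition eval_at :: "mpoly \<Rightarrow> complex mat \<Rightarrow> complex" where
  "eval_at f N = (\<Sum>m \<in> Poly_Mapping.keys f. Poly_Mapping.lookup f m *
      (\<Prod>v \<in> Poly_Mapping.keys m. (N $$ v) ^ Poly_Mapping.lookup m v))"


section \<open>Closed subschemes of the Grassmannian\<close>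

definition charts :: "nat \<Rightarrow> nat set set" where
  "charts n = {J. J \<subseteq> {..<n} \<and> card J = 3}"

definition chart_ring :: "nat \<Rightarrow> nat set \<Rightarrow> mpoly ring" where
  "chart_ring n J = \<lparr>carrier = polys_in ({..<3} \<times> ({..<n} - J)),
     monoid.mult = (*), one = 1, zero = 0, add = (+)\<rparr>"

text \<open>The universal matrix over \<open>U\<^sub>J\<close>; \<open>pick J i\<close> is the \<open>i\<close>-th element of \<open>J\<close>.\<close>

definition chart_matrix :: "nat \<Rightarrow> nat set \<Rightarrow> mpoly mat" where
  "chart_matrix n J = mat 3 n (\<lambda>(i, j).
     if j \<in> J then (if j = pick J i then 1 else 0) else xvar i j)"

type_synonym subscheme = "nat set \<Rightarrow> mpoly set"

definition same_subscheme :: "nat \<Rightarrow> subscheme \<Rightarrow> subscheme \<Rightarrow> bool" where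
  "same_subscheme n X Y \<longleftrightarrow> (\<forall>J \<in> charts n. X J = Y J)"

text \<open>\<open>E M\<close> is a set of polynomial expressions in the entries of \<open>M\<close> which, locally, are sections
  of line bundles; in the trivialisation over \<open>U\<^sub>J\<close> they are evaluated at the universal matrix.\<close>

definition cut_out :: "nat \<Rightarrow> (mpoly mat \<Rightarrow> mpoly set) \<Rightarrow> subscheme" where
  "cut_out n E J = Idl\<^bsub>chart_ring n J\<^esub> (E (chart_matrix n J))"

definition scheme_inter :: "nat \<Rightarrow> subscheme \<Rightarrow> subscheme \<Rightarrow> subscheme" where
  "scheme_inter n X Y J = X J <+>\<^bsub>chart_ring n J\<^esub> Y J"

definition radical :: "('a, 'b) ring_scheme \<Rightarrow> 'a set \<Rightarrow> 'a set" where
  "radical R \<aa> = {f \<in> carrier R. \<exists>k::nat. f [^]\<^bsub>R\<^esub> k \<in> \<aa>}"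

definition reduced_subscheme :: "nat \<Rightarrow> subscheme \<Rightarrow> subscheme" where
  "reduced_subscheme n X J = radical (chart_ring n J) (X J)"


text \<open>\<open>Idl\<close> is only meaningful for generators inside the carrier of a ring.\<close>

lemma polys_in_one: "1 \<in> polys_in X"
  by (auto simp: polys_in_def)

lemma polys_in_zero: "0 \<in> polys_in X"
  by (auto simp: polys_in_def)

lemma polys_in_add: "f \<in> polys_in X \<Longrightarrow> g \<in> polys_in X \<Longrightarrow> f + g \<in> polys_in X"
  unfolding polys_in_def using Poly_Mapping.keys_add[of f g] by blast

lemma polys_in_uminus: "f \<in> polys_in X \<Longrightarrow> - f \<in> polys_in X"
  by (auto simp: polys_in_def)

lemma polys_in_mult:
  assumes "f \<in> polys_in X" "g \<in> polys_in X"
  shows "f * g \<in> polys_in X"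
  unfolding polys_in_def
proof safe
  fix m v assume m: "m \<in> Poly_Mapping.keys (f * g)" and v: "v \<in> Poly_Mapping.keys m"
  from m obtain a b where "m = a + b" "a \<in> Poly_Mapping.keys f" "b \<in> Poly_Mapping.keys g"
    using Poly_Mapping.keys_mult[of f g] by blast
  with v assms show "v \<in> X"
    using Poly_Mapping.keys_add[of a b] unfolding polys_in_def by blast
qed

lemma polys_in_sum: "(\<And>a. a \<in> A \<Longrightarrow> h a \<in> polys_in X) \<Longrightarrow> sum h A \<in> polys_in X"
  by (induction A rule: infinite_finite_induct) (auto intro: polys_in_zero polys_in_add)

lemma polys_in_prod: "(\<And>a. a \<in> A \<Longrightarrow> h a \<in> polys_in X) \<Longrightarrow> prod h A \<in> polys_in X"
  by (induction A rule: infinite_finite_induct) (auto intro: polys_in_one polys_in_mult)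

lemma cring_chart_ring: "cring (chart_ring n J)"
proof -
  let ?X = "{..<3} \<times> ({..<n} - J)"
  have "\<exists>y \<in> polys_in ?X. y + x = 0" if "x \<in> polys_in ?X" for x
    using polys_in_uminus[OF that] by (intro bexI[of _ "- x"]) auto
  then show ?thesis
    by (intro cringI abelian_groupI comm_monoidI)
      (auto simp: chart_ring_def polys_in_one polys_in_zero algebra_simps
        intro: polys_in_add polys_in_mult)
qed

lemma polys_in_det:
  assumes "\<And>i j. i < dim_row B \<Longrightarrow> j < dim_col B \<Longrightarrow> B $$ (i, j) \<in> polys_in X"
  shows "Determinant.det B \<in> polys_in X"
proof (cases "dim_row B = dim_col B")
  case True
  have "of_int (sign p) * (\<Prod>i = 0..<dim_row B. B $$ (i, p i)) \<in> polys_in X"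
    if p: "p permutes {0..<dim_row B}" for p
  proof (rule polys_in_mult)
    show "of_int (sign p) \<in> polys_in X"
      by (cases p rule: sign_cases) (auto intro: polys_in_one polys_in_uminus)
    show "(\<Prod>i = 0..<dim_row B. B $$ (i, p i)) \<in> polys_in X"
      by (rule polys_in_prod, rule assms) (use True permutes_in_image[OF p] in auto)
  qed
  with True show ?thesis
    unfolding Determinant.det_def by (auto intro!: polys_in_sum)
qed (simp add: Determinant.det_def polys_in_zero)

lemma polys_in_submatrix_det:
  assumes "\<And>i j. i < dim_row B \<Longrightarrow> j < dim_col B \<Longrightarrow> B $$ (i, j) \<in> polys_in X"
  shows "Determinant.det (submatrix B UNIV S) \<in> polys_in X"
proof (rule polys_in_det)
  fix i j
  assume "i < dim_row (submatrix B UNIV S)" "j < dim_col (submatrix B UNIV S)"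
  then have ij: "i < card {i. i < dim_row B \<and> i \<in> UNIV}" "j < card {j. j < dim_col B \<and> j \<in> S}"
    by (simp_all add: dim_submatrix)
  with assms pick_le[OF ij(1)] pick_le[OF ij(2)] show "submatrix B UNIV S $$ (i, j) \<in> polys_in X"
    by (simp only: submatrix_index)
qed

lemma chart_matrix_entry:
  assumes "i < 3" "j < n"
  shows "chart_matrix n J $$ (i, j) \<in> carrier (chart_ring n J)"
  using assms
  by (auto simp: chart_matrix_def chart_ring_def polys_in_one polys_in_zero)
    (auto simp: polys_in_def xvar_def)

lemma submatrix_chart_matrix:
  assumes "J \<in> charts n"
  shows "submatrix (chart_matrix n J) UNIV J = 1\<^sub>m 3"
proof -
  from assms have J: "J \<subseteq> {..<n}" "card J = 3"
    by (auto simp: charts_def)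
  then have cols: "{j. j < n \<and> j \<in> J} = J" by auto
  have mem: "pick J a \<in> J" "pick J a < n" if "a < 3" for a
    using pick_in_set_le[of a J] that J by auto
  have inj: "pick J a = pick J b \<longleftrightarrow> a = b" if "a < 3" "b < 3" for a b
    using that J pick_mono_le[of a J b] pick_mono_le[of b J a]
    by (metis less_irrefl nat_neq_iff)
  have dims: "dim_row (chart_matrix n J) = 3" "dim_col (chart_matrix n J) = n"
    by (simp_all add: chart_matrix_def)
  have "submatrix (chart_matrix n J) UNIV J =
      mat 3 3 (\<lambda>(i, j). chart_matrix n J $$ (i, pick J j))"
    by (simp only: submatrix_def dims cols J pick_UNIV) simp
  also have "\<dots> = 1\<^sub>m 3"
  proof (rule eq_matI)
    fix i j
    assume "i < dim_row (1\<^sub>m 3 :: mpoly mat)" "j < dim_col (1\<^sub>m 3 :: mpoly mat)"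
    then have ij: "i < 3" "j < 3" by simp_all
    then show "mat 3 3 (\<lambda>(i, j). chart_matrix n J $$ (i, pick J j)) $$ (i, j) = 1\<^sub>m 3 $$ (i, j)"
      using mem[OF ij(2)] inj[OF ij(2,1)] by (auto simp: chart_matrix_def simp del: pick.simps)
  qed simp_all
  finally show ?thesis .
qed


section \<open>Closed points and Zariski closures\<close>

text \<open>For \<open>M\<close> of full row rank, \<open>row_class M\<close> is the point \<open>[M]\<close> of the Grassmannian, as the set of
  all matrices with the same row space as \<open>M\<close>.\<close>

definition row_class :: "complex mat \<Rightarrow> complex mat set" where
  "row_class M = {g * M | g. g \<in> carrier_mat (dim_row M) (dim_row M) \<and> invertible_mat g}"

text \<open>The closure in \<open>Gr(3,n)\<close> of a set \<open>Z\<close> of points, with its reduced structure: over \<open>U\<^sub>J\<close>, the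
  functions vanishing on \<open>Z \<inter> U\<^sub>J\<close>.\<close>

definition closure_of_points :: "nat \<Rightarrow> complex mat set set \<Rightarrow> subscheme" where
  "closure_of_points n Z J = {f \<in> carrier (chart_ring n J).
     \<forall>P \<in> Z. \<forall>N \<in> P. submatrix N UNIV J = 1\<^sub>m 3 \<longrightarrow> eval_at f N = 0}"


section \<open>The ABCT variety\<close>

definition veronese :: "complex mat \<Rightarrow> complex mat" where
  "veronese A = mat_of_cols 3 (map (\<lambda>j.
     vec_of_list [(A $$ (0, j))\<^sup>2, A $$ (0, j) * A $$ (1, j), (A $$ (1, j))\<^sup>2]) [0..<dim_col A])"

definition ABCT_variety :: "nat \<Rightarrow> subscheme" where
  "ABCT_variety n = closure_of_points n
     {row_class (veronese A) | A. A \<in> carrier_mat 2 n \<and> vec_space.rank 2 A = 2 \<and>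
        vec_space.rank 3 (veronese A) = 3}"


section \<open>Boundaries of colliding configurations\<close>

definition cyclic_interval :: "nat \<Rightarrow> nat set \<Rightarrow> bool" where
  "cyclic_interval n S \<longleftrightarrow> (\<exists>a < n. \<exists>l \<in> {1..n}. S = (\<lambda>k. (a + k) mod n) ` {..<l})"

definition positroid_variety :: "nat \<Rightarrow> nat set \<Rightarrow> nat \<Rightarrow> (nat \<Rightarrow> nat set) \<Rightarrow> subscheme" where
  "positroid_variety n A0 r I = closure_of_points n
     {row_class M | M. M \<in> carrier_mat 3 n \<and> vec_space.rank 3 M = 3 \<and>
        vec_space.rank 3 (submatrix M UNIV A0) = 0 \<and>
        (\<forall>i \<in> {1..r}. vec_space.rank 3 (submatrix M UNIV (I i)) \<le> 1)}"

definition V_boundary :: "nat \<Rightarrow> nat set \<Rightarrow> nat \<Rightarrow> (nat \<Rightarrow> nat set) \<Rightarrow> subscheme" where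
  "V_boundary n A0 r I = scheme_inter n (positroid_variety n A0 r I) (ABCT_variety n)"

definition pluecker_coord :: "nat set \<Rightarrow> 'a::comm_ring_1 mat \<Rightarrow> 'a" where
  "pluecker_coord J M = det (submatrix M UNIV J)"

definition positroid_pluecker_coords ::
  "nat set \<Rightarrow> nat \<Rightarrow> (nat \<Rightarrow> nat set) \<Rightarrow> 'a::comm_ring_1 mat \<Rightarrow> 'a set" where
  "positroid_pluecker_coords A0 r I M = {pluecker_coord J M | J.
     J \<subseteq> {..<dim_col M} \<and> card J = 3 \<and> (J \<inter> A0 \<noteq> {} \<or> (\<exists>i \<in> {1..r}. card (J \<inter> I i) \<ge> 2))}"

definition maximal_minors :: "'a::comm_ring_1 mat \<Rightarrow> 'a set" where
  "maximal_minors B = {det (submatrix B UNIV S) | S. S \<subseteq> {..<dim_col B} \<and> card S = dim_row B}"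

definition quad_col :: "'a::comm_ring_1 mat \<Rightarrow> nat \<Rightarrow> nat \<Rightarrow> 'a vec" where
  "quad_col M a b = vec_of_list
     [M $$ (0, a) * M $$ (0, b), M $$ (1, a) * M $$ (1, b), M $$ (2, a) * M $$ (2, b),
      M $$ (0, a) * M $$ (1, b), M $$ (0, a) * M $$ (2, b), M $$ (1, a) * M $$ (2, b)]"

definition theta :: "'a::comm_ring_1 mat \<Rightarrow> 'a mat" where
  "theta M = mat_of_cols 6 (map (\<lambda>j. quad_col M j j) [0..<dim_col M])"

text \<open>A column is appended for each ordered pair; since \<open>quad_col\<close> is not symmetric, the columns of
  \<open>(a, b)\<close> and \<open>(b, a)\<close> agree only where the columns \<open>a\<close> and \<open>b\<close> of \<open>M\<close> are proportional.\<close>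

definition theta_tilde :: "nat \<Rightarrow> (nat \<Rightarrow> nat set) \<Rightarrow> 'a::comm_ring_1 mat \<Rightarrow> 'a mat" where
  "theta_tilde r I M = mat_of_cols 6 (cols (theta M) @
     [quad_col M a b. i \<leftarrow> [1..<Suc r], a \<leftarrow> [0..<dim_col M], b \<leftarrow> [0..<dim_col M],
        a \<in> I i \<and> b \<in> I i \<and> a \<noteq> b])"

lemma generators_in_carrier:
  "positroid_pluecker_coords A0 r I (chart_matrix n J) \<union>
     maximal_minors (theta_tilde r I (chart_matrix n J)) \<subseteq> carrier (chart_ring n J)"
proof -
  let ?M = "chart_matrix n J" and ?X = "{..<3} \<times> ({..<n} - J)"
  let ?T = "theta_tilde r I ?M"
  define Q where "Q = {quad_col ?M a b | a b. a < n \<and> b < n}"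
  have dims [simp]: "dim_row ?M = 3" "dim_col ?M = n"
    by (auto simp: chart_matrix_def)
  have car: "carrier (chart_ring n J) = polys_in ?X"
    by (simp add: chart_ring_def)
  have M: "?M $$ (i, j) \<in> polys_in ?X" if "i < 3" "j < n" for i j
    using chart_matrix_entry[OF that, of J] car by simp
  have q: "quad_col ?M a b $ k \<in> polys_in ?X" if "a < n" "b < n" "k < 6" for a b k
  proof -
    from \<open>k < 6\<close> have "k \<in> {0, 1, 2, 3, 4, 5}" by auto
    then show ?thesis
      using M that unfolding quad_col_def vec_of_list_index
      by (auto simp: nth_Cons_numeral intro!: polys_in_mult)
  qed
  have qdim: "dim_vec (quad_col ?M a b) = 6" for a b
    by (simp add: quad_col_def)
  have q_range: "quad_col ?M a b \<in> Q" if "a < n" "b < n" for a b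
    using that unfolding Q_def by blast
  have "cols (theta ?M) = map (\<lambda>j. quad_col ?M j j) [0..<n]"
    unfolding theta_def dims by (rule cols_mat_of_cols) (auto intro!: carrier_vecI simp: qdim)
  then have th: "set (cols (theta ?M)) \<subseteq> Q"
    by (auto intro!: q_range)
  obtain cs where T: "?T = mat_of_cols 6 cs" and cs: "set cs \<subseteq> Q"
    by (rule that[OF theta_tilde_def])
      (use th in \<open>auto split: if_splits intro!: q_range\<close>)
  have "?T $$ (i, j) \<in> polys_in ?X" if "i < 6" "j < dim_col ?T" for i j
  proof -
    from that have j: "j < length cs" by (simp add: T)
    with cs[unfolded Q_def] nth_mem[OF j] obtain a b where "a < n" "b < n" "cs ! j = quad_col ?M a b"
      by blast
    with j q that show ?thesis
      by (simp add: T mat_of_cols_index)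
  qed
  moreover have "dim_row ?T = 6" by (simp add: T)
  ultimately have "det (submatrix ?T UNIV S) \<in> polys_in ?X" for S
    by (intro polys_in_submatrix_det) auto
  moreover have "det (submatrix ?M UNIV S) \<in> polys_in ?X" for S
    by (intro polys_in_submatrix_det) (auto intro: M)
  ultimately show ?thesis
    unfolding car maximal_minors_def positroid_pluecker_coords_def pluecker_coord_def by blast
qed

definition V_boundary' :: "nat \<Rightarrow> nat set \<Rightarrow> nat \<Rightarrow> (nat \<Rightarrow> nat set) \<Rightarrow> subscheme" where
  "V_boundary' n A0 r I = scheme_inter n (V_boundary n A0 r I)
     (cut_out n (\<lambda>M. maximal_minors (theta_tilde r I M)))"

end

theory Submission
  imports Defs
begin

text \<open>
  Work on the chart \<open>U\<^sub>J\<close> and let \<open>K\<close> be the ideal of the Pluecker coordinates and of the maximal minors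
  of \<open>theta_tilde\<close>.  If \<open>J\<close> meets \<open>A0\<close> or contains two elements of some \<open>I i\<close>, then \<open>K\<close> is the unit ideal.
  Otherwise the columns in \<open>J\<close> are the coordinate points \<open>e\<^sub>0, e\<^sub>1, e\<^sub>2\<close> in three distinct groups.  Modulo the
  Pluecker coordinates a column \<open>k\<close> of the group \<open>s\<close> is \<open>t\<^sub>k y\<^sub>s\<close>, and the minors become the \<open>3 \<times> 3\<close> minors of
  the matrix with columns \<open>(u v, u w, v w)\<close>, \<open>y\<^sub>s = (u, v, w)\<close>, times monomials in \<open>t\<close>.  Subtracting multiples
  of these minors, every polynomial is congruent modulo \<open>K\<close> to a combination of standard monomials, those not
  divisible by a diagonal term; and standard monomials are linearly independent as functions on the
  configurations in which all \<open>y\<^sub>s\<close> lie on one smooth conic through \<open>e\<^sub>0, e\<^sub>1, e\<^sub>2\<close>.  Such configurations belong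
  to both the positroid and the ABCT variety, so every function vanishing on the boundary, and hence every
  element of its radical ideal, lies in \<open>K\<close>.

  Conversely \<open>K\<close> lies in the radical because the square of a maximal minor of \<open>theta_tilde\<close> is, on the positroid
  variety, a product of two maximal minors of \<open>theta\<close>.
\<close>

section \<open>Standard monomials on configurations on a smooth conic\<close>

text \<open>The columns appended to \<open>theta\<close> are what the reduction step needs. A
  monomial may contain the factor u v of one group through two different columns a and b, which
  contributes t_a t_b, while a minor of \<open>theta\<close> is quadratic in every column that it
  involves. The minors with mixed columns (a, b) supply the missing multidegrees in t.

  Where u v w is nonzero, (u v, u w, v w) is proportional to (1/w, 1/v, 1/u). Rank below 3 therefore
  says that the images under the standard Cremona transformation are collinear, that is, that the
  points lie on one conic through the three coordinate points.

  The obstacle is independence on smooth conics: all points share the conic, so the labels cannot be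
  treated one at a time. Splitting off the smallest label leaves coefficients that satisfy only a
  weaker standardness condition, and the smooth conics do not obviously separate those. Each weaker
  condition is therefore paired with a more degenerate locus, where independence is easier and which
  is reached as a limit of the previous one.\<close>

text \<open>A configuration \<open>Y\<close> assigns to each label \<open>s\<close> the point with coordinates \<open>Y s 0\<close>, \<open>Y s 1\<close>,
  \<open>Y s 2\<close>, and \<open>e s i\<close> is the exponent of that coordinate.  Linear independence is stated for indexed
  families that may repeat exponents: a vanishing combination must cancel within each class of equal
  exponents on \<open>S\<close>.\<close>

definition power_product :: "nat set \<Rightarrow> (nat \<Rightarrow> nat \<Rightarrow> nat) \<Rightarrow> (nat \<Rightarrow> nat \<Rightarrow> complex) \<Rightarrow> complex" where
  "power_product S e Y = (\<Prod>s\<in>S. Y s 0 ^ e s 0 * Y s 1 ^ e s 1 * Y s 2 ^ e s 2)"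

definition exponent_key :: "nat set \<Rightarrow> (nat \<Rightarrow> nat \<Rightarrow> nat) \<Rightarrow> nat \<Rightarrow> nat \<Rightarrow> nat" where
  "exponent_key S e = (\<lambda>s i. if s \<in> S \<and> i < 3 then e s i else 0)"

definition cancels :: "nat set \<Rightarrow> nat set \<Rightarrow> (nat \<Rightarrow> complex) \<Rightarrow> (nat \<Rightarrow> nat \<Rightarrow> nat \<Rightarrow> nat) \<Rightarrow> bool" where
  "cancels S A c e \<longleftrightarrow> (\<forall>\<kappa>. (\<Sum>x | x \<in> A \<and> exponent_key S (e x) = \<kappa>. c x) = 0)"

definition independent_on :: "nat set \<Rightarrow> ((nat \<Rightarrow> nat \<Rightarrow> nat) \<Rightarrow> bool) \<Rightarrow> (nat \<Rightarrow> nat \<Rightarrow> complex) set \<Rightarrow> bool" where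
  "independent_on S P Z \<longleftrightarrow> (\<forall>A c e. finite A \<longrightarrow> (\<forall>x\<in>A. P (e x)) \<longrightarrow>
     (\<forall>Y\<in>Z. (\<Sum>x\<in>A. c x * power_product S (e x) Y) = 0) \<longrightarrow> cancels S A c e)"

lemma independent_onD:
  assumes "independent_on S P Z" "finite A" "\<And>x. x \<in> A \<Longrightarrow> P (e x)"
    "\<And>Y. Y \<in> Z \<Longrightarrow> (\<Sum>x\<in>A. c x * power_product S (e x) Y) = 0"
  shows "cancels S A c e"
  using assms unfolding independent_on_def by blast

lemma power_product_insert:
  "finite S \<Longrightarrow> s \<notin> S \<Longrightarrow> power_product (insert s S) e Y = Y s 0 ^ e s 0 * Y s 1 ^ e s 1 * Y s 2 ^ e s 2 * power_product S e Y"
  unfolding power_product_def by (rule prod.insert)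

lemma power_product_key: "power_product S (exponent_key S e) Y = power_product S e Y"
  unfolding power_product_def exponent_key_def by (intro prod.cong) auto

lemma cancels_sum_eq_0:
  assumes "finite A" "cancels S A c e"
  shows "(\<Sum>x\<in>A. c x * power_product S (e x) Y) = 0"
proof -
  have "(\<Sum>x\<in>A. c x * power_product S (e x) Y) =
      (\<Sum>\<kappa>\<in>(\<lambda>x. exponent_key S (e x)) ` A. \<Sum>x | x \<in> A \<and> exponent_key S (e x) = \<kappa>. c x * power_product S (e x) Y)"
    by (rule sum.image_gen[OF assms(1)])
  also have "\<dots> = (\<Sum>\<kappa>\<in>(\<lambda>x. exponent_key S (e x)) ` A. (\<Sum>x | x \<in> A \<and> exponent_key S (e x) = \<kappa>. c x) * power_product S \<kappa> Y)"
    by (intro sum.cong refl, unfold sum_distrib_right, intro sum.cong) (auto simp: power_product_key)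
  finally show ?thesis
    using assms(2) by (simp add: cancels_def)
qed

section \<open>Splitting off the point of one label\<close>

abbreviation slice :: "nat set \<Rightarrow> (nat \<Rightarrow> nat \<Rightarrow> nat \<Rightarrow> nat) \<Rightarrow> nat \<Rightarrow> nat \<Rightarrow> nat \<Rightarrow> nat \<Rightarrow> nat set" where
  "slice A e s a b d \<equiv> {x \<in> A. e x s 0 = a \<and> e x s 1 = b \<and> e x s 2 = d}"

lemma cancels_insert:
  assumes "s \<notin> S" and "\<And>a b d. cancels S (slice A e s a b d) c e"
  shows "cancels (insert s S) A c e"
  unfolding cancels_def
proof
  fix \<kappa>
  have "{x. x \<in> A \<and> exponent_key (insert s S) (e x) = \<kappa>} =
     (if \<forall>t i. (t, i) \<notin> insert s S \<times> {..<3} \<longrightarrow> \<kappa> t i = 0 then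
     {x. x \<in> slice A e s (\<kappa> s 0) (\<kappa> s 1) (\<kappa> s 2) \<and> exponent_key S (e x) = exponent_key S \<kappa>} else {})"
  proof -
    have *: "exponent_key (insert s S) (e x) = \<kappa> \<longleftrightarrow> (\<forall>t i. (t, i) \<notin> insert s S \<times> {..<3} \<longrightarrow> \<kappa> t i = 0) \<and>
       e x s 0 = \<kappa> s 0 \<and> e x s 1 = \<kappa> s 1 \<and> e x s 2 = \<kappa> s 2 \<and> exponent_key S (e x) = exponent_key S \<kappa>" for x
    proof -
      have "exponent_key (insert s S) (e x) = \<kappa> \<longleftrightarrow> (\<forall>t i. (t, i) \<notin> insert s S \<times> {..<3} \<longrightarrow> \<kappa> t i = 0) \<and>
         (\<forall>i<3. e x s i = \<kappa> s i) \<and> exponent_key S (e x) = exponent_key S \<kappa>"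
        unfolding exponent_key_def fun_eq_iff using assms(1) by (auto split: if_splits)
      then show ?thesis
        by (simp add: numeral_3_eq_3 All_less_Suc numeral_2_eq_2 conj_ac)
    qed
    show ?thesis by (subst *) auto
  qed
  then show "(\<Sum>x | x \<in> A \<and> exponent_key (insert s S) (e x) = \<kappa>. c x) = 0"
    using assms(2)[of "\<kappa> s 0" "\<kappa> s 1" "\<kappa> s 2"] by (auto simp: cancels_def split: if_splits)
qed

text \<open>The coefficient of \<open>u ^ a * v ^ b * w ^ d\<close> when the combination is expanded
  in the coordinates (u, v, w) of the point s; it is a function of the remaining points.\<close>

definition slice_sum :: "nat set \<Rightarrow> nat set \<Rightarrow> (nat \<Rightarrow> complex) \<Rightarrow> (nat \<Rightarrow> nat \<Rightarrow> nat \<Rightarrow> nat) \<Rightarrow> nat \<Rightarrow> nat \<Rightarrow> nat \<Rightarrow> nat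
    \<Rightarrow> (nat \<Rightarrow> nat \<Rightarrow> complex) \<Rightarrow> complex" where
  "slice_sum S A c e s a b d Y = (\<Sum>x\<in>slice A e s a b d. c x * power_product S (e x) Y)"

definition triple :: "complex \<Rightarrow> complex \<Rightarrow> complex \<Rightarrow> nat \<Rightarrow> complex" where
  "triple u v w = (\<lambda>i. if i = 0 then u else if i = 1 then v else w)"

lemma triple_simps [simp]: "triple u v w 0 = u" "triple u v w (Suc 0) = v" "triple u v w 1 = v" "triple u v w 2 = w"
  by (auto simp: triple_def)

lemma power_product_cong: "(\<And>s i. s \<in> S \<Longrightarrow> i < 3 \<Longrightarrow> Y s i = Y' s i) \<Longrightarrow> power_product S e Y = power_product S e Y'"
  unfolding power_product_def by (intro prod.cong) auto

lemma slice_sum_cong: "(\<And>s i. s \<in> S \<Longrightarrow> i < 3 \<Longrightarrow> Y s i = Y' s i) \<Longrightarrow> slice_sum S A c e t a b d Y = slice_sum S A c e t a b d Y'"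
  unfolding slice_sum_def by (intro sum.cong refl arg_cong2[where f="(*)"] power_product_cong)

lemma sum_delta3:
  fixes f :: "nat \<Rightarrow> nat \<Rightarrow> nat \<Rightarrow> complex"
  assumes "p \<le> N" "q \<le> N" "r \<le> N"
  shows "(\<Sum>a\<le>N. \<Sum>b\<le>N. \<Sum>d\<le>N. if p = a \<and> q = b \<and> r = d then f a b d else 0) = f p q r"
proof -
  have "(\<Sum>d\<le>N. if p = a \<and> q = b \<and> r = d then f a b d else 0) = (if p = a \<and> q = b then f a b r else 0)" for a b
    using assms by (cases "p = a \<and> q = b") auto
  moreover have "(\<Sum>b\<le>N. if p = a \<and> q = b then f a b r else 0) = (if p = a then f a q r else 0)" for a
    using assms by (cases "p = a") auto
  ultimately show ?thesis
    using assms by simp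
qed

lemma sum_expand:
  assumes S: "finite S" "s \<notin> S" and A: "finite A"
    and N: "\<And>x. x \<in> A \<Longrightarrow> e x s 0 \<le> N \<and> e x s 1 \<le> N \<and> e x s 2 \<le> N"
  shows "(\<Sum>x\<in>A. c x * power_product (insert s S) (e x) (Y(s := triple u v w))) =
    (\<Sum>a\<le>N. \<Sum>b\<le>N. \<Sum>d\<le>N. u ^ a * v ^ b * w ^ d * slice_sum S A c e s a b d Y)"
proof -
  have "(\<Sum>a\<le>N. \<Sum>b\<le>N. \<Sum>d\<le>N. u ^ a * v ^ b * w ^ d * slice_sum S A c e s a b d Y) =
     (\<Sum>a\<le>N. \<Sum>b\<le>N. \<Sum>d\<le>N. \<Sum>x\<in>A. if e x s 0 = a \<and> e x s 1 = b \<and> e x s 2 = d then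
        u ^ a * v ^ b * w ^ d * (c x * power_product S (e x) Y) else 0)"
    unfolding slice_sum_def sum_distrib_left sum.inter_filter[OF A, symmetric] ..
  also have "\<dots> = (\<Sum>x\<in>A. \<Sum>a\<le>N. \<Sum>b\<le>N. \<Sum>d\<le>N. if e x s 0 = a \<and> e x s 1 = b \<and> e x s 2 = d then
        u ^ a * v ^ b * w ^ d * (c x * power_product S (e x) Y) else 0)"
    by (simp only: sum.swap[of _ _ A])
  also have "\<dots> = (\<Sum>x\<in>A. c x * power_product (insert s S) (e x) (Y(s := triple u v w)))"
  proof (intro sum.cong refl)
    fix x assume x: "x \<in> A"
    have m: "power_product S (e x) (Y(s := triple u v w)) = power_product S (e x) Y"
      by (rule power_product_cong) (use S in auto)
    have "(\<Sum>a\<le>N. \<Sum>b\<le>N. \<Sum>d\<le>N. if e x s 0 = a \<and> e x s 1 = b \<and> e x s 2 = d then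
        u ^ a * v ^ b * w ^ d * (c x * power_product S (e x) Y) else 0) =
      u ^ e x s 0 * v ^ e x s 1 * w ^ e x s 2 * (c x * power_product S (e x) Y)"
      using N[OF x] by (intro sum_delta3) auto
    also have "\<dots> = c x * power_product (insert s S) (e x) (Y(s := triple u v w))"
      using S by (simp add: power_product_insert m mult_ac)
    finally show "(\<Sum>a\<le>N. \<Sum>b\<le>N. \<Sum>d\<le>N. if e x s 0 = a \<and> e x s 1 = b \<and> e x s 2 = d then
        u ^ a * v ^ b * w ^ d * (c x * power_product S (e x) Y) else 0) = c x * power_product (insert s S) (e x) (Y(s := triple u v w))" .
  qed
  finally show ?thesis ..
qed

lemma exponent_bound:
  fixes e :: "nat \<Rightarrow> nat \<Rightarrow> nat \<Rightarrow> nat"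
  assumes "finite A"
  obtains N :: nat where "\<And>x. x \<in> A \<Longrightarrow> e x s 0 \<le> N \<and> e x s 1 \<le> N \<and> e x s 2 \<le> N"
proof
  show "e x s 0 \<le> (\<Sum>x\<in>A. e x s 0 + e x s 1 + e x s 2) \<and> e x s 1 \<le> (\<Sum>x\<in>A. e x s 0 + e x s 1 + e x s 2)
     \<and> e x s 2 \<le> (\<Sum>x\<in>A. e x s 0 + e x s 1 + e x s 2)" if "x \<in> A" for x
    using member_le_sum[OF that, of "\<lambda>x. e x s 0 + e x s 1 + e x s 2"] assms by simp
qed

section \<open>Comparison of coefficients and limits at 0\<close>

lemma poly_coeffs_zero:
  fixes g :: "nat \<Rightarrow> complex"
  assumes "finite F" "\<And>z. z \<notin> F \<Longrightarrow> (\<Sum>a\<le>N. z ^ a * g a) = 0" "a \<le> N"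
  shows "g a = 0"
proof (rule ccontr)
  assume "g a \<noteq> 0"
  then have "finite {z. (\<Sum>i\<le>N. g i * z ^ i) = 0}"
    by (rule polyfun_roots_finite[OF _ assms(3)])
  moreover have "UNIV \<subseteq> F \<union> {z. (\<Sum>i\<le>N. g i * z ^ i) = 0}"
    using assms(2) by (auto simp: mult.commute)
  ultimately have "finite (UNIV :: complex set)"
    using assms(1) finite_subset by blast
  then show False
    using infinite_UNIV_char_0 by blast
qed

text \<open>The excluded values of v may depend on u, as they do for the open condition
  \<open>\<beta> * u + \<gamma> * v \<noteq> 0\<close>.\<close>

lemma poly2_coeffs_zero:
  fixes g :: "nat \<Rightarrow> nat \<Rightarrow> complex"
  assumes F: "finite F" "\<And>u. finite (G u)"
    and "\<And>u v. u \<notin> F \<Longrightarrow> v \<notin> G u \<Longrightarrow> (\<Sum>a\<le>N. \<Sum>b\<le>N. u ^ a * v ^ b * g a b) = 0" "a \<le> N" "b \<le> N"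
  shows "g a b = 0"
proof -
  have "(\<Sum>a\<le>N. u ^ a * g a b) = 0" if "u \<notin> F" for u
  proof (rule poly_coeffs_zero[OF F(2) _ assms(5), where g = "\<lambda>b. \<Sum>a\<le>N. u ^ a * g a b"])
    fix v assume "v \<notin> G u"
    from assms(3)[OF that this] show "(\<Sum>b\<le>N. v ^ b * (\<Sum>a\<le>N. u ^ a * g a b)) = 0"
      by (subst (asm) sum.swap) (simp add: sum_distrib_left mult_ac)
  qed
  then show ?thesis
    using poly_coeffs_zero[OF F(1) _ assms(4), of "\<lambda>a. g a b"] by blast
qed

text \<open>Every degeneration ends here: the relation holds for small nonzero parameters and is
  wanted at the limit configuration.\<close>

lemma punctured_limit_0:
  fixes f :: "complex \<Rightarrow> complex"
  assumes "isCont f 0" "eventually (\<lambda>z. f z = 0) (at 0)"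
  shows "f 0 = 0"
proof -
  have "(f \<longlongrightarrow> 0) (at 0)"
    using assms(2) by (rule tendsto_eventually)
  with assms(1) show ?thesis
    unfolding isCont_def using LIM_unique by blast
qed

lemma isCont_power_product:
  assumes "\<And>s i. s \<in> S \<Longrightarrow> i < 3 \<Longrightarrow> isCont (\<lambda>z. Y z s i) (0::complex)"
  shows "isCont (\<lambda>z. power_product S e (Y z)) 0"
  unfolding power_product_def by (intro continuous_intros assms) auto

lemma isCont_slice_sum:
  assumes "\<And>s i. s \<in> S \<Longrightarrow> i < 3 \<Longrightarrow> isCont (\<lambda>z. Y z s i) (0::complex)"
  shows "isCont (\<lambda>z. slice_sum S A c e t a b d (Y z)) 0"
  unfolding slice_sum_def by (intro continuous_intros isCont_power_product assms) auto

lemma isCont_if: "(\<not> Q \<Longrightarrow> isCont g x) \<Longrightarrow> (Q \<Longrightarrow> isCont f x) \<Longrightarrow> isCont (\<lambda>z. if Q then f z else g z) x"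
  by (cases Q) auto

text \<open>\<open>cancels\<close> yields vanishing at every configuration and not only on the locus
  at hand, so slices already settled also drop out at perturbed configurations.\<close>

lemma slice_sum_eq_0:
  assumes "finite A" "cancels S (slice A e s a b d) c e"
  shows "slice_sum S A c e s a b d Y = 0"
  unfolding slice_sum_def by (rule cancels_sum_eq_0) (use assms in auto)

text \<open>The conics through the three coordinate points are \<open>\<alpha> u v + \<beta> u w + \<gamma> v w = 0\<close>; the cases
  \<open>\<alpha> = 0\<close> and \<open>\<alpha> = \<beta> = 0\<close> are the successive degenerations \<open>w (\<beta> u + \<gamma> v) = 0\<close> and \<open>v w = 0\<close>.\<close>

definition axes :: "nat set \<Rightarrow> (nat \<Rightarrow> nat \<Rightarrow> complex) set" where
  "axes S = {Y. \<forall>s\<in>S. (Y s 2 = 0 \<and> Y s 1 \<noteq> 0) \<or> (Y s 1 = 0 \<and> Y s 2 \<noteq> 0)}"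

definition line_pairs :: "nat set \<Rightarrow> (nat \<Rightarrow> nat \<Rightarrow> complex) set" where
  "line_pairs S = {Y. \<exists>\<beta> \<gamma>. \<beta> \<noteq> 0 \<and> \<gamma> \<noteq> 0 \<and> (\<forall>s\<in>S. (Y s 2 = 0 \<and> \<beta> * Y s 0 + \<gamma> * Y s 1 \<noteq> 0) \<or>
      (\<beta> * Y s 0 + \<gamma> * Y s 1 = 0 \<and> Y s 2 \<noteq> 0))}"

definition conic :: "complex \<Rightarrow> complex \<Rightarrow> complex \<Rightarrow> (nat \<Rightarrow> complex) \<Rightarrow> bool" where
  "conic \<alpha> \<beta> \<gamma> y \<longleftrightarrow> \<alpha> * y 0 * y 1 + \<beta> * y 0 * y 2 + \<gamma> * y 1 * y 2 = 0"

lemma conic_triple: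
  "conic \<alpha> \<beta> \<gamma> (triple u v w) \<longleftrightarrow> \<alpha> * u * v + w * (\<beta> * u + \<gamma> * v) = 0"
  "conic \<alpha> \<beta> \<gamma> (triple u v w) \<longleftrightarrow> \<beta> * u * w + v * (\<alpha> * u + \<gamma> * w) = 0"
  by (simp_all add: conic_def algebra_simps)

definition smooth_conics :: "nat set \<Rightarrow> (nat \<Rightarrow> nat \<Rightarrow> complex) set" where
  "smooth_conics S = {Y. \<exists>\<alpha> \<beta> \<gamma>. \<alpha> \<noteq> 0 \<and> \<beta> \<noteq> 0 \<and> \<gamma> \<noteq> 0 \<and> (\<forall>s\<in>S. conic \<alpha> \<beta> \<gamma> (Y s))}"

text \<open>The diagonal terms of the maximal minors of the matrix with columns \<open>(u v, u w, v w)\<close> are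
  \<open>(u v)\<^sub>i (u w)\<^sub>j (v w)\<^sub>k\<close> with \<open>i < j < k\<close>; \<open>std3\<close> are the exponents not divisible by any of them.
  \<open>std2\<close> and \<open>std1\<close> arise in the same way from the last two rows and from the last row.\<close>

definition std1 :: "nat set \<Rightarrow> (nat \<Rightarrow> nat \<Rightarrow> nat) \<Rightarrow> bool" where
  "std1 S e \<longleftrightarrow> (\<forall>k\<in>S. e k 1 = 0 \<or> e k 2 = 0)"

definition std2 :: "nat set \<Rightarrow> (nat \<Rightarrow> nat \<Rightarrow> nat) \<Rightarrow> bool" where
  "std2 S e \<longleftrightarrow> (\<forall>j\<in>S. \<forall>k\<in>S. j < k \<longrightarrow> e j 0 = 0 \<or> e j 2 = 0 \<or> e k 1 = 0 \<or> e k 2 = 0)"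

definition std3 :: "nat set \<Rightarrow> (nat \<Rightarrow> nat \<Rightarrow> nat) \<Rightarrow> bool" where
  "std3 S e \<longleftrightarrow> (\<forall>i\<in>S. \<forall>j\<in>S. \<forall>k\<in>S. i < j \<longrightarrow> j < k \<longrightarrow>
     e i 0 = 0 \<or> e i 1 = 0 \<or> e j 0 = 0 \<or> e j 2 = 0 \<or> e k 1 = 0 \<or> e k 2 = 0)"

lemma std3_insert:
  assumes e: "std3 (insert s S) e" and s: "\<forall>k\<in>S. s < k" "e s 0 \<noteq> 0" "e s 1 \<noteq> 0"
  shows "std2 S e"
  unfolding std2_def
proof (intro ballI impI)
  fix j k assume jk: "j \<in> S" "k \<in> S" "j < k"
  have *: "\<lbrakk>i \<in> insert s S; j \<in> insert s S; k \<in> insert s S; i < j; j < k\<rbrakk> \<Longrightarrow>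
     e i 0 = 0 \<or> e i 1 = 0 \<or> e j 0 = 0 \<or> e j 2 = 0 \<or> e k 1 = 0 \<or> e k 2 = 0" for i j k
    using e unfolding std3_def by metis
  from *[of s j k] jk s show "e j 0 = 0 \<or> e j 2 = 0 \<or> e k 1 = 0 \<or> e k 2 = 0"
    by simp
qed

section \<open>Independence by induction on the set of labels\<close>

lemma independent_on_empty:
  assumes "Z \<noteq> {}"
  shows "independent_on {} P Z"
  unfolding independent_on_def cancels_def
proof (intro allI impI)
  fix A c e \<kappa>
  assume "\<forall>Y\<in>Z. (\<Sum>x\<in>A. c x * power_product {} (e x) Y) = 0"
  with assms have "(\<Sum>x\<in>A. c x) = 0" by (auto simp: power_product_def)
  moreover have "{x. x \<in> A \<and> exponent_key {} (e x) = \<kappa>} = (if \<kappa> = (\<lambda>s i. 0) then A else {})"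
    by (auto simp: exponent_key_def)
  ultimately show "(\<Sum>x | x \<in> A \<and> exponent_key {} (e x) = \<kappa>. c x) = 0"
    by simp
qed

lemma sum_pow0: "(\<Sum>b\<le>(N::nat). (0::complex) ^ b * f b) = f 0"
proof -
  have "(\<Sum>b\<le>N. (0::complex) ^ b * f b) = (\<Sum>b\<le>N. if b = 0 then f b else 0)"
    by (intro sum.cong) (auto simp: power_0_left)
  then show ?thesis by simp
qed

lemma cancels_empty: "cancels S {} c e"
  by (simp add: cancels_def)

text \<open>Reduces the inductive step to the single coefficients: from the polynomial identity in
  the coordinates (u, v, w) of the point s, each slice has to be shown to cancel on the remaining
  labels.\<close>

lemma independent_on_insertI:
  assumes S: "finite S" "s \<notin> S"
    and step: "\<And>A c e N a b d. finite A \<Longrightarrow> (\<And>x. x \<in> A \<Longrightarrow> P (e x)) \<Longrightarrow>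
      (\<And>x. x \<in> A \<Longrightarrow> e x s 0 \<le> N \<and> e x s 1 \<le> N \<and> e x s 2 \<le> N) \<Longrightarrow>
      (\<And>Y u v w. Y(s := triple u v w) \<in> Z \<Longrightarrow>
        (\<Sum>a\<le>N. \<Sum>b\<le>N. \<Sum>d\<le>N. u ^ a * v ^ b * w ^ d * slice_sum S A c e s a b d Y) = 0) \<Longrightarrow>
      cancels S (slice A e s a b d) c e"
  shows "independent_on (insert s S) P Z"
  unfolding independent_on_def
proof (intro allI impI)
  fix A :: "nat set" and c e
  assume A: "finite A" and std: "\<forall>x\<in>A. P (e x)"
    and van: "\<forall>Y\<in>Z. (\<Sum>x\<in>A. c x * power_product (insert s S) (e x) Y) = 0"
  obtain N where N: "\<And>x. x \<in> A \<Longrightarrow> e x s 0 \<le> N \<and> e x s 1 \<le> N \<and> e x s 2 \<le> N"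
    by (rule exponent_bound[OF A, where e = e and s = s]) blast
  show "cancels (insert s S) A c e"
  proof (rule cancels_insert[OF S(2)], rule step[where e = e and N = N, OF A])
    fix Y u v w assume "Y(s := triple u v w) \<in> Z"
    with van have "(\<Sum>x\<in>A. c x * power_product (insert s S) (e x) (Y(s := triple u v w))) = 0" by blast
    then show "(\<Sum>a\<le>N. \<Sum>b\<le>N. \<Sum>d\<le>N. u ^ a * v ^ b * w ^ d * slice_sum S A c e s a b d Y) = 0"
      by (subst (asm) sum_expand[OF S A, where N = N]) (use N in auto)
  qed (use std N in auto)
qed

lemma cancels_sliceI:
  assumes "independent_on S P Z" "finite A" "\<And>x. x \<in> slice A e s a b d \<Longrightarrow> P (e x)"
    "\<And>Y. Y \<in> Z \<Longrightarrow> slice_sum S A c e s a b d Y = 0"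
  shows "cancels S (slice A e s a b d) c e"
  by (rule independent_onD[OF assms(1)]) (use assms in \<open>auto simp: slice_sum_def\<close>)

text \<open>A point on the line w = 0 isolates the coefficients with d = 0, and a point on v = 0
  those with b = 0. The condition \<open>std1\<close> leaves no others.\<close>

lemma independent_std1:
  assumes "finite S"
  shows "independent_on S (std1 S) (axes S)"
  using assms
proof (induction S)
  case empty
  show ?case by (rule independent_on_empty) (auto simp: axes_def)
next
  case (insert s S)
  show ?case
  proof (rule independent_on_insertI[OF insert.hyps])
    fix A :: "nat set" and c e N a b d
    assume A: "finite A" and std: "\<And>x. x \<in> A \<Longrightarrow> std1 (insert s S) (e x)"
      and N: "\<And>x. x \<in> A \<Longrightarrow> e x s 0 \<le> N \<and> e x s 1 \<le> N \<and> e x s 2 \<le> N"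
      and van: "\<And>Y u v w. Y(s := triple u v w) \<in> axes (insert s S) \<Longrightarrow>
        (\<Sum>a\<le>N. \<Sum>b\<le>N. \<Sum>d\<le>N. u ^ a * v ^ b * w ^ d * slice_sum S A c e s a b d Y) = 0"
    have ex: "(\<Sum>a\<le>N. \<Sum>b\<le>N. \<Sum>d\<le>N. u ^ a * v ^ b * w ^ d * slice_sum S A c e s a b d Y) = 0"
      if "Y \<in> axes S" "(w = 0 \<and> v \<noteq> 0) \<or> (v = 0 \<and> w \<noteq> 0)" for u v w Y
      using that insert.hyps by (intro van) (auto simp: axes_def)
    have z1: "slice_sum S A c e s a b 0 Y = 0" if Y: "Y \<in> axes S" and ab: "a \<le> N" "b \<le> N" for a b Y
    proof (rule poly2_coeffs_zero[OF _ _ _ ab, of "{}" "\<lambda>_. {0}" "\<lambda>a b. slice_sum S A c e s a b 0 Y"])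
      fix u v :: complex assume "v \<notin> {0}"
      then show "(\<Sum>a\<le>N. \<Sum>b\<le>N. u ^ a * v ^ b * slice_sum S A c e s a b 0 Y) = 0"
        using ex[OF Y, of 0 v u]
        by (simp add: mult.assoc sum_pow0 flip: sum_distrib_left)
    qed auto
    have z2: "slice_sum S A c e s a 0 b Y = 0" if Y: "Y \<in> axes S" and ab: "a \<le> N" "b \<le> N" for a b Y
    proof (rule poly2_coeffs_zero[OF _ _ _ ab, of "{}" "\<lambda>_. {0}" "\<lambda>a b. slice_sum S A c e s a 0 b Y"])
      fix u v :: complex assume "v \<notin> {0}"
      then show "(\<Sum>a\<le>N. \<Sum>b\<le>N. u ^ a * v ^ b * slice_sum S A c e s a 0 b Y) = 0"
        using ex[OF Y, of v 0 u]
        by (simp add: mult.assoc sum_pow0 flip: sum_distrib_left)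
    qed auto
    show "cancels S (slice A e s a b d) c e"
    proof (cases "slice A e s a b d = {}")
      case True then show ?thesis by (simp only: cancels_empty)
    next
      case False
      then obtain x where x: "x \<in> slice A e s a b d" by blast
      then have le: "a \<le> N" "b \<le> N" "d \<le> N" using N by auto
      from x std[of x] have bd: "b = 0 \<or> d = 0" by (auto simp: std1_def)
      show ?thesis
      proof (rule cancels_sliceI[OF insert.IH A])
        show "std1 S (e x)" if "x \<in> slice A e s a b d" for x
          using std[of x] that by (auto simp: std1_def)
        show "slice_sum S A c e s a b d Y = 0" if "Y \<in> axes S" for Y
          using bd z1[OF that le(1,2)] z2[OF that le(1,3)] by blast
      qed
    qed
  qed
qed

text \<open>Division by the lowest power of w that can occur. The guard \<open>d < m\<close> removes
  the terms for which the truncated difference \<open>d - m\<close> would be a spurious 0.\<close>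

lemma sum_power_diff_eq_0:
  fixes h :: "nat \<Rightarrow> complex"
  assumes "(\<Sum>d\<le>N. w ^ d * h d) = 0" "\<And>d. d < m \<Longrightarrow> h d = 0" "w \<noteq> 0"
  shows "(\<Sum>d\<le>N. (if d < m then 0 else w ^ (d - m) * h d)) = 0"
proof -
  have "w ^ m * (\<Sum>d\<le>N. (if d < m then 0 else w ^ (d - m) * h d)) = (\<Sum>d\<le>N. w ^ d * h d)"
    unfolding sum_distrib_left
    by (intro sum.cong refl) (use assms(2) in \<open>auto simp flip: power_add mult.assoc\<close>)
  with assms show ?thesis by simp
qed

lemma sum_shift0: "m \<le> N \<Longrightarrow> (\<Sum>d\<le>N. (if d < m then 0 else (0::complex) ^ (d - m) * h d)) = h m"
proof -
  assume "m \<le> N"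
  have "(\<Sum>d\<le>N. (if d < m then 0 else (0::complex) ^ (d - m) * h d)) = (\<Sum>d\<le>N. if d = m then h d else 0)"
    by (intro sum.cong) (auto simp: power_0_left)
  with \<open>m \<le> N\<close> show ?thesis by simp
qed

text \<open>Once the smallest label is split off, a coefficient whose monomial contains \<open>u w\<close> is only known to
  satisfy the weaker condition \<open>std1\<close>.  It is detected by the degeneration \<open>\<beta> \<rightarrow> 0\<close>, in which the
  remaining points move to the pair of lines \<open>v w = 0\<close>.\<close>

lemma independent_std2:
  assumes "finite S"
  shows "independent_on S (std2 S) (line_pairs S)"
  using assms
proof (induction S rule: finite_linorder_min_induct)
  case empty
  have "(\<lambda>s i. 0) \<in> line_pairs {}" by (auto simp: line_pairs_def intro: exI[of _ 1])
  then show ?case by (intro independent_on_empty) blast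
next
  case (insert s S)
  then have sS: "s \<notin> S" by auto
  show ?case
  proof (rule independent_on_insertI[OF insert.hyps(1) sS])
    fix A :: "nat set" and c e N a b d
    assume A: "finite A" and std: "\<And>x. x \<in> A \<Longrightarrow> std2 (insert s S) (e x)"
      and N: "\<And>x. x \<in> A \<Longrightarrow> e x s 0 \<le> N \<and> e x s 1 \<le> N \<and> e x s 2 \<le> N"
      and van: "\<And>Y u v w. Y(s := triple u v w) \<in> line_pairs (insert s S) \<Longrightarrow>
        (\<Sum>a\<le>N. \<Sum>b\<le>N. \<Sum>d\<le>N. u ^ a * v ^ b * w ^ d * slice_sum S A c e s a b d Y) = 0"
    let ?g = "slice_sum S A c e s"
    let ?on = "\<lambda>\<beta> \<gamma> Y. \<forall>t\<in>S. (Y t 2 = 0 \<and> \<beta> * Y t 0 + \<gamma> * Y t 1 \<noteq> (0::complex)) \<or>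
      (\<beta> * Y t 0 + \<gamma> * Y t 1 = 0 \<and> Y t 2 \<noteq> 0)"
    have ex: "(\<Sum>a\<le>N. \<Sum>b\<le>N. \<Sum>d\<le>N. u ^ a * v ^ b * w ^ d * ?g a b d Y) = 0"
      if "\<beta> \<noteq> 0" "\<gamma> \<noteq> 0" "?on \<beta> \<gamma> Y" "(w = 0 \<and> \<beta> * u + \<gamma> * v \<noteq> 0) \<or> (\<beta> * u + \<gamma> * v = 0 \<and> w \<noteq> 0)"
      for \<beta> \<gamma> u v w Y
    proof (rule van)
      have "?on \<beta> \<gamma> (Y(s := triple u v w))" using that(3) sS by (metis fun_upd_other)
      then show "Y(s := triple u v w) \<in> line_pairs (insert s S)"
        unfolding line_pairs_def using that by (intro CollectI exI[of _ \<beta>] exI[of _ \<gamma>]) (auto simp del: fun_upd_apply simp: fun_upd_same)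
    qed
    have std2_S: "std2 S (e x)" if "x \<in> A" for x
      using std[OF that] by (auto simp: std2_def)
    \<comment> \<open>With the point s on the line w = 0, its coordinates u and v are free apart
      from \<open>\<beta> * u + \<gamma> * v \<noteq> 0\<close>.\<close>
    have w0: "cancels S (slice A e s a b 0) c e" for a b
    proof (cases "slice A e s a b 0 = {}")
      case False
      then have ab: "a \<le> N" "b \<le> N" using N by auto
      show ?thesis
      proof (rule cancels_sliceI[OF insert.IH A])
        fix Y assume "Y \<in> line_pairs S"
        then obtain \<beta> \<gamma> where bg: "\<beta> \<noteq> 0" "\<gamma> \<noteq> 0" "?on \<beta> \<gamma> Y" by (auto simp: line_pairs_def)
        show "?g a b 0 Y = 0"
        proof (rule poly2_coeffs_zero[OF _ _ _ ab, of "{}" "\<lambda>u. {- \<beta> * u / \<gamma>}" "\<lambda>a b. ?g a b 0 Y"])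
          fix u v :: complex assume "v \<notin> {- \<beta> * u / \<gamma>}"
          then have "\<beta> * u + \<gamma> * v \<noteq> 0" using bg(2) by (auto simp: field_simps add_eq_0_iff)
          then show "(\<Sum>a\<le>N. \<Sum>b\<le>N. u ^ a * v ^ b * ?g a b 0 Y) = 0"
            using ex[OF bg, of 0 u v] by (simp add: mult.assoc sum_pow0 flip: sum_distrib_left)
        qed auto
      qed (use std2_S in auto)
    qed (simp only: cancels_empty)
    \<comment> \<open>On the other line v is a multiple of u, which merges all monomials with the
      same degree m = a + b in u and v; \<open>?h\<close> selects that degree.\<close>
    let ?h = "\<lambda>m d b Y. \<Sum>a\<le>N. if a + b = m then ?g a b d Y else 0"
    have line: "(\<Sum>b\<le>N. (- \<beta> / \<gamma>) ^ b * ?h m d b Y) = 0"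
      if bg: "\<beta> \<noteq> 0" "\<gamma> \<noteq> 0" "?on \<beta> \<gamma> Y" and d: "d \<noteq> 0" "d \<le> N" and m: "m \<le> 2 * N" for \<beta> \<gamma> Y m d
    proof (rule poly_coeffs_zero[OF _ _ m, of "{}" "\<lambda>m. \<Sum>b\<le>N. (- \<beta> / \<gamma>) ^ b * ?h m d b Y"])
      fix u
      have "(\<Sum>a\<le>N. \<Sum>b\<le>N. u ^ a * (- \<beta> / \<gamma> * u) ^ b * ?g a b d Y) = 0"
      proof (rule poly_coeffs_zero[OF _ _ d(2), of "{0}" "\<lambda>d. \<Sum>a\<le>N. \<Sum>b\<le>N. u ^ a * (- \<beta> / \<gamma> * u) ^ b * ?g a b d Y"])
        fix w :: complex assume "w \<notin> {0}"
        then have "(\<Sum>a\<le>N. \<Sum>b\<le>N. \<Sum>d\<le>N. u ^ a * (- \<beta> / \<gamma> * u) ^ b * w ^ d * ?g a b d Y) = 0"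
          using bg(2) by (intro ex[OF bg]) auto
        also have "(\<Sum>a\<le>N. \<Sum>b\<le>N. \<Sum>d\<le>N. u ^ a * (- \<beta> / \<gamma> * u) ^ b * w ^ d * ?g a b d Y) =
            (\<Sum>a\<le>N. \<Sum>d\<le>N. \<Sum>b\<le>N. u ^ a * (- \<beta> / \<gamma> * u) ^ b * w ^ d * ?g a b d Y)"
          by (intro sum.cong refl sum.swap)
        also have "\<dots> = (\<Sum>d\<le>N. \<Sum>a\<le>N. \<Sum>b\<le>N. u ^ a * (- \<beta> / \<gamma> * u) ^ b * w ^ d * ?g a b d Y)"
          by (rule sum.swap)
        finally show "(\<Sum>d\<le>N. w ^ d * (\<Sum>a\<le>N. \<Sum>b\<le>N. u ^ a * (- \<beta> / \<gamma> * u) ^ b * ?g a b d Y)) = 0"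
          by (simp add: sum_distrib_left mult_ac)
      qed auto
      also have "(\<Sum>a\<le>N. \<Sum>b\<le>N. u ^ a * (- \<beta> / \<gamma> * u) ^ b * ?g a b d Y) =
          (\<Sum>a\<le>N. \<Sum>b\<le>N. \<Sum>m\<le>2*N. if a + b = m then u ^ m * (- \<beta> / \<gamma>) ^ b * ?g a b d Y else 0)"
        unfolding power_mult_distrib[of "- \<beta> / \<gamma>" u] by (intro sum.cong refl) (simp add: power_add mult_ac)
      also have "\<dots> = (\<Sum>m\<le>2*N. \<Sum>b\<le>N. \<Sum>a\<le>N. if a + b = m then u ^ m * (- \<beta> / \<gamma>) ^ b * ?g a b d Y else 0)"
        by (subst sum.swap, subst (2) sum.swap, subst sum.swap) simp
      also have "\<dots> = (\<Sum>m\<le>2*N. u ^ m * (\<Sum>b\<le>N. (- \<beta> / \<gamma>) ^ b * ?h m d b Y))"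
        unfolding sum_distrib_left by (intro sum.cong refl) simp
      finally show "(\<Sum>m\<le>2*N. u ^ m * (\<Sum>b\<le>N. (- \<beta> / \<gamma>) ^ b * ?h m d b Y)) = 0" .
    qed auto
    \<comment> \<open>Within one degree m the coefficients are separated in ascending order of b,
      the power of \<beta> that they carry.\<close>
    have w1: "cancels S (slice A e s a b d) c e" if "d \<noteq> 0" for a b d
    proof (induction b arbitrary: a rule: less_induct)
      case (less b)
      show ?case
      proof (cases "slice A e s a b d = {}")
        case False
        then have le: "a \<le> N" "b \<le> N" "d \<le> N" using N by auto
        have below: "?h (a + b) d b' Y = 0" if "b' < b" for b' Y
          using slice_sum_eq_0[OF A less.IH[OF that]] by (auto intro!: sum.neutral)
        have diag: "?h (a + b) d b Y = ?g a b d Y" for Y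
          using le by simp
        have line': "(\<Sum>b'\<le>N. (- \<beta> / \<gamma>) ^ b' * ?h (a + b) d b' Y) = 0"
          if "\<beta> \<noteq> 0" "\<gamma> \<noteq> 0" "?on \<beta> \<gamma> Y" for \<beta> \<gamma> Y
          by (rule line) (use that \<open>d \<noteq> 0\<close> le in auto)
        show ?thesis
        proof (cases "a = 0")
          \<comment> \<open>For a = 0 the exponent b is the whole degree, so no larger exponent
            occurs and the relation on the line has a single remaining term.\<close>
          case True
          show ?thesis
          proof (rule cancels_sliceI[OF insert.IH A])
            fix Y assume "Y \<in> line_pairs S"
            then obtain \<beta> \<gamma> where bg: "\<beta> \<noteq> 0" "\<gamma> \<noteq> 0" "?on \<beta> \<gamma> Y" by (auto simp: line_pairs_def)
            have "?h (a + b) d b' Y = 0" if "b' \<noteq> b" for b'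
            proof (cases "b' < b")
              case False
              with True that show ?thesis by (intro sum.neutral) auto
            qed (rule below)
            then have "(\<Sum>b'\<le>N. (- \<beta> / \<gamma>) ^ b' * ?h (a + b) d b' Y) =
                (\<Sum>b'\<le>N. if b' = b then (- \<beta> / \<gamma>) ^ b * ?h (a + b) d b Y else 0)"
              by (intro sum.cong refl) (simp split: if_split)
            also have "\<dots> = (- \<beta> / \<gamma>) ^ b * ?g a b d Y"
              using le diag by simp
            finally show "?g a b d Y = 0"
              using line'[OF bg] bg le by simp
          qed (use std2_S in auto)
        next
          case False
          show ?thesis
          proof (rule cancels_sliceI[OF independent_std1[OF insert.hyps(1)] A])
            show "std1 S (e x)" if "x \<in> slice A e s a b d" for x
              using std[of x] that insert.hyps(2) False \<open>d \<noteq> 0\<close> unfolding std1_def std2_def by fastforce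
          next
            fix Y assume Y: "Y \<in> axes S"
            \<comment> \<open>With \<gamma> = 1, the points with w = 0 stay where they are and the
              others move from v = 0 to the line \<beta> u + v = 0. Below, \<open>f\<close> is the
              relation divided by (- \<beta>) ^ b, so that only the term of exponent b survives at
              \<beta> = 0.\<close>
            define P where "P \<beta> t = (if Y t 2 = 0 then Y t else triple (Y t 0) (- \<beta> * Y t 0) (Y t 2))" for \<beta> t
            define f where "f \<beta> = (\<Sum>b'\<le>N. if b' < b then 0 else (- \<beta>) ^ (b' - b) * ?h (a + b) d b' (P \<beta>))" for \<beta>
            have "f 0 = 0"
            proof (rule punctured_limit_0)
              have "isCont (\<lambda>\<beta>. P \<beta> t i) 0" for t i
                unfolding P_def triple_def by (cases "Y t 2 = 0"; cases "i = 0"; cases "i = 1") (auto intro!: continuous_intros)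
              then have "isCont (\<lambda>\<beta>. ?g a b d (P \<beta>)) 0" for a b d
                by (intro isCont_slice_sum)
              then show "isCont f 0"
                unfolding f_def by (intro continuous_intros isCont_if)
              have "\<forall>\<^sub>F \<beta> in at 0. \<forall>t\<in>S. Y t 2 = 0 \<longrightarrow> \<beta> * Y t 0 + Y t 1 \<noteq> 0"
              proof (intro eventually_ball_finite insert.hyps ballI)
                fix t assume "t \<in> S"
                have "((\<lambda>\<beta>. \<beta> * Y t 0 + Y t 1) \<longlongrightarrow> 0 * Y t 0 + Y t 1) (at 0)"
                  by (intro tendsto_intros)
                with Y \<open>t \<in> S\<close> show "\<forall>\<^sub>F \<beta> in at 0. Y t 2 = 0 \<longrightarrow> \<beta> * Y t 0 + Y t 1 \<noteq> 0"
                  by (cases "Y t 2 = 0") (auto simp: axes_def dest: tendsto_imp_eventually_ne)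
              qed
              moreover have "\<forall>\<^sub>F \<beta> in at (0::complex). \<beta> \<noteq> 0"
                by (simp add: eventually_at_filter)
              ultimately show "\<forall>\<^sub>F \<beta> in at 0. f \<beta> = 0"
              proof eventually_elim
                case (elim \<beta>)
                have "?on \<beta> 1 (P \<beta>)"
                  using elim Y by (auto simp: P_def axes_def)
                from line'[OF elim(2) one_neq_zero this] le
                have "(\<Sum>b'\<le>N. (- \<beta>) ^ b' * ?h (a + b) d b' (P \<beta>)) = 0" by simp
                from sum_power_diff_eq_0[OF this below] elim show ?case
                  by (simp add: f_def)
              qed
            qed
            moreover have "f 0 = ?h (a + b) d b (P 0)"
              unfolding f_def minus_zero by (rule sum_shift0[OF le(2)])
            moreover have "?g a b d (P 0) = ?g a b d Y"
              by (rule slice_sum_cong) (use Y in \<open>auto simp: P_def triple_def axes_def less_Suc_eq numeral_3_eq_3 numeral_2_eq_2\<close>)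
            ultimately show "?g a b d Y = 0"
              using diag by simp
          qed
        qed
      qed (simp only: cancels_empty)
    qed
    show "cancels S (slice A e s a b d) c e"
      using w0 w1 by (cases "d = 0") auto
  qed
qed

text \<open>On the conic, the smallest point satisfies \<open>w = - \<alpha> u v / (\<beta> u + \<gamma> v)\<close>.  In ascending order of the
  exponent of \<open>w\<close>, the limits \<open>v \<rightarrow> 0\<close> and \<open>u \<rightarrow> 0\<close> isolate the coefficients of the pure powers of \<open>u\<close>
  and \<open>v\<close>, and \<open>\<alpha> \<rightarrow> 0\<close> isolates those of the mixed monomials, on a pair of lines.\<close>

lemma independent_std3:
  assumes "finite S"
  shows "independent_on S (std3 S) (smooth_conics S)"
  using assms
proof (induction S rule: finite_linorder_min_induct)
  case empty
  have "(\<lambda>s i. 0) \<in> smooth_conics {}" by (auto simp: smooth_conics_def intro: exI[of _ 1])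
  then show ?case by (intro independent_on_empty) blast
next
  case (insert s S)
  then have sS: "s \<notin> S" by auto
  show ?case
  proof (rule independent_on_insertI[OF insert.hyps(1) sS])
    fix A :: "nat set" and c e N a b d
    assume A: "finite A" and std: "\<And>x. x \<in> A \<Longrightarrow> std3 (insert s S) (e x)"
      and N: "\<And>x. x \<in> A \<Longrightarrow> e x s 0 \<le> N \<and> e x s 1 \<le> N \<and> e x s 2 \<le> N"
      and van: "\<And>Y u v w. Y(s := triple u v w) \<in> smooth_conics (insert s S) \<Longrightarrow>
        (\<Sum>a\<le>N. \<Sum>b\<le>N. \<Sum>d\<le>N. u ^ a * v ^ b * w ^ d * slice_sum S A c e s a b d Y) = 0"
    let ?g = "slice_sum S A c e s"
    have std3_S: "std3 S (e x)" if "x \<in> A" for x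
      using std[OF that] by (auto simp: std3_def)
    have ex: "(\<Sum>a\<le>N. \<Sum>b\<le>N. \<Sum>d\<le>N. u ^ a * v ^ b * w ^ d * ?g a b d Y) = 0"
      if "\<alpha> \<noteq> 0" "\<beta> \<noteq> 0" "\<gamma> \<noteq> 0" "\<And>t. t \<in> S \<Longrightarrow> conic \<alpha> \<beta> \<gamma> (Y t)" "conic \<alpha> \<beta> \<gamma> (triple u v w)"
      for \<alpha> \<beta> \<gamma> u v w Y
      by (rule van) (use that sS in \<open>auto simp: smooth_conics_def\<close>)
    show "cancels S (slice A e s a b d) c e"
    proof (induction d arbitrary: a b rule: less_induct)
      case (less d)
      \<comment> \<open>The left-hand side of the relation divided by w ^ d. The coefficients of
        lower powers of w vanish by induction, and at w = 0 only those of w ^ d are left.\<close>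
      define h where "h u v w Y = (\<Sum>d'\<le>N. if d' < d then 0 else w ^ (d' - d) * (\<Sum>a\<le>N. \<Sum>b\<le>N. u ^ a * v ^ b * ?g a b d' Y))"
        for u v w Y
      have h0: "h u v (- \<alpha> * u * v / (\<beta> * u + \<gamma> * v)) Y = 0"
        if Y: "\<alpha> \<noteq> 0" "\<beta> \<noteq> 0" "\<gamma> \<noteq> 0" "\<And>t. t \<in> S \<Longrightarrow> conic \<alpha> \<beta> \<gamma> (Y t)" and uv: "u \<noteq> 0" "v \<noteq> 0" "\<beta> * u + \<gamma> * v \<noteq> 0"
        for \<alpha> \<beta> \<gamma> u v Y
      proof -
        let ?w = "- \<alpha> * u * v / (\<beta> * u + \<gamma> * v)"
        have "\<alpha> * u * v + ?w * (\<beta> * u + \<gamma> * v) = 0" using uv by simp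
        then have "conic \<alpha> \<beta> \<gamma> (triple u v ?w)" unfolding conic_triple(1) .
        then have "(\<Sum>a\<le>N. \<Sum>b\<le>N. \<Sum>d\<le>N. u ^ a * v ^ b * ?w ^ d * ?g a b d Y) = 0"
            using ex[where \<alpha> = \<alpha> and \<beta> = \<beta> and \<gamma> = \<gamma> and u = u and v = v and w = ?w and Y = Y] Y by blast
        also have "(\<Sum>a\<le>N. \<Sum>b\<le>N. \<Sum>d\<le>N. u ^ a * v ^ b * ?w ^ d * ?g a b d Y) =
            (\<Sum>a\<le>N. \<Sum>d\<le>N. \<Sum>b\<le>N. u ^ a * v ^ b * ?w ^ d * ?g a b d Y)"
          by (intro sum.cong refl sum.swap)
        also have "\<dots> = (\<Sum>d\<le>N. \<Sum>a\<le>N. \<Sum>b\<le>N. u ^ a * v ^ b * ?w ^ d * ?g a b d Y)"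
          by (rule sum.swap)
        finally have "(\<Sum>d\<le>N. ?w ^ d * (\<Sum>a\<le>N. \<Sum>b\<le>N. u ^ a * v ^ b * ?g a b d Y)) = 0"
          by (simp add: sum_distrib_left mult_ac)
        moreover have "(\<Sum>a\<le>N. \<Sum>b\<le>N. u ^ a * v ^ b * ?g a b d' Y) = 0" if "d' < d" for d'
          using slice_sum_eq_0[OF A less.IH[OF that]] by simp
        moreover have "?w \<noteq> 0" using Y uv by simp
        ultimately show ?thesis unfolding h_def by (rule sum_power_diff_eq_0)
      qed
      have hw0: "h u v 0 Y = (\<Sum>a\<le>N. \<Sum>b\<le>N. u ^ a * v ^ b * ?g a b d Y)" if "d \<le> N" for u v Y
        unfolding h_def by (rule sum_shift0[OF that])
      have isCont_h: "isCont (\<lambda>z. h (u z) (v z) (w z) (Y z)) 0"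
        if "isCont u (0::complex)" "isCont v 0" "isCont w 0" "\<And>t i. t \<in> S \<Longrightarrow> isCont (\<lambda>z. Y z t i) 0" for u v w Y
      proof -
        have "isCont (\<lambda>z. ?g a b d' (Y z)) 0" for a b d'
          by (rule isCont_slice_sum) (use that(4) in blast)
        then show ?thesis unfolding h_def using that(1-3) by (intro continuous_intros isCont_if)
      qed
      have ev0: "\<forall>\<^sub>F z in at (0::complex). z \<noteq> 0"
        by (simp add: eventually_at_filter)
      have ev: "\<forall>\<^sub>F z in at 0. f z \<noteq> 0" if "isCont f 0" "f 0 \<noteq> 0" for f :: "complex \<Rightarrow> complex"
        using that unfolding isCont_def by (rule tendsto_imp_eventually_ne)
      show ?case
      proof (cases "slice A e s a b d = {}")
        case False
        then have le: "a \<le> N" "b \<le> N" "d \<le> N" using N by auto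
        consider "b = 0" | "a = 0" | "a \<noteq> 0" "b \<noteq> 0" by blast
        then show ?thesis
        proof cases
          \<comment> \<open>Here only \<open>std3\<close> is inherited by the other labels, so their
            points must stay on a smooth conic. Only the point s moves, to v = 0, and w tends to 0
            with it.\<close>
          case 1
          show ?thesis
          proof (rule cancels_sliceI[OF insert.IH A])
            fix Y assume "Y \<in> smooth_conics S"
            then obtain \<alpha> \<beta> \<gamma> where Y: "\<alpha> \<noteq> 0" "\<beta> \<noteq> 0" "\<gamma> \<noteq> 0" "\<And>t. t \<in> S \<Longrightarrow> conic \<alpha> \<beta> \<gamma> (Y t)"
              by (auto simp: smooth_conics_def)
            have van0: "(\<Sum>a\<le>N. u ^ a * ?g a 0 d Y) = 0" if u: "u \<notin> {0}" for u
            proof -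
              let ?f = "\<lambda>v. h u v (- \<alpha> * u * v / (\<beta> * u + \<gamma> * v)) Y"
              have "?f 0 = 0"
              proof (rule punctured_limit_0)
                show "isCont ?f 0"
                  using Y u by (intro isCont_h continuous_intros) auto
                have "\<forall>\<^sub>F v in at 0. \<beta> * u + \<gamma> * v \<noteq> 0"
                  using Y u by (intro ev continuous_intros) auto
                with ev0 show "\<forall>\<^sub>F v in at 0. ?f v = 0"
                  by eventually_elim (rule h0[OF Y], use u in auto)
              qed
              then show ?thesis
                using hw0[OF le(3), of u 0 Y] by (simp add: mult.assoc sum_pow0 flip: sum_distrib_left)
            qed
            show "?g a b d Y = 0"
              unfolding 1 by (rule poly_coeffs_zero[where F = "{0}" and g = "\<lambda>a. ?g a 0 d Y", OF _ van0 le(1)]) simp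
          qed (use std3_S in auto)
        next
          case 2
          show ?thesis
          proof (rule cancels_sliceI[OF insert.IH A])
            fix Y assume "Y \<in> smooth_conics S"
            then obtain \<alpha> \<beta> \<gamma> where Y: "\<alpha> \<noteq> 0" "\<beta> \<noteq> 0" "\<gamma> \<noteq> 0" "\<And>t. t \<in> S \<Longrightarrow> conic \<alpha> \<beta> \<gamma> (Y t)"
              by (auto simp: smooth_conics_def)
            have van0: "(\<Sum>b\<le>N. v ^ b * ?g 0 b d Y) = 0" if v: "v \<notin> {0}" for v
            proof -
              let ?f = "\<lambda>u. h u v (- \<alpha> * u * v / (\<beta> * u + \<gamma> * v)) Y"
              have "?f 0 = 0"
              proof (rule punctured_limit_0)
                show "isCont ?f 0"
                  using Y v by (intro isCont_h continuous_intros) auto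
                have "\<forall>\<^sub>F u in at 0. \<beta> * u + \<gamma> * v \<noteq> 0"
                  using Y v by (intro ev continuous_intros) auto
                with ev0 show "\<forall>\<^sub>F u in at 0. ?f u = 0"
                  by eventually_elim (rule h0[OF Y], use v in auto)
              qed
              then show ?thesis
                using hw0[OF le(3), of 0 v Y] by (simp add: mult.assoc sum_pow0 flip: sum_distrib_left)
            qed
            show "?g a b d Y = 0"
              unfolding 2 by (rule poly_coeffs_zero[where F = "{0}" and g = "\<lambda>b. ?g 0 b d Y", OF _ van0 le(2)]) simp
          qed (use std3_S in auto)
        next
          case 3
          show ?thesis
          proof (rule cancels_sliceI[OF independent_std2[OF insert.hyps(1)] A])
            fix x assume "x \<in> slice A e s a b d"
            with std[of x] 3 insert.hyps(2) show "std2 S (e x)"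
              by (intro std3_insert[of s S "e x"]) simp_all
          next
            fix Y assume "Y \<in> line_pairs S"
            then obtain \<beta> \<gamma> where bg: "\<beta> \<noteq> 0" "\<gamma> \<noteq> 0" and on: "\<And>t. t \<in> S \<Longrightarrow> (Y t 2 = 0 \<and> \<beta> * Y t 0 + \<gamma> * Y t 1 \<noteq> 0) \<or>
                (\<beta> * Y t 0 + \<gamma> * Y t 1 = 0 \<and> Y t 2 \<noteq> 0)" by (auto simp: line_pairs_def)
            \<comment> \<open>Moves each point from the line pair onto the conic, solving for w if
              the point lies on w = 0 and for v otherwise. Both denominators are nonzero at \<alpha>
              = 0 because the point lies on exactly one of the two lines.\<close>
            define P where "P \<alpha> t = (if Y t 2 = 0 then triple (Y t 0) (Y t 1) (- \<alpha> * Y t 0 * Y t 1 / (\<beta> * Y t 0 + \<gamma> * Y t 1))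
              else triple (Y t 0) (- \<beta> * Y t 0 * Y t 2 / (\<alpha> * Y t 0 + \<gamma> * Y t 2)) (Y t 2))" for \<alpha> t
            have contP: "isCont (\<lambda>\<alpha>. P \<alpha> t i) 0" if "t \<in> S" for t i
              using on[OF that] bg unfolding P_def triple_def
              by (cases "Y t 2 = 0"; cases "i = 0"; cases "i = 1") (auto intro!: continuous_intros)
            have "\<forall>\<^sub>F \<alpha> in at 0. \<forall>t\<in>S. Y t 2 \<noteq> 0 \<longrightarrow> \<alpha> * Y t 0 + \<gamma> * Y t 2 \<noteq> 0"
            proof (intro eventually_ball_finite insert.hyps ballI)
              fix t assume "t \<in> S"
              show "\<forall>\<^sub>F \<alpha> in at 0. Y t 2 \<noteq> 0 \<longrightarrow> \<alpha> * Y t 0 + \<gamma> * Y t 2 \<noteq> 0"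
              proof (cases "Y t 2 = 0")
                case False
                have "\<forall>\<^sub>F \<alpha> in at 0. \<alpha> * Y t 0 + \<gamma> * Y t 2 \<noteq> 0"
                  using bg False by (intro ev continuous_intros) auto
                then show ?thesis by eventually_elim auto
              qed auto
            qed
            with ev0 have evP: "\<forall>\<^sub>F \<alpha> in at 0. \<alpha> \<noteq> 0 \<and> (\<forall>t\<in>S. conic \<alpha> \<beta> \<gamma> (P \<alpha> t))"
            proof eventually_elim
              case (elim \<alpha>)
              have "conic \<alpha> \<beta> \<gamma> (P \<alpha> t)" if t: "t \<in> S" for t
              proof (cases "Y t 2 = 0")
                case True
                then have nz: "\<beta> * Y t 0 + \<gamma> * Y t 1 \<noteq> 0" using on[OF t] by auto
                let ?w = "- \<alpha> * Y t 0 * Y t 1 / (\<beta> * Y t 0 + \<gamma> * Y t 1)"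
                have "\<alpha> * Y t 0 * Y t 1 + ?w * (\<beta> * Y t 0 + \<gamma> * Y t 1) = 0" using nz by simp
                then have "conic \<alpha> \<beta> \<gamma> (triple (Y t 0) (Y t 1) ?w)" unfolding conic_triple(1) .
                then show ?thesis using True by (simp add: P_def)
              next
                case False
                with elim t have nz: "\<alpha> * Y t 0 + \<gamma> * Y t 2 \<noteq> 0" by blast
                let ?v = "- \<beta> * Y t 0 * Y t 2 / (\<alpha> * Y t 0 + \<gamma> * Y t 2)"
                have "\<beta> * Y t 0 * Y t 2 + ?v * (\<alpha> * Y t 0 + \<gamma> * Y t 2) = 0" using nz by simp
                then have "conic \<alpha> \<beta> \<gamma> (triple (Y t 0) ?v (Y t 2))" unfolding conic_triple(2) .
                then show ?thesis using False by (simp add: P_def)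
              qed
              with elim show ?case by blast
            qed
            show "?g a b d Y = 0"
            \<comment> \<open>The excluded values are those for which w would be 0 or its
              denominator would vanish.\<close>
            proof (rule poly2_coeffs_zero[OF _ _ _ le(1,2), of "{0}" "\<lambda>u. {0, - \<beta> * u / \<gamma>}" "\<lambda>a b. ?g a b d Y"])
              fix u v :: complex assume u: "u \<notin> {0}" and v: "v \<notin> {0, - \<beta> * u / \<gamma>}"
              then have nz: "\<beta> * u + \<gamma> * v \<noteq> 0" using bg by (auto simp: field_simps add_eq_0_iff)
              let ?f = "\<lambda>\<alpha>. h u v (- \<alpha> * u * v / (\<beta> * u + \<gamma> * v)) (P \<alpha>)"
              have "?f 0 = 0"
              proof (rule punctured_limit_0)
                show "isCont ?f 0"
                proof (rule isCont_h)
                  show "isCont (\<lambda>\<alpha>. - \<alpha> * u * v / (\<beta> * u + \<gamma> * v)) 0"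
                    using nz by (intro continuous_intros) auto
                qed (simp_all add: contP)
                from evP show "\<forall>\<^sub>F \<alpha> in at 0. ?f \<alpha> = 0"
                  by eventually_elim (rule h0, use bg nz u v in auto)
              qed
              moreover have "?g a b d (P 0) = ?g a b d Y" for a b
              proof (rule slice_sum_cong)
                fix t i assume "t \<in> S" "i < (3::nat)"
                have "Y t 1 = - \<beta> * Y t 0 / \<gamma>" if "\<beta> * Y t 0 + \<gamma> * Y t 1 = 0"
                  using that bg by (simp add: field_simps add_eq_0_iff)
                moreover have "i = 0 \<or> i = 1 \<or> i = 2" using \<open>i < 3\<close> by auto
                ultimately show "P 0 t i = Y t i"
                  using on[OF \<open>t \<in> S\<close>] bg by (auto simp: P_def triple_def)
              qed
              ultimately show "(\<Sum>a\<le>N. \<Sum>b\<le>N. u ^ a * v ^ b * ?g a b d Y) = 0"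
                using hw0[OF le(3), of u v "P 0"] by simp
            qed auto
          qed
        qed
      qed (simp only: cancels_empty)
    qed
  qed
qed

section \<open>Evaluation of polynomials\<close>

definition mono_at :: "((nat \<times> nat) \<Rightarrow>\<^sub>0 nat) \<Rightarrow> complex mat \<Rightarrow> complex" where
  "mono_at m N = (\<Prod>v \<in> Poly_Mapping.keys m. (N $$ v) ^ Poly_Mapping.lookup m v)"

lemma eval_at_altdef: "eval_at f N = (\<Sum>m \<in> Poly_Mapping.keys f. Poly_Mapping.lookup f m * mono_at m N)"
  unfolding eval_at_def mono_at_def ..

lemma mono_at_superset:
  "finite B \<Longrightarrow> Poly_Mapping.keys m \<subseteq> B \<Longrightarrow> mono_at m N = (\<Prod>v \<in> B. (N $$ v) ^ Poly_Mapping.lookup m v)"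
  unfolding mono_at_def by (rule prod.mono_neutral_left) (auto simp: in_keys_iff)

lemma mono_at_add: "mono_at (a + b) N = mono_at a N * mono_at b N"
proof -
  let ?B = "Poly_Mapping.keys a \<union> Poly_Mapping.keys b"
  have "finite ?B" "Poly_Mapping.keys (a + b) \<subseteq> ?B" using Poly_Mapping.keys_add[of a b] by auto
  then show ?thesis
    by (simp add: mono_at_superset[of ?B] lookup_add power_add prod.distrib)
qed

lemma mono_at_zero [simp]: "mono_at 0 N = 1"
  by (simp add: mono_at_def)

lemma eval_at_superset:
  "finite B \<Longrightarrow> Poly_Mapping.keys f \<subseteq> B \<Longrightarrow> eval_at f N = (\<Sum>m \<in> B. Poly_Mapping.lookup f m * mono_at m N)"
  unfolding eval_at_altdef by (rule sum.mono_neutral_left) (auto simp: in_keys_iff)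

lemma eval_at_add: "eval_at (f + g) N = eval_at f N + eval_at g N"
proof -
  let ?B = "Poly_Mapping.keys f \<union> Poly_Mapping.keys g"
  have "finite ?B" "Poly_Mapping.keys (f + g) \<subseteq> ?B" using Poly_Mapping.keys_add[of f g] by auto
  then show ?thesis
    by (simp add: eval_at_superset[of ?B] lookup_add algebra_simps sum.distrib)
qed

lemma eval_at_single: "eval_at (Poly_Mapping.single m c) N = c * mono_at m N"
  by (simp add: eval_at_altdef)

lemma eval_at_zero [simp]: "eval_at 0 N = 0"
  by (simp add: eval_at_def)

lemma eval_at_sum: "eval_at (sum h A) N = (\<Sum>a\<in>A. eval_at (h a) N)"
  by (induction A rule: infinite_finite_induct) (auto simp: eval_at_add)

lemma poly_mapping_eq_sum_single:
  "f = (\<Sum>m \<in> Poly_Mapping.keys f. Poly_Mapping.single m (Poly_Mapping.lookup f m))"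
  by (rule poly_mapping_eqI) (auto simp: lookup_sum lookup_single when_def in_keys_iff)

lemma eval_at_mult: "eval_at (f * g) N = eval_at f N * eval_at g N"
proof -
  have "f * g = (\<Sum>m \<in> Poly_Mapping.keys f. \<Sum>m' \<in> Poly_Mapping.keys g.
     Poly_Mapping.single (m + m') (Poly_Mapping.lookup f m * Poly_Mapping.lookup g m'))"
    unfolding arg_cong2[OF poly_mapping_eq_sum_single[of f] poly_mapping_eq_sum_single[of g], of "(*)"]
    by (simp add: sum_product mult_single)
  then show ?thesis
    by (simp add: eval_at_sum eval_at_single mono_at_add eval_at_altdef[of f] eval_at_altdef[of g]
        sum_product mult_ac)
qed

lemma eval_at_one [simp]: "eval_at 1 N = 1"
  using eval_at_single[of 0 1 N] by simp

interpretation eval_at: comm_ring_hom "\<lambda>f. eval_at f N" for N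
  by unfold_locales (auto simp: eval_at_add eval_at_mult)

lemma eval_at_xvar [simp]: "eval_at (xvar i k) N = N $$ (i, k)"
  by (simp add: xvar_def eval_at_single mono_at_def)

section \<open>Polynomials as combinations of monomials\<close>

definition const_poly :: "complex \<Rightarrow> mpoly" where "const_poly c = Poly_Mapping.single 0 c"

text \<open>A monomial is a multiset of matrix positions, so that exchanging entries and comparing
  degrees become operations on multisets.\<close>

definition monomial :: "(nat \<times> nat) multiset \<Rightarrow> mpoly" where
  "monomial E = (\<Prod>v\<in>#E. xvar (fst v) (snd v))"

lemma eval_at_const_poly [simp]: "eval_at (const_poly c) N = c"
  by (simp add: const_poly_def eval_at_single)

lemma const_poly_add: "const_poly (a + b) = const_poly a + const_poly b"
  by (simp add: const_poly_def single_add)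

lemma const_poly_0 [simp]: "const_poly 0 = 0"
  by (simp add: const_poly_def)

lemma const_poly_sum: "const_poly (sum h A) = (\<Sum>a\<in>A. const_poly (h a))"
  by (induction A rule: infinite_finite_induct) (auto simp: const_poly_add)

lemma const_poly_in_polys [simp]: "const_poly c \<in> polys_in V"
  by (auto simp: const_poly_def polys_in_def)

lemma xvar_in_polys: "(i, k) \<in> V \<Longrightarrow> xvar i k \<in> polys_in V"
  by (auto simp: xvar_def polys_in_def)

lemma monomial_simps [simp]:
  "monomial {#} = 1" "monomial (add_mset v E) = xvar (fst v) (snd v) * monomial E"
  "monomial (E + F) = monomial E * monomial F"
  by (simp_all add: monomial_def)

lemma monomial_in_polys: "set_mset E \<subseteq> V \<Longrightarrow> monomial E \<in> polys_in V"
  by (induction E) (auto intro!: polys_in_one polys_in_mult xvar_in_polys)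

lemma eval_at_monomial: "eval_at (monomial E) N = (\<Prod>v\<in>#E. N $$ v)"
  by (induction E) (auto simp: eval_at_mult)

lemma xvar_power: "xvar i k ^ d = Poly_Mapping.single (Poly_Mapping.single (i, k) d) 1"
  by (induction d) (auto simp: xvar_def mult_single simp flip: single_add)

lemma single_eq_monomial:
  "\<exists>E. set_mset E \<subseteq> Poly_Mapping.keys m \<and> Poly_Mapping.single m 1 = monomial E"
proof (induction m rule: update_induct)
  case const
  show ?case by (intro exI[of _ "{#}"]) auto
next
  case (update m v d)
  then obtain E where E: "set_mset E \<subseteq> Poly_Mapping.keys m" "Poly_Mapping.single m 1 = monomial E"
    by blast
  have "Poly_Mapping.update v d m = Poly_Mapping.single v d + m"
    using update(1) by (intro poly_mapping_eqI) (auto simp: lookup_update lookup_add lookup_single when_def in_keys_iff)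
  then have "Poly_Mapping.single (Poly_Mapping.update v d m) (1::complex) = xvar (fst v) (snd v) ^ d * monomial E"
    by (simp add: xvar_power mult_single flip: E(2))
  also have "xvar (fst v) (snd v) ^ d = monomial (replicate_mset d v)"
    by (induction d) auto
  also have "monomial (replicate_mset d v) * monomial E = monomial (replicate_mset d v + E)"
    by simp
  finally show ?case
    using E(1) update(2) by (intro exI[of _ "replicate_mset d v + E"]) (auto simp: keys_update)
qed

lemma polys_in_monomials:
  assumes "f \<in> polys_in V"
  obtains L where "\<And>c E. (c, E) \<in> set L \<Longrightarrow> set_mset E \<subseteq> V" "f = (\<Sum>(c, E)\<leftarrow>L. const_poly c * monomial E)"
proof -
  define E where "E m = (SOME E. set_mset E \<subseteq> Poly_Mapping.keys m \<and> Poly_Mapping.single m 1 = monomial E)" for m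
  have E: "set_mset (E m) \<subseteq> Poly_Mapping.keys m" "Poly_Mapping.single m 1 = monomial (E m)" for m
    unfolding E_def
    by (rule someI_ex[OF single_eq_monomial, THEN conjunct1], rule someI_ex[OF single_eq_monomial, THEN conjunct2])
  from finite_distinct_list[OF finite_keys[of f]]
  obtain ms where ms: "set ms = Poly_Mapping.keys f" "distinct ms" by (elim exE conjE)
  let ?L = "map (\<lambda>m. (Poly_Mapping.lookup f m, E m)) ms"
  have "f = (\<Sum>m \<in> Poly_Mapping.keys f. const_poly (Poly_Mapping.lookup f m) * monomial (E m))"
    by (subst poly_mapping_eq_sum_single) (simp only: const_poly_def mult_single E(2)[symmetric] add_0 mult_1_right)
  also have "\<dots> = (\<Sum>m\<leftarrow>ms. const_poly (Poly_Mapping.lookup f m) * monomial (E m))"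
    using ms by (simp add: sum_list_distinct_conv_sum_set)
  finally have "f = (\<Sum>(c, E)\<leftarrow>?L. const_poly c * monomial E)"
    by (simp add: o_def)
  moreover have "set_mset E' \<subseteq> V" if "(c, E') \<in> set ?L" for c E'
  proof -
    from that obtain m where "m \<in> Poly_Mapping.keys f" "E' = E m" using ms by auto
    with E(1)[of m] assms show ?thesis unfolding polys_in_def by blast
  qed
  ultimately show ?thesis using that by blast
qed

section \<open>Determinants and ranks\<close>

lemma bij_betw_pick:
  assumes "finite S"
  shows "bij_betw (pick S) {..<card S} S"
proof -
  have inj: "inj_on (pick S) {..<card S}"
  proof (rule inj_onI)
    fix a b assume "a \<in> {..<card S}" "b \<in> {..<card S}" "pick S a = pick S b"
    then show "a = b"
      using pick_mono_le[of a S b] pick_mono_le[of b S a] by (metis lessThan_iff less_irrefl nat_neq_iff)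
  qed
  moreover have "pick S ` {..<card S} \<subseteq> S" using pick_in_set_le by blast
  ultimately show ?thesis
    using card_subset_eq[OF assms] card_image[OF inj] by (simp add: bij_betw_def)
qed

lemma submatrix_UNIV_cols:
  assumes "B \<in> carrier_mat p q" "S \<subseteq> {..<q}"
  shows "submatrix B UNIV S = mat p (card S) (\<lambda>(i, j). B $$ (i, pick S j))"
proof -
  have "{j. j < q \<and> j \<in> S} = S" using assms by auto
  then show ?thesis
    using assms by (simp add: submatrix_def pick_UNIV)
qed

lemma det_permute_columns:
  fixes A :: "'a :: comm_ring_1 mat"
  assumes A: "A \<in> carrier_mat n n" and p: "p permutes {0 ..< n}"
  shows "det (mat n n (\<lambda>(i, j). A $$ (i, p j))) = signof p * det A"
proof -
  have "det (mat n n (\<lambda>(i, j). A $$ (i, p j))) = det (transpose_mat (mat n n (\<lambda>(i, j). A $$ (i, p j))))"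
    by (subst det_transpose) auto
  also have "transpose_mat (mat n n (\<lambda>(i, j). A $$ (i, p j))) = mat n n (\<lambda>(i, j). transpose_mat A $$ (p i, j))"
    using A permutes_in_image[OF p] by (intro eq_matI) auto
  also have "det \<dots> = signof p * det (transpose_mat A)"
    using A by (intro det_permute_rows[OF _ p]) auto
  finally show ?thesis using det_transpose[OF A] by simp
qed

text \<open>\<open>submatrix\<close> always takes columns in increasing order. A choice of columns
  in any order, with repetitions, gives 0 or the sorted minor up to the sign of the sorting
  permutation; this frees later arguments from the order.\<close>

lemma det_columns_submatrix:
  fixes B :: "'a :: comm_ring_1 mat"
  assumes B: "B \<in> carrier_mat p q" and f: "\<And>j. j < p \<Longrightarrow> f j < q"
  shows "det (mat p p (\<lambda>(i, j). B $$ (i, f j))) = 0 \<or>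
    card (f ` {..<p}) = p \<and> (\<exists>\<sigma>. det (mat p p (\<lambda>(i, j). B $$ (i, f j))) = of_int \<sigma> * det (submatrix B UNIV (f ` {..<p})))"
proof (cases "inj_on f {..<p}")
  case False
  then obtain a b where ab: "a < p" "b < p" "a \<noteq> b" "f a = f b" by (auto simp: inj_on_def)
  have "det (mat p p (\<lambda>(i, j). B $$ (i, f j))) = 0"
    by (rule det_identical_columns[of _ p a b]) (use ab in auto)
  then show ?thesis by blast
next
  case True
  let ?S = "f ` {..<p}"
  have card: "card ?S = p" using card_image[OF True] by simp
  have S: "?S \<subseteq> {..<q}" using f by auto
  have bij: "bij_betw (pick ?S) {..<p} ?S" using bij_betw_pick[of ?S] card by simp
  define \<pi> where "\<pi> j = (if j < p then the_inv_into {..<p} (pick ?S) (f j) else j)" for j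
  have pf: "pick ?S (\<pi> j) = f j" "\<pi> j < p" if "j < p" for j
  proof -
    have "f j \<in> ?S" using that by auto
    then show "pick ?S (\<pi> j) = f j"
      unfolding \<pi>_def using that f_the_inv_into_f_bij_betw[OF bij] by simp
    show "\<pi> j < p"
      unfolding \<pi>_def using that the_inv_into_into[OF bij_betw_imp_inj_on[OF bij], of "f j" "{..<p}"] bij
      by (auto simp: bij_betw_def)
  qed
  have "\<pi> permutes {0..<p}"
  proof (rule bij_imp_permutes)
    have "inj_on \<pi> {0..<p}"
    proof (rule inj_onI)
      fix a b assume ab: "a \<in> {0..<p}" "b \<in> {0..<p}" "\<pi> a = \<pi> b"
      then have "f a = f b" using pf(1)[of a] pf(1)[of b] by simp
      with True ab show "a = b" by (auto dest: inj_onD)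
    qed
    moreover have "\<pi> ` {0..<p} \<subseteq> {0..<p}" using pf(2) by auto
    ultimately show "bij_betw \<pi> {0..<p} {0..<p}"
      by (simp add: bij_betw_def endo_inj_surj)
  qed (auto simp: \<pi>_def)
  from det_permute_columns[OF _ this, of "submatrix B UNIV ?S"]
  have "det (mat p p (\<lambda>(i, j). submatrix B UNIV ?S $$ (i, \<pi> j))) = signof \<pi> * det (submatrix B UNIV ?S)"
    unfolding submatrix_UNIV_cols[OF B S] card by simp
  also have "mat p p (\<lambda>(i, j). submatrix B UNIV ?S $$ (i, \<pi> j)) = mat p p (\<lambda>(i, j). B $$ (i, f j))"
    unfolding submatrix_UNIV_cols[OF B S] card by (intro eq_matI) (auto simp: pf simp del: pick.simps)
  finally show ?thesis using card by blast
qed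

lemma det_expand_first_column:
  fixes F :: "nat \<Rightarrow> nat \<Rightarrow> 'a :: comm_ring_1"
  shows "det (mat (Suc n) (Suc n) (\<lambda>(i, j). F i j)) =
    (\<Sum>i<Suc n. (-1) ^ i * F i 0 * det (mat n n (\<lambda>(i', j). F (if i' < i then i' else Suc i') (Suc j))))"
proof -
  have "mat_delete (mat (Suc n) (Suc n) (\<lambda>(i, j). F i j)) i 0 =
      mat n n (\<lambda>(i', j). F (if i' < i then i' else Suc i') (Suc j))" for i
    by (rule eq_matI) (auto simp: mat_delete_def)
  then show ?thesis
    by (subst laplace_expansion_column[of _ "Suc n" 0]) (auto simp: cofactor_def mult_ac intro!: sum.cong)
qed

lemma det_mat_3:
  fixes F :: "nat \<Rightarrow> nat \<Rightarrow> 'a :: comm_ring_1"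
  shows "det (mat 3 3 (\<lambda>(i, j). F i j)) =
    F 0 0 * (F 1 1 * F 2 2 - F 1 2 * F 2 1) - F 0 1 * (F 1 0 * F 2 2 - F 1 2 * F 2 0) +
    F 0 2 * (F 1 0 * F 2 1 - F 1 1 * F 2 0)"
  by (simp add: numeral_3_eq_3 det_expand_first_column numeral_2_eq_2 algebra_simps)

lemma det_mat_unit_first_column:
  fixes F :: "nat \<Rightarrow> nat \<Rightarrow> 'a :: comm_ring_1"
  assumes "\<And>i. i < Suc n \<Longrightarrow> F i 0 = (if i = 0 then 1 else 0)"
  shows "det (mat (Suc n) (Suc n) (\<lambda>(i, j). F i j)) = det (mat n n (\<lambda>(i, j). F (Suc i) (Suc j)))"
proof -
  have "det (mat (Suc n) (Suc n) (\<lambda>(i, j). F i j)) =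
     (\<Sum>i<Suc n. if i = 0 then det (mat n n (\<lambda>(i, j). F (Suc i) (Suc j))) else 0)"
    unfolding det_expand_first_column by (intro sum.cong) (auto simp: assms)
  then show ?thesis by simp
qed

text \<open>For minors that use the three columns in \<open>J\<close>: these have quadratic columns
  equal to the first three unit vectors, and only the rows of mixed products remain.\<close>

lemma det_mat_6_unit_columns:
  fixes F :: "nat \<Rightarrow> nat \<Rightarrow> 'a :: comm_ring_1"
  assumes "\<And>i j. i < 6 \<Longrightarrow> j < 3 \<Longrightarrow> F i j = (if i = j then 1 else 0)"
  shows "det (mat 6 6 (\<lambda>(i, j). F i j)) = det (mat 3 3 (\<lambda>(i, j). F (i + 3) (j + 3)))"
proof -
  have n: "6 = Suc (Suc (Suc 3))" by simp
  show ?thesis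
    unfolding n
    by (subst det_mat_unit_first_column, simp add: assms)+ (simp add: numeral_3_eq_3)
qed

lemma det_scale_columns:
  fixes F :: "nat \<Rightarrow> nat \<Rightarrow> 'a :: comm_ring_1"
  shows "det (mat n n (\<lambda>(i, j). c j * F i j)) = (\<Prod>j<n. c j) * det (mat n n (\<lambda>(i, j). F i j))"
proof -
  have "(\<Prod>i = 0..<n. c (p i) * F i (p i)) = (\<Prod>j<n. c j) * (\<Prod>i = 0..<n. F i (p i))"
    if "p permutes {0..<n}" for p
    using prod.permute[OF that, of c] by (simp add: prod.distrib o_def lessThan_atLeast0)
  moreover have "(\<Prod>i = 0..<n. mat n n (\<lambda>(i, j). G i j) $$ (i, p i)) = (\<Prod>i = 0..<n. G i (p i))"
    if "p permutes {0..<n}" for p and G :: "nat \<Rightarrow> nat \<Rightarrow> 'a"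
    using permutes_in_image[OF that] by (intro prod.cong) auto
  ultimately show ?thesis
    by (subst (1 2) det_def'[of _ n]) (auto simp: sum_distrib_left mult_ac intro!: sum.cong)
qed

lemma (in vec_space) rank_le_nr:
  assumes "A \<in> carrier_mat n nc"
  shows "rank A \<le> n"
proof -
  have "VectorSpace.subspace class_ring (span (set (cols A))) V"
    using assms cols_dim span_is_subspace by (metis carrier_matD(1))
  from subspace_dim[OF this fin_dim] show ?thesis
    using fin_dim_span_cols[OF assms] unfolding rank_def dim_is_n .
qed

text \<open>Row \<open>i\<close> of \<open>quad_col M a b\<close> is \<open>M $$ (qrow1 i, a) * M $$ (qrow2 i, b)\<close>.\<close>

definition qrow1 :: "nat \<Rightarrow> nat" where "qrow1 i = [0, 1, 2, 0, 0, 1] ! i"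
definition qrow2 :: "nat \<Rightarrow> nat" where "qrow2 i = [0, 1, 2, 1, 2, 2] ! i"

lemma less_6_cases: "i < 6 \<Longrightarrow> i = 0 \<or> i = 1 \<or> i = 2 \<or> i = 3 \<or> i = 4 \<or> i = (5::nat)"
  by auto

lemma qrow_lt: "i < 6 \<Longrightarrow> qrow1 i < 3" "i < 6 \<Longrightarrow> qrow2 i < 3"
  using less_6_cases[of i] by (auto simp: qrow1_def qrow2_def nth_Cons_numeral)

lemma quad_col_index: "i < 6 \<Longrightarrow> quad_col M a b $ i = M $$ (qrow1 i, a) * M $$ (qrow2 i, b)"
  unfolding quad_col_def vec_of_list_index using less_6_cases[of i]
  by (auto simp: qrow1_def qrow2_def nth_Cons_numeral)

text \<open>A minor of \<open>theta_tilde\<close> addressed by pairs of columns of \<open>M\<close>,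
  in any order, instead of by positions in the list of columns of \<open>theta_tilde\<close>. Pairs
  with equal entries give the columns of \<open>theta\<close>.\<close>

definition quad_det :: "'a :: comm_ring_1 mat \<Rightarrow> (nat \<Rightarrow> nat \<times> nat) \<Rightarrow> 'a" where
  "quad_det M ps = det (mat 6 6 (\<lambda>(i, j). M $$ (qrow1 i, fst (ps j)) * M $$ (qrow2 i, snd (ps j))))"

definition column_pairs :: "nat \<Rightarrow> (nat \<Rightarrow> nat set) \<Rightarrow> nat \<Rightarrow> (nat \<times> nat) set" where
  "column_pairs r I q = {(a, b). a < q \<and> b < q \<and> (a = b \<or> (\<exists>i\<in>{1..r}. a \<in> I i \<and> b \<in> I i))}"

lemma theta_tilde_columns:
  obtains ps where "set ps = column_pairs r I (dim_col M)"
    "\<And>M' :: 'b::comm_ring_1 mat. dim_col M' = dim_col M \<Longrightarrow>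
       theta_tilde r I M' = mat 6 (length ps) (\<lambda>(i, j). M' $$ (qrow1 i, fst (ps ! j)) * M' $$ (qrow2 i, snd (ps ! j)))"
proof
  let ?q = "dim_col M"
  let ?ps = "map (\<lambda>j. (j, j)) [0..<?q] @
     [(a, b). i \<leftarrow> [1..<Suc r], a \<leftarrow> [0..<?q], b \<leftarrow> [0..<?q], a \<in> I i \<and> b \<in> I i \<and> a \<noteq> b]"
  show "set ?ps = column_pairs r I ?q"
  proof (rule Set.set_eqI)
    fix p :: "nat \<times> nat"
    obtain a b where p: "p = (a, b)" by (cases p)
    have up: "set [1..<Suc r] = {1..r}" "set [0..<?q] = {..<?q}" by auto
    have "p \<in> set ?ps \<longleftrightarrow> (a < ?q \<and> a = b) \<or>
       (\<exists>i\<in>{1..r}. \<exists>a'\<in>{..<?q}. \<exists>b'\<in>{..<?q}. (a' \<in> I i \<and> b' \<in> I i \<and> a' \<noteq> b') \<and> p = (a', b'))"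
      unfolding set_append set_concat set_map up Un_iff by (fastforce simp: p)
    also have "\<dots> \<longleftrightarrow> p \<in> column_pairs r I ?q"
      unfolding column_pairs_def p by blast
    finally show "p \<in> set ?ps \<longleftrightarrow> p \<in> column_pairs r I ?q" .
  qed
  show "theta_tilde r I M' = mat 6 (length ?ps) (\<lambda>(i, j). M' $$ (qrow1 i, fst (?ps ! j)) * M' $$ (qrow2 i, snd (?ps ! j)))"
    if "dim_col M' = ?q" for M' :: "'b mat"
  proof -
    have "cols (theta M') = map (\<lambda>j. quad_col M' j j) [0..<?q]"
      unfolding theta_def that by (rule cols_mat_of_cols) (auto intro!: carrier_vecI simp: quad_col_def)
    then have "theta_tilde r I M' = mat_of_cols 6 (map (\<lambda>(a, b). quad_col M' a b) ?ps)"
      unfolding theta_tilde_def that by (simp add: map_concat o_def if_distrib[where f = "map _"] cong: if_cong)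
    then show ?thesis
      by (intro eq_matI) (simp_all add: mat_of_cols_index quad_col_index case_prod_beta del: length_append map_append)
  qed
qed

lemma maximal_minor_theta_tilde:
  assumes "m \<in> maximal_minors (theta_tilde r I M)"
  obtains ps where "\<And>j. j < 6 \<Longrightarrow> ps j \<in> column_pairs r I (dim_col M)" "m = quad_det M ps"
proof -
  obtain ps where ps: "set ps = column_pairs r I (dim_col M)"
     "theta_tilde r I M = mat 6 (length ps) (\<lambda>(i, j). M $$ (qrow1 i, fst (ps ! j)) * M $$ (qrow2 i, snd (ps ! j)))"
    by (rule theta_tilde_columns[of r I M]) auto
  from assms obtain S where S: "S \<subseteq> {..<length ps}" "card S = 6" "m = det (submatrix (theta_tilde r I M) UNIV S)"
    unfolding maximal_minors_def ps(2) by auto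
  have lt: "pick S j < length ps" if "j < 6" for j
    using pick_in_set_le[of j S] that S by auto
  have "submatrix (theta_tilde r I M) UNIV S = mat 6 6 (\<lambda>(i, j). M $$ (qrow1 i, fst (ps ! pick S j)) * M $$ (qrow2 i, snd (ps ! pick S j)))"
    unfolding ps(2) using S lt by (subst submatrix_UNIV_cols[of _ 6 "length ps"]) (auto simp del: pick.simps)
  then have "m = quad_det M (\<lambda>j. ps ! pick S j)"
    using S(3) by (simp add: quad_det_def del: pick.simps)
  moreover have "ps ! pick S j \<in> column_pairs r I (dim_col M)" if "j < 6" for j
    unfolding ps(1)[symmetric] by (rule nth_mem[OF lt[OF that]])
  ultimately show ?thesis by (intro that)
qed

lemma quad_det_maximal_minor:
  assumes "\<And>j. j < 6 \<Longrightarrow> ps j \<in> column_pairs r I (dim_col M)"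
  shows "quad_det M ps = 0 \<or> (\<exists>\<sigma>. \<exists>m \<in> maximal_minors (theta_tilde r I M). quad_det M ps = of_int \<sigma> * m)"
proof -
  obtain qs where qs: "set qs = column_pairs r I (dim_col M)"
     "theta_tilde r I M = mat 6 (length qs) (\<lambda>(i, j). M $$ (qrow1 i, fst (qs ! j)) * M $$ (qrow2 i, snd (qs ! j)))"
    by (rule theta_tilde_columns[of r I M]) auto
  define f where "f j = (SOME k. k < length qs \<and> qs ! k = ps j)" for j
  have f: "f j < length qs \<and> qs ! f j = ps j" if "j < 6" for j
  proof -
    have "ps j \<in> set qs" using assms[OF that] qs(1) by simp
    then have "\<exists>k. k < length qs \<and> qs ! k = ps j" by (simp only: in_set_conv_nth)
    then show ?thesis unfolding f_def by (rule someI_ex)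
  qed
  let ?T = "theta_tilde r I M"
  have "?T \<in> carrier_mat 6 (length qs)" unfolding qs(2) by simp
  from det_columns_submatrix[OF this, of f] f
  have "det (mat 6 6 (\<lambda>(i, j). ?T $$ (i, f j))) = 0 \<or> card (f ` {..<6}) = 6 \<and>
     (\<exists>\<sigma>. det (mat 6 6 (\<lambda>(i, j). ?T $$ (i, f j))) = of_int \<sigma> * det (submatrix ?T UNIV (f ` {..<6})))"
    by blast
  moreover have "mat 6 6 (\<lambda>(i, j). ?T $$ (i, f j)) = mat 6 6 (\<lambda>(i, j). M $$ (qrow1 i, fst (ps j)) * M $$ (qrow2 i, snd (ps j)))"
    unfolding qs(2) using f by (intro eq_matI) auto
  moreover have "f ` {..<6} \<subseteq> {..<dim_col ?T}" "dim_row ?T = 6"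
    using f by (auto simp: qs(2))
  then have "det (submatrix ?T UNIV (f ` {..<6})) \<in> maximal_minors ?T" if "card (f ` {..<6}) = 6"
    using that unfolding maximal_minors_def by (intro CollectI exI[of _ "f ` {..<6}"]) auto
  ultimately show ?thesis
    unfolding quad_det_def by auto
qed

section \<open>Rank bounds as equations between entries\<close>

lemma pick_pair:
  assumes "i < i'"
  shows "pick {i, i'} 0 = i" "pick {i, i'} (Suc 0) = i'"
proof -
  show *: "pick {i, i'} 0 = i"
    unfolding pick.simps by (rule Least_equality) (use assms in auto)
  show "pick {i, i'} (Suc 0) = i'"
    unfolding pick.simps(2) * by (rule Least_equality) (use assms in auto)
qed

lemma vec_space_rank_minor2:
  fixes B :: "'a :: field mat"
  assumes B: "B \<in> carrier_mat p q" and "i < i'" "i' < p" "k < k'" "k' < q"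
    and nz: "B $$ (i, k) * B $$ (i', k') \<noteq> B $$ (i, k') * B $$ (i', k)"
  shows "2 \<le> vec_space.rank p B"
proof -
  have eq: "{a. a < p \<and> a \<in> {i, i'}} = {i, i'}" "{a. a < q \<and> a \<in> {k, k'}} = {k, k'}" using assms by auto
  have card: "card {i, i'} = 2" "card {k, k'} = 2" using assms by auto
  have "submatrix B {i, i'} {k, k'} = mat 2 2 (\<lambda>(a, b). B $$ (pick {i, i'} a, pick {k, k'} b))"
    using B unfolding submatrix_def by (simp only: carrier_matD eq card)
  then have "det (submatrix B {i, i'} {k, k'}) = B $$ (i, k) * B $$ (i', k') - B $$ (i, k') * B $$ (i', k)"
    using assms by (simp add: numeral_2_eq_2 det_expand_first_column pick_pair del: pick.simps)
  with nz have "det (submatrix B {i, i'} {k, k'}) \<noteq> 0" by simp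
  from vec_space.rank_gt_minor[OF B this] eq assms show ?thesis by simp
qed

text \<open>All 2 x 2 minors vanish, so every column is a multiple of the column of one nonzero
  entry (i0, k0).\<close>

lemma rank_le_1_columns:
  fixes B :: "'a :: field mat"
  assumes B: "B \<in> carrier_mat p q" and rk: "vec_space.rank p B \<le> 1"
  obtains t y where "\<And>i k. i < p \<Longrightarrow> k < q \<Longrightarrow> B $$ (i, k) = t k * y i"
proof (cases "\<forall>i<p. \<forall>k<q. B $$ (i, k) = 0")
  case True
  then show ?thesis using that[of "\<lambda>_. 0" "\<lambda>_. 0"] by auto
next
  case False
  then obtain i0 k0 where nz: "i0 < p" "k0 < q" "B $$ (i0, k0) \<noteq> 0" by blast
  have lt: "B $$ (i, k) * B $$ (i', k') = B $$ (i, k') * B $$ (i', k)"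
    if "i < i'" "i' < p" "k < k'" "k' < q" for i i' k k'
  proof (rule ccontr)
    assume "B $$ (i, k) * B $$ (i', k') \<noteq> B $$ (i, k') * B $$ (i', k)"
    from vec_space_rank_minor2[OF B that this] rk show False by simp
  qed
  have lt': "B $$ (i, k) * B $$ (i', k') = B $$ (i, k') * B $$ (i', k)"
    if "i < i'" "i' < p" "k < q" "k' < q" for i i' k k'
  proof (cases k k' rule: linorder_cases)
    case less
    show ?thesis by (rule lt[OF that(1,2) less that(4)])
  next
    case greater
    show ?thesis by (rule lt[OF that(1,2) greater that(3), symmetric])
  qed simp
  have "B $$ (i, k) * B $$ (i', k') = B $$ (i, k') * B $$ (i', k)"
    if "i < p" "i' < p" "k < q" "k' < q" for i i' k k'
  proof (cases i i' rule: linorder_cases)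
    case less
    show ?thesis by (rule lt'[OF less that(2-4)])
  next
    case greater
    show ?thesis using lt'[OF greater that(1,4,3)] by (simp only: mult.commute)
  qed (simp only: mult.commute)
  then have "B $$ (i, k) = B $$ (i0, k) / B $$ (i0, k0) * B $$ (i, k0)" if "i < p" "k < q" for i k
    using that nz by (simp add: field_simps)
  then show ?thesis using that[of "\<lambda>k. B $$ (i0, k) / B $$ (i0, k0)" "\<lambda>i. B $$ (i, k0)"] by auto
qed

lemma rank_0_entries:
  fixes B :: "'a :: field mat"
  assumes B: "B \<in> carrier_mat p q" and rk: "vec_space.rank p B = 0" and "i < p" "k < q"
  shows "B $$ (i, k) = 0"
proof (rule ccontr)
  assume nz: "B $$ (i, k) \<noteq> 0"
  have eq: "{a. a < p \<and> a \<in> {i}} = {i}" "{a. a < q \<and> a \<in> {k}} = {k}" using assms by auto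
  have pick: "pick {j} 0 = j" for j :: nat
    unfolding pick.simps by (rule Least_equality) auto
  have "submatrix B {i} {k} = mat 1 1 (\<lambda>(a, b). B $$ (pick {i} a, pick {k} b))"
    using B unfolding submatrix_def by (simp only: carrier_matD eq card_1_singleton_iff card.empty card_insert_disjoint finite.emptyI empty_iff not_False_eq_True One_nat_def)
  also have "\<dots> = mat 1 1 (\<lambda>_. B $$ (i, k))"
    by (rule eq_matI) (auto simp: pick simp del: pick.simps)
  finally have "submatrix B {i} {k} = mat 1 1 (\<lambda>_. B $$ (i, k))" .
  then have "det (submatrix B {i} {k}) \<noteq> 0" using nz by (simp add: det_single)
  from vec_space.rank_gt_minor[OF B this] eq rk assms(3,4) show False by simp
qed

lemma submatrix_mult_UNIV:
  assumes "g \<in> carrier_mat p p" "M \<in> carrier_mat p q" "S \<subseteq> {..<q}"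
  shows "submatrix (g * M) UNIV S = g * submatrix M UNIV S"
proof -
  have lt: "pick S j < q" if "j < card S" for j
    using pick_in_set_le[OF that] assms by auto
  have *: "g * M \<in> carrier_mat p q" using assms by auto
  show ?thesis
    unfolding submatrix_UNIV_cols[OF * assms(3)] submatrix_UNIV_cols[OF assms(2,3)]
    using assms lt by (intro eq_matI) (auto simp: scalar_prod_def simp del: pick.simps)
qed

section \<open>Points of the positroid variety and of the ABCT variety\<close>

text \<open>Explicit factors replace the rank bounds because they are visibly preserved by left
  multiplication. Full row rank is supplied separately by the normalisation
  \<open>submatrix N UNIV J = 1\<^sub>m 3\<close>.\<close>

definition positroid_point :: "nat \<Rightarrow> nat set \<Rightarrow> nat \<Rightarrow> (nat \<Rightarrow> nat set) \<Rightarrow> complex mat \<Rightarrow> bool" where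
  "positroid_point n A0 r I N \<longleftrightarrow> N \<in> carrier_mat 3 n \<and> (\<forall>k\<in>A0. \<forall>i<3. N $$ (i, k) = 0) \<and>
     (\<forall>s\<in>{1..r}. \<exists>t y. \<forall>k\<in>I s. \<forall>i<3. N $$ (i, k) = t k * y i)"

lemma submatrix_UNIV_entry:
  assumes "B \<in> carrier_mat p q" "S \<subseteq> {..<q}" "k \<in> S"
  obtains c where "c < card S" "\<And>i. i < p \<Longrightarrow> submatrix B UNIV S $$ (i, c) = B $$ (i, k)"
proof -
  have "finite S" using assms(2) finite_subset by blast
  from bij_betw_imp_surj_on[OF bij_betw_pick[OF this]] assms(3) have "k \<in> pick S ` {..<card S}" by (simp only:)
  then obtain c where "c < card S" "pick S c = k" by (elim imageE) simp
  then show ?thesis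
    using that[of c] unfolding submatrix_UNIV_cols[OF assms(1,2)] by (simp del: pick.simps)
qed

lemma mult_entry_3:
  assumes "g \<in> carrier_mat p 3" "M \<in> carrier_mat 3 n" "i < p" "k < n"
  shows "(g * M) $$ (i, k) = (\<Sum>j<3. g $$ (i, j) * M $$ (j, k))"
  using assms by (auto simp: scalar_prod_def lessThan_atLeast0)

lemma row_class_positroid_point:
  assumes M: "M \<in> carrier_mat 3 n" and sub: "A0 \<subseteq> {..<n}" "\<And>s. s \<in> {1..r} \<Longrightarrow> I s \<subseteq> {..<n}"
    and rk: "vec_space.rank 3 (submatrix M UNIV A0) = 0"
      "\<And>s. s \<in> {1..r} \<Longrightarrow> vec_space.rank 3 (submatrix M UNIV (I s)) \<le> 1"
    and N: "N \<in> row_class M"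
  shows "positroid_point n A0 r I N"
  unfolding positroid_point_def
proof (intro conjI ballI allI impI)
  from N M obtain g where g: "g \<in> carrier_mat 3 3" "N = g * M" unfolding row_class_def by auto
  show "N \<in> carrier_mat 3 n" using g M by auto
  note entry = mult_entry_3[OF g(1) M]
  {
    fix k i assume k: "k \<in> A0" and i: "i < (3::nat)"
    have "M $$ (j, k) = 0" if j: "j < 3" for j
    proof -
      obtain c where c: "c < card A0" "submatrix M UNIV A0 $$ (j, c) = M $$ (j, k)"
        using submatrix_UNIV_entry[OF M sub(1) k] j by metis
      have "submatrix M UNIV A0 \<in> carrier_mat 3 (card A0)"
        unfolding submatrix_UNIV_cols[OF M sub(1)] by simp
      from rank_0_entries[OF this rk(1) j c(1)] c(2) show ?thesis by simp
    qed
    then show "N $$ (i, k) = 0" using entry[OF i, of k] k sub(1) g(2) by auto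
  next
    fix s assume s: "s \<in> {1..r}"
    have "submatrix M UNIV (I s) \<in> carrier_mat 3 (card (I s))"
      unfolding submatrix_UNIV_cols[OF M sub(2)[OF s]] by simp
    from rank_le_1_columns[OF this rk(2)[OF s]] obtain t y
      where ty: "\<And>i k. i < 3 \<Longrightarrow> k < card (I s) \<Longrightarrow> submatrix M UNIV (I s) $$ (i, k) = t k * y i" by metis
    have "\<exists>t'. \<forall>i<3. M $$ (i, k) = t' * y i" if k: "k \<in> I s" for k
    proof -
      obtain c where "c < card (I s)" "\<And>i. i < 3 \<Longrightarrow> submatrix M UNIV (I s) $$ (i, c) = M $$ (i, k)"
        using submatrix_UNIV_entry[OF M sub(2)[OF s] k] by metis
      then show ?thesis using ty[of _ c] by (intro exI[of _ "t c"]) auto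
    qed
    then obtain t' where t': "\<And>k i. k \<in> I s \<Longrightarrow> i < 3 \<Longrightarrow> M $$ (i, k) = t' k * y i" by metis
    have "N $$ (i, k) = t' k * (\<Sum>j<3. g $$ (i, j) * y j)" if "k \<in> I s" "i < 3" for i k
    proof -
      have "k < n" using that sub(2)[OF s] by auto
      then have "N $$ (i, k) = (\<Sum>j<3. g $$ (i, j) * M $$ (j, k))" using entry that g(2) by simp
      also have "\<dots> = (\<Sum>j<3. g $$ (i, j) * (t' k * y j))" using t'[OF that(1)] by simp
      finally show ?thesis by (simp add: sum_distrib_left mult_ac)
    qed
    then show "\<exists>t y. \<forall>k\<in>I s. \<forall>i<3. N $$ (i, k) = t k * y i"
      by (intro exI[of _ t'] exI[of _ "\<lambda>i. \<Sum>j<3. g $$ (i, j) * y j"]) auto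
  }
qed

lemma charts_pick:
  assumes "J \<in> charts n"
  shows "finite J" "card J = 3" "J \<subseteq> {..<n}" "i < 3 \<Longrightarrow> pick J i \<in> J" "i < 3 \<Longrightarrow> pick J i < n"
    "i < 3 \<Longrightarrow> j < 3 \<Longrightarrow> pick J i = pick J j \<longleftrightarrow> i = j" "k \<in> J \<Longrightarrow> \<exists>i<3. k = pick J i"
proof -
  show J: "finite J" "card J = 3" "J \<subseteq> {..<n}"
    using assms finite_subset by (auto simp: charts_def)
  have bij: "bij_betw (pick J) {..<3} J" using bij_betw_pick[OF J(1)] J(2) by simp
  show p: "pick J i \<in> J" if "i < 3" for i
    using bij that unfolding bij_betw_def by blast
  then show "i < 3 \<Longrightarrow> pick J i < n" using J(3) by blast
  show "i < 3 \<Longrightarrow> j < 3 \<Longrightarrow> pick J i = pick J j \<longleftrightarrow> i = j"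
    using bij unfolding bij_betw_def inj_on_def by blast
  show "k \<in> J \<Longrightarrow> \<exists>i<3. k = pick J i"
    using bij unfolding bij_betw_def by blast
qed

lemma rank_3_if_minor:
  assumes N: "(N :: complex mat) \<in> carrier_mat 3 n" and J: "J \<in> charts n" and "det (submatrix N UNIV J) \<noteq> 0"
  shows "vec_space.rank 3 N = 3"
proof (rule antisym)
  show "vec_space.rank 3 N \<le> 3" by (rule vec_space.rank_le_nr[OF N])
  have "{j. j < n \<and> j \<in> J} = J" using charts_pick(3)[OF J] by auto
  with vec_space.rank_gt_minor[OF N assms(3)] charts_pick(2)[OF J] show "3 \<le> vec_space.rank 3 N" by simp
qed

lemma row_class_refl: "N \<in> carrier_mat m n \<Longrightarrow> N \<in> row_class N"
  unfolding row_class_def by (rule CollectI, rule exI[of _ "1\<^sub>m m"])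
    (auto simp: invertible_mat_def inverts_mat_def intro!: exI[of _ "1\<^sub>m m"])

lemma positroid_point_ranks:
  assumes N: "positroid_point n A0 r I N" and sub: "A0 \<subseteq> {..<n}" "\<And>s. s \<in> {1..r} \<Longrightarrow> I s \<subseteq> {..<n}"
  shows "vec_space.rank 3 (submatrix N UNIV A0) = 0"
    "s \<in> {1..r} \<Longrightarrow> vec_space.rank 3 (submatrix N UNIV (I s)) \<le> 1"
proof -
  from N have car: "N \<in> carrier_mat 3 n" by (simp add: positroid_point_def)
  have mem: "pick S c \<in> S" if "c < card S" for S c using pick_in_set_le[OF that] .
  have "submatrix N UNIV A0 = 0\<^sub>m 3 (card A0)"
    unfolding submatrix_UNIV_cols[OF car sub(1)]
    by (rule eq_matI) (use N mem in \<open>auto simp: positroid_point_def simp del: pick.simps\<close>)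
  then show "vec_space.rank 3 (submatrix N UNIV A0) = 0"
    using vec_space.rank_0I by metis
  assume s: "s \<in> {1..r}"
  with N obtain t y where ty: "\<And>k i. k \<in> I s \<Longrightarrow> i < 3 \<Longrightarrow> N $$ (i, k) = t k * y i"
    unfolding positroid_point_def by blast
  show "vec_space.rank 3 (submatrix N UNIV (I s)) \<le> 1"
    unfolding submatrix_UNIV_cols[OF car sub(2)[OF s]]
    by (rule vec_space.rank_le_1_product_entries[of _ _ "card (I s)" y "\<lambda>c. t (pick (I s) c)"])
      (use ty mem in \<open>auto simp: mult.commute simp del: pick.simps\<close>)
qed

text \<open>A row class contains each of its normalised matrices as a representative, so over the
  chart vanishing can be tested on normalised matrices alone.\<close>

lemma positroid_variety_iff:
  assumes J: "J \<in> charts n" and sub: "A0 \<subseteq> {..<n}" "\<And>s. s \<in> {1..r} \<Longrightarrow> I s \<subseteq> {..<n}"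
  shows "f \<in> positroid_variety n A0 r I J \<longleftrightarrow> f \<in> carrier (chart_ring n J) \<and>
     (\<forall>N. positroid_point n A0 r I N \<and> submatrix N UNIV J = 1\<^sub>m 3 \<longrightarrow> eval_at f N = 0)" (is "?L \<longleftrightarrow> ?R")
proof
  assume L: ?L
  have "eval_at f N = 0" if N: "positroid_point n A0 r I N" "submatrix N UNIV J = 1\<^sub>m 3" for N
  proof -
    from N have car: "N \<in> carrier_mat 3 n" by (simp add: positroid_point_def)
    from N(2) have "vec_space.rank 3 N = 3" by (intro rank_3_if_minor[OF car J]) simp
    then have "row_class N \<in> {row_class M | M. M \<in> carrier_mat 3 n \<and> vec_space.rank 3 M = 3 \<and>
        vec_space.rank 3 (submatrix M UNIV A0) = 0 \<and>
        (\<forall>i \<in> {1..r}. vec_space.rank 3 (submatrix M UNIV (I i)) \<le> 1)}"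
      using car positroid_point_ranks[OF N(1) sub] by (intro CollectI exI[of _ N]) simp
    with L row_class_refl[OF car] N(2) show ?thesis
      unfolding positroid_variety_def closure_of_points_def by blast
  qed
  with L show ?R unfolding positroid_variety_def closure_of_points_def by blast
next
  assume R: ?R
  have "eval_at f N = 0"
    if "M \<in> carrier_mat 3 n" "vec_space.rank 3 (submatrix M UNIV A0) = 0"
      "\<forall>i \<in> {1..r}. vec_space.rank 3 (submatrix M UNIV (I i)) \<le> 1" "N \<in> row_class M" "submatrix N UNIV J = 1\<^sub>m 3"
    for M N
    using R row_class_positroid_point[OF that(1) sub that(2) _ that(4)] that(3,5) by simp
  with R show ?L
    unfolding positroid_variety_def closure_of_points_def by auto
qed

section \<open>Veronese images and matrices on a smooth conic\<close>

lemma veronese_carrier: "A \<in> carrier_mat 2 n \<Longrightarrow> veronese A \<in> carrier_mat 3 n"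
  by (auto simp: veronese_def)

lemma veronese_index:
  assumes "A \<in> carrier_mat 2 n" "k < n"
  shows "veronese A $$ (0, k) = (A $$ (0, k))\<^sup>2" "veronese A $$ (1, k) = A $$ (0, k) * A $$ (1, k)"
    "veronese A $$ (2, k) = (A $$ (1, k))\<^sup>2"
  using assms by (simp_all add: veronese_def mat_of_cols_index vec_of_list_index numeral_2_eq_2)

lemma sum_3: "(\<Sum>j<(3::nat). f j) = f 0 + f 1 + (f 2 :: 'a :: comm_monoid_add)"
  by (simp add: numeral_3_eq_3 numeral_2_eq_2)

lemma sum_6: "(\<Sum>j<(6::nat). f j) = f 0 + f 1 + f 2 + f 3 + f 4 + (f 5 :: 'a :: comm_monoid_add)"
  by (simp add: eval_nat_numeral)

lemma product_of_linear_forms: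
  fixes a b x :: "nat \<Rightarrow> 'a :: comm_ring_1"
  shows "(\<Sum>k<3. a k * x k) * (\<Sum>k<3. b k * x k) =
    (\<Sum>m<6. (a (qrow1 m) * b (qrow2 m) + (if m < 3 then 0 else a (qrow2 m) * b (qrow1 m))) * (x (qrow1 m) * x (qrow2 m)))"
  unfolding sum_3 sum_6 by (simp add: qrow1_def qrow2_def nth_Cons_numeral algebra_simps)

text \<open>Left multiplication by g acts on quadratic columns through the second symmetric power of
  g, the matrix \<open>S\<close> below. Its last three columns add both orders of a mixed product,
  which is legitimate because only pairs of equal columns occur.\<close>

lemma quad_det_mult_left:
  fixes g :: "'a :: comm_ring_1 mat"
  assumes g: "g \<in> carrier_mat 3 3" and M: "M \<in> carrier_mat 3 n" and ps: "\<And>j. j < 6 \<Longrightarrow> fst (ps j) = snd (ps j) \<and> snd (ps j) < n"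
  shows "\<exists>c. quad_det (g * M) ps = c * quad_det M ps"
proof -
  define S where "S = mat 6 6 (\<lambda>(i, m). g $$ (qrow1 i, qrow1 m) * g $$ (qrow2 i, qrow2 m) +
     (if m < 3 then 0 else g $$ (qrow1 i, qrow2 m) * g $$ (qrow2 i, qrow1 m)))"
  define T where "T = mat 6 6 (\<lambda>(i, j). M $$ (qrow1 i, fst (ps j)) * M $$ (qrow2 i, snd (ps j)))"
  have "mat 6 6 (\<lambda>(i, j). (g * M) $$ (qrow1 i, fst (ps j)) * (g * M) $$ (qrow2 i, snd (ps j))) = S * T"
  proof (rule eq_matI)
    fix i j assume "i < dim_row (S * T)" "j < dim_col (S * T)"
    then have ij: "i < 6" "j < 6" by (auto simp: S_def T_def)
    then have "(S * T) $$ (i, j) = (\<Sum>m<6. S $$ (i, m) * T $$ (m, j))"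
      by (simp add: S_def T_def scalar_prod_def lessThan_atLeast0)
    also have "\<dots> = (\<Sum>k<3. g $$ (qrow1 i, k) * M $$ (k, snd (ps j))) * (\<Sum>k<3. g $$ (qrow2 i, k) * M $$ (k, snd (ps j)))"
      unfolding product_of_linear_forms using ij ps[of j] by (intro sum.cong) (auto simp: S_def T_def)
    also have "\<dots> = (g * M) $$ (qrow1 i, fst (ps j)) * (g * M) $$ (qrow2 i, snd (ps j))"
      using ij ps[of j] qrow_lt[of i] by (simp add: mult_entry_3[OF g M] del: index_mult_mat)
    finally show "mat 6 6 (\<lambda>(i, j). (g * M) $$ (qrow1 i, fst (ps j)) * (g * M) $$ (qrow2 i, snd (ps j))) $$ (i, j) = (S * T) $$ (i, j)"
      using ij by simp
  qed (auto simp: S_def T_def)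
  then have "quad_det (g * M) ps = det S * quad_det M ps"
    unfolding quad_det_def T_def[symmetric] by (simp add: S_def T_def det_mult[of _ 6])
  then show ?thesis by blast
qed

lemma quad_det_veronese:
  assumes A: "A \<in> carrier_mat 2 n" and ps: "\<And>j. j < 6 \<Longrightarrow> fst (ps j) = snd (ps j) \<and> snd (ps j) < n"
  shows "quad_det (veronese A) ps = 0"
  unfolding quad_det_def
\<comment> \<open>Row 1 is the square of the middle coordinate and row 4 the product of the outer
  ones; they agree on the conic x_1^2 = x_0 x_2.\<close>
proof (rule det_identical_rows[of _ 6 1 4])
  let ?T = "mat 6 6 (\<lambda>(i, j). veronese A $$ (qrow1 i, fst (ps j)) * veronese A $$ (qrow2 i, snd (ps j)))"
  show "row ?T 1 = row ?T 4"
    by (rule eq_vecI) (use ps in \<open>auto simp: qrow1_def qrow2_def veronese_index[OF A] power2_eq_square simp flip: One_nat_def\<close>)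
qed auto

lemma ABCT_quad_det:
  assumes "A \<in> carrier_mat 2 n" "N \<in> row_class (veronese A)"
    and ps: "\<And>j. j < 6 \<Longrightarrow> fst (ps j) = snd (ps j) \<and> snd (ps j) < n"
  shows "quad_det N ps = 0"
proof -
  from assms(2) veronese_carrier[OF assms(1)] obtain g where g: "g \<in> carrier_mat 3 3" "N = g * veronese A"
    unfolding row_class_def by auto
  then show ?thesis
    using quad_det_mult_left[OF g(1) veronese_carrier[OF assms(1)] ps] quad_det_veronese[OF assms(1) ps] by auto
qed

text \<open>The square roots scale a point of the cone over the conic to an exact image of the Veronese map.\<close>

lemma conic_parametrisation:
  fixes x y z :: complex
  assumes "x * y + x * z + y * z = 0"
  shows "\<exists>p q. p\<^sup>2 = y + z \<and> q\<^sup>2 = x + z \<and> p * q = - z"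
proof -
  define p q where "p = csqrt (y + z)" and "q = csqrt (x + z)"
  have pq: "p\<^sup>2 = y + z" "q\<^sup>2 = x + z" by (simp_all add: p_def q_def)
  have "(p * q)\<^sup>2 = z\<^sup>2" unfolding power_mult_distrib pq using assms by (simp add: power2_eq_square algebra_simps)
  then have "p * q = z \<or> p * q = - z" by (simp add: power2_eq_iff)
  then show ?thesis
  proof
    assume "p * q = z"
    with pq show ?thesis by (intro exI[of _ "- p"] exI[of _ q]) simp
  next
    assume "p * q = - z"
    with pq show ?thesis by (intro exI[of _ p] exI[of _ q]) simp
  qed
qed

text \<open>A normalised matrix on a smooth conic is in the row class of an actual Veronese image
  and not merely in the closure, so elements of the ABCT ideal can be evaluated at it
  directly.\<close>

lemma ABCT_point:
  assumes J: "J \<in> charts n" and N: "N \<in> carrier_mat 3 n" "submatrix N UNIV J = 1\<^sub>m 3"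
    and nz: "\<alpha> \<noteq> 0" "\<beta> \<noteq> 0" "\<gamma> \<noteq> 0" and on: "\<And>k. k < n \<Longrightarrow> conic \<alpha> \<beta> \<gamma> (\<lambda>i. N $$ (i, k))"
  shows "\<exists>A \<in> carrier_mat 2 n. vec_space.rank 2 A = 2 \<and> vec_space.rank 3 (veronese A) = 3 \<and> N \<in> row_class (veronese A)"
proof -
  \<comment> \<open>Dividing the coordinates by \<gamma>, \<beta>, \<alpha> in this order brings the
    conic to the form x y + x z + y z = 0.\<close>
  have "\<exists>p q. p\<^sup>2 = N $$ (1, k) / \<beta> + N $$ (2, k) / \<alpha> \<and> q\<^sup>2 = N $$ (0, k) / \<gamma> + N $$ (2, k) / \<alpha> \<and> p * q = - (N $$ (2, k) / \<alpha>)"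
    if "k < n" for k
    using on[OF that] nz by (intro conic_parametrisation) (simp add: conic_def field_simps)
  then obtain p q where pq: "\<And>k. k < n \<Longrightarrow> (p k)\<^sup>2 = N $$ (1, k) / \<beta> + N $$ (2, k) / \<alpha>"
    "\<And>k. k < n \<Longrightarrow> (q k)\<^sup>2 = N $$ (0, k) / \<gamma> + N $$ (2, k) / \<alpha>" "\<And>k. k < n \<Longrightarrow> p k * q k = - (N $$ (2, k) / \<alpha>)"
    by metis
  define A where "A = mat 2 n (\<lambda>(i, k). if i = 0 then p k else q k)"
  have A: "A \<in> carrier_mat 2 n" by (simp add: A_def)
  note V = veronese_carrier[OF A]
  have V_entry: "veronese A $$ (0, k) = (p k)\<^sup>2" "veronese A $$ (1, k) = p k * q k" "veronese A $$ (2, k) = (q k)\<^sup>2"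
    if "k < n" for k
    using veronese_index[OF A that] that by (simp_all add: A_def)
  \<comment> \<open>Recovers \<gamma> x, \<beta> y, \<alpha> z from (p^2, p q, q^2) by x = q^2 + p
    q, y = p^2 + p q and z = - p q; \<open>h\<close> is its inverse.\<close>
  define g where "g = mat 3 3 (\<lambda>(i, j). [[0, \<gamma>, \<gamma>], [\<beta>, \<beta>, 0], [0, - \<alpha>, 0]] ! i ! j)"
  define h where "h = mat 3 3 (\<lambda>(i, j). [[0, 1 / \<beta>, 1 / \<alpha>], [0, 0, - 1 / \<alpha>], [1 / \<gamma>, 0, 1 / \<alpha>]] ! i ! j)"
  have c3: "i = 0 \<or> i = 1 \<or> i = 2" if "i < 3" for i :: nat using that by auto
  have g: "g \<in> carrier_mat 3 3" and h: "h \<in> carrier_mat 3 3" by (simp_all add: g_def h_def)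
  have gh: "g * h = 1\<^sub>m 3" and hg: "h * g = 1\<^sub>m 3"
    using nz by (auto intro!: eq_matI simp: g_def h_def scalar_prod_def numeral_3_eq_3 less_Suc_eq)
  have NgV: "N = g * veronese A"
  proof (rule eq_matI)
    fix i k assume "i < dim_row (g * veronese A)" "k < dim_col (g * veronese A)"
    then have ik: "i < 3" "k < n" using g V by auto
    show "N $$ (i, k) = (g * veronese A) $$ (i, k)"
      unfolding mult_entry_3[OF g V ik] sum_3 V_entry[OF ik(2)] pq[OF ik(2)] using c3[OF ik(1)] nz
      by (auto simp: g_def nth_Cons_numeral field_simps)
  qed (use N g V in auto)
  have "invertible_mat g"
    unfolding invertible_mat_def inverts_mat_def using g h gh hg by auto
  then have "N \<in> row_class (veronese A)"
    unfolding row_class_def using NgV g V by auto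
  moreover have "det (submatrix (veronese A) UNIV J) \<noteq> 0"
  proof
    assume z: "det (submatrix (veronese A) UNIV J) = 0"
    have sJ: "submatrix (veronese A) UNIV J \<in> carrier_mat 3 3"
      unfolding submatrix_UNIV_cols[OF V charts_pick(3)[OF J]] charts_pick(2)[OF J] by simp
    have "1\<^sub>m 3 = g * submatrix (veronese A) UNIV J"
      using N(2) submatrix_mult_UNIV[OF g V charts_pick(3)[OF J]] NgV by simp
    then have "det (1\<^sub>m 3 :: complex mat) = det g * det (submatrix (veronese A) UNIV J)"
      using det_mult[OF g sJ] by simp
    with z show False by simp
  qed
  note det_nz = this
  have "vec_space.rank 3 (veronese A) = 3"
    by (rule rank_3_if_minor[OF V J det_nz])
  moreover have "vec_space.rank 2 A = 2"
  proof (rule antisym)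
    show "vec_space.rank 2 A \<le> 2" by (rule vec_space.rank_le_nr[OF A])
    let ?j = "pick J"
    have lt: "?j 0 < n" "?j 1 < n" "?j 2 < n" using charts_pick(5)[OF J] by (simp_all del: pick.simps)
    have "det (submatrix (veronese A) UNIV J) = det (mat 3 3 (\<lambda>(i, j). veronese A $$ (i, ?j j)))"
      unfolding submatrix_UNIV_cols[OF V charts_pick(3)[OF J]] charts_pick(2)[OF J] ..
    \<comment> \<open>A homogeneous Vandermonde determinant: the 3 x 3 minor of the Veronese image
      is the product of the 2 x 2 minors of \<open>A\<close>, so these are nonzero.\<close>
    also have "\<dots> = (p (?j 0) * q (?j 1) - p (?j 1) * q (?j 0)) * ((p (?j 0) * q (?j 2) - p (?j 2) * q (?j 0)) *
        (p (?j 1) * q (?j 2) - p (?j 2) * q (?j 1)))"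
      unfolding det_mat_3 V_entry[OF lt(1)] V_entry[OF lt(2)] V_entry[OF lt(3)]
      by (simp add: power2_eq_square algebra_simps)
    finally have ne: "p (?j 0) * q (?j 1) \<noteq> p (?j 1) * q (?j 0)" using det_nz by auto
    have "pick J 0 < pick J 1" using pick_mono_le[of 1 J 0] charts_pick(2)[OF J] by (simp del: pick.simps)
    then show "2 \<le> vec_space.rank 2 A"
      using lt ne by (intro vec_space_rank_minor2[of A 2 n 0 1 "?j 0" "?j 1"]) (auto simp: A_def simp del: pick.simps)
  qed
  ultimately show ?thesis using A by blast
qed

section \<open>Reduction to standard monomials\<close>

lemma carrier_chart_ring: "carrier (chart_ring n J) = polys_in ({..<3} \<times> ({..<n} - J))"
  by (simp add: chart_ring_def)

lemma of_int_in_polys: "of_int \<sigma> \<in> polys_in X"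
proof -
  have "of_int \<sigma> = const_poly (of_int \<sigma>)" by (simp add: const_poly_def)
  then show ?thesis by simp
qed

lemma
  assumes "ideal K (chart_ring n J)"
  shows chart_ideal_subset: "K \<subseteq> polys_in ({..<3} \<times> ({..<n} - J))"
    and chart_ideal_0: "0 \<in> K"
    and chart_ideal_add: "f \<in> K \<Longrightarrow> g \<in> K \<Longrightarrow> f + g \<in> K"
    and chart_ideal_mult: "f \<in> K \<Longrightarrow> h \<in> polys_in ({..<3} \<times> ({..<n} - J)) \<Longrightarrow> h * f \<in> K"
proof -
  interpret ideal K "chart_ring n J" by fact
  show "K \<subseteq> polys_in ({..<3} \<times> ({..<n} - J))"
    using a_subset by (simp add: carrier_chart_ring)
  show "0 \<in> K" using additive_subgroup.zero_closed[OF additive_subgroup_axioms] by (simp add: chart_ring_def)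
  show "f + g \<in> K" if "f \<in> K" "g \<in> K" for f g
    using additive_subgroup.a_closed[OF additive_subgroup_axioms that] by (simp add: chart_ring_def)
  show "h * f \<in> K" if "f \<in> K" "h \<in> polys_in ({..<3} \<times> ({..<n} - J))" for f h
    using I_l_closed[OF that(1), of h] that(2) by (simp add: chart_ring_def)
qed

lemma chart_ideal_sum:
  assumes "ideal K (chart_ring n J)" "\<And>a. a \<in> A \<Longrightarrow> h a \<in> K"
  shows "sum h A \<in> K"
  using assms(2)
  by (induction A rule: infinite_finite_induct) (auto intro: chart_ideal_0[OF assms(1)] chart_ideal_add[OF assms(1)])

locale good_chart =
  fixes n r :: nat and A0 :: "nat set" and I :: "nat \<Rightarrow> nat set" and J :: "nat set" and K :: "mpoly set"
  assumes J: "J \<in> charts n"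
    and cover: "A0 \<union> (\<Union>i\<in>{1..r}. I i) = {..<n}"
    and A0_disjoint: "A0 \<inter> (\<Union>i\<in>{1..r}. I i) = {}"
    and I_disjoint: "disjoint_family_on I {1..r}"
    and J_A0: "J \<inter> A0 = {}" and J_I: "\<And>s. s \<in> {1..r} \<Longrightarrow> card (J \<inter> I s) < 2"
    and K: "ideal K (chart_ring n J)"
    and pluecker_subset: "positroid_pluecker_coords A0 r I (chart_matrix n J) \<subseteq> K"
    and minors_subset: "maximal_minors (theta_tilde r I (chart_matrix n J)) \<subseteq> K"
begin

text \<open>The value \<open>0\<close> stands for \<open>A0\<close>; the groups are numbered from \<open>1\<close>.\<close>

definition group :: "nat \<Rightarrow> nat" where
  "group k = (if \<exists>s\<in>{1..r}. k \<in> I s then THE s. s \<in> {1..r} \<and> k \<in> I s else 0)"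

lemma group_eq:
  assumes "s \<in> {1..r}" "k \<in> I s"
  shows "group k = s"
proof -
  have "(THE s. s \<in> {1..r} \<and> k \<in> I s) = s"
  proof (rule the_equality)
    fix s' assume s': "s' \<in> {1..r} \<and> k \<in> I s'"
    show "s' = s"
    proof (rule ccontr)
      assume "s' \<noteq> s"
      then have "I s' \<inter> I s = {}" using I_disjoint s' assms(1) unfolding disjoint_family_on_def by blast
      then show False using s' assms(2) by blast
    qed
  qed (use assms in auto)
  moreover have "\<exists>s\<in>{1..r}. k \<in> I s" using assms by blast
  ultimately show ?thesis unfolding group_def by (simp only: if_True)
qed

lemma group_cases:
  assumes "k < n"
  obtains "k \<in> A0" "group k = 0" | "group k \<in> {1..r}" "k \<in> I (group k)"
proof (cases "\<exists>s\<in>{1..r}. k \<in> I s")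
  case True
  then obtain s where s: "s \<in> {1..r}" "k \<in> I s" by blast
  with group_eq[OF s] that(2) show ?thesis by simp
next
  case False
  then have "k \<in> A0" using cover assms by blast
  with False that(1) show ?thesis by (simp add: group_def)
qed

text \<open>The group of the column of \<open>M\<close> that is the unit vector e_i.\<close>

definition special :: "nat \<Rightarrow> nat" where "special i = group (pick J i)"

lemma special_range:
  assumes "i < 3"
  shows "special i \<in> {1..r}" "pick J i \<in> I (special i)"
proof -
  have "pick J i \<in> J" "pick J i < n" using charts_pick(4,5)[OF J assms] .
  then have "pick J i \<notin> A0" using J_A0 by blast
  then show "special i \<in> {1..r}" "pick J i \<in> I (special i)"
    unfolding special_def using group_cases[OF \<open>pick J i < n\<close>] by blast+
qed

lemma special_inj:
  assumes "i < 3" "j < 3" "special i = special j"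
  shows "i = j"
proof (rule ccontr)
  assume "i \<noteq> j"
  then have ne: "pick J i \<noteq> pick J j" using charts_pick(6)[OF J assms(1,2)] by simp
  have "{pick J i, pick J j} \<subseteq> J \<inter> I (special i)"
    using special_range(2)[OF assms(1)] special_range(2)[OF assms(2)] assms(3)
      charts_pick(4)[OF J assms(1)] charts_pick(4)[OF J assms(2)] by simp
  moreover have "finite (J \<inter> I (special i))" using charts_pick(1)[OF J] by simp
  ultimately have "card {pick J i, pick J j} \<le> card (J \<inter> I (special i))" by (rule card_mono[rotated])
  then show False using ne J_I[OF special_range(1)[OF assms(1)]] by (simp del: pick.simps)
qed

abbreviation M where "M \<equiv> chart_matrix n J"

lemma M_carrier: "M \<in> carrier_mat 3 n"
  by (simp add: chart_matrix_def)

lemma M_J: "i < 3 \<Longrightarrow> j < 3 \<Longrightarrow> M $$ (i, pick J j) = (if i = j then 1 else 0)"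
  using charts_pick(4,5,6)[OF J] by (auto simp: chart_matrix_def simp del: pick.simps)

lemma M_var: "i < 3 \<Longrightarrow> k < n \<Longrightarrow> k \<notin> J \<Longrightarrow> M $$ (i, k) = xvar i k"
  by (simp add: chart_matrix_def)

section \<open>Relations among the matrix entries modulo K\<close>

lemma pluecker_in_K:
  assumes f: "\<And>j. j < 3 \<Longrightarrow> f j < n"
    and bad: "(\<exists>j<3. f j \<in> A0) \<or> (\<exists>s\<in>{1..r}. \<exists>j<3. \<exists>j'<3. f j \<noteq> f j' \<and> f j \<in> I s \<and> f j' \<in> I s)"
  shows "det (mat 3 3 (\<lambda>(i, j). M $$ (i, f j))) \<in> K"
proof -
  let ?S = "f ` {..<3}"
  consider "det (mat 3 3 (\<lambda>(i, j). M $$ (i, f j))) = 0" | \<sigma> where "card ?S = 3"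
    "det (mat 3 3 (\<lambda>(i, j). M $$ (i, f j))) = of_int \<sigma> * det (submatrix M UNIV ?S)"
    using det_columns_submatrix[where f = f, OF M_carrier f] by blast
  then show ?thesis
  proof cases
    case 1
    then show ?thesis using chart_ideal_0[OF K] by simp
  next
    case 2
    have "?S \<inter> A0 \<noteq> {} \<or> (\<exists>s\<in>{1..r}. 2 \<le> card (?S \<inter> I s))"
      using bad
    proof
      assume "\<exists>s\<in>{1..r}. \<exists>j<3. \<exists>j'<3. f j \<noteq> f j' \<and> f j \<in> I s \<and> f j' \<in> I s"
      then obtain s j j' where s: "s \<in> {1..r}" "j < 3" "j' < 3" "f j \<noteq> f j'" "f j \<in> I s" "f j' \<in> I s" by blast
      then have "card {f j, f j'} \<le> card (?S \<inter> I s)" by (intro card_mono) auto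
      then have "2 \<le> card (?S \<inter> I s)" using s(4) by simp
      with s(1) show ?thesis by blast
    qed auto
    then have "det (submatrix M UNIV ?S) \<in> positroid_pluecker_coords A0 r I M"
      unfolding positroid_pluecker_coords_def pluecker_coord_def
      using 2(1) f M_carrier by (intro CollectI exI[of _ ?S]) auto
    then show ?thesis
      unfolding 2(2) using pluecker_subset of_int_in_polys by (intro chart_ideal_mult[OF K]) auto
  qed
qed

lemma less_3_cases: "i < 3 \<Longrightarrow> i = 0 \<or> i = 1 \<or> i = (2::nat)"
  by auto

text \<open>Replacing the unit column e_i by column k turns the determinant into the entry (i, k).
  It is a Pluecker coordinate in K if k is in \<open>A0\<close>, or if the unit column of the group
  of k remains among the chosen columns.\<close>

lemma variable_in_K:
  assumes i: "i < 3" and k: "k < n" "k \<notin> J" and bad: "group k = 0 \<or> (\<exists>i'<3. i' \<noteq> i \<and> group k = special i')"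
  shows "xvar i k \<in> K"
proof -
  let ?f = "(pick J)(i := k)"
  have "det (mat 3 3 (\<lambda>(i, j). M $$ (i, ?f j))) \<in> K"
  proof (rule pluecker_in_K)
    show "?f j < n" if "j < 3" for j using that k charts_pick(5)[OF J that] by simp
    from bad show "(\<exists>j<3. ?f j \<in> A0) \<or> (\<exists>s\<in>{1..r}. \<exists>j<3. \<exists>j'<3. ?f j \<noteq> ?f j' \<and> ?f j \<in> I s \<and> ?f j' \<in> I s)"
    proof
      assume "group k = 0"
      then have "k \<in> A0" using group_cases[OF k(1)] by auto
      with i show ?thesis by (intro disjI1 exI[of _ i]) simp
    next
      assume "\<exists>i'<3. i' \<noteq> i \<and> group k = special i'"
      then obtain i' where i': "i' < 3" "i' \<noteq> i" "group k = special i'" by blast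
      have "k \<in> I (special i')" using group_cases[OF k(1)] i' special_range(1)[OF i'(1)] by auto
      moreover have "k \<noteq> pick J i'" using charts_pick(4)[OF J i'(1)] k(2) by blast
      ultimately show ?thesis using i i' special_range[OF i'(1)]
        by (intro disjI2 bexI[of _ "special i'"] exI[of _ i] exI[of _ i'] conjI) (simp_all del: pick.simps)
    qed
  qed
  also have "det (mat 3 3 (\<lambda>(i, j). M $$ (i, ?f j))) = xvar i k"
    unfolding det_mat_3 using less_3_cases[OF i] k
    by (elim disjE) (simp_all add: M_J M_var del: pick.simps One_nat_def)
  finally show ?thesis .
qed

text \<open>Replacing the unit columns e_i and e_i' by k and l leaves a 2 x 2 minor; two of the
  three columns then lie in one group.\<close>

lemma minor_in_K:
  assumes i: "i < 3" "i' < 3" and k: "k < n" "k \<notin> J" "l < n" "l \<notin> J" and g: "group k = group l" "group k \<in> {1..r}"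
  shows "xvar i k * xvar i' l - xvar i' k * xvar i l \<in> K"
proof (cases "i = i' \<or> k = l")
  case True
  then show ?thesis using chart_ideal_0[OF K] by (auto simp: mult.commute)
next
  case False
  let ?f = "(pick J)(i := k, i' := l)"
  have "det (mat 3 3 (\<lambda>(i, j). M $$ (i, ?f j))) \<in> K"
  proof (rule pluecker_in_K)
    show "?f j < n" if "j < 3" for j using that k charts_pick(5)[OF J that] by simp
    have "k \<in> I (group k)" "l \<in> I (group k)" using group_cases[OF k(1)] group_cases[OF k(3)] g by auto
    then show "(\<exists>j<3. ?f j \<in> A0) \<or> (\<exists>s\<in>{1..r}. \<exists>j<3. \<exists>j'<3. ?f j \<noteq> ?f j' \<and> ?f j \<in> I s \<and> ?f j' \<in> I s)"
      using i g(2) False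
      by (intro disjI2 bexI[of _ "group k"] exI[of _ i] exI[of _ i'] conjI) (simp_all del: pick.simps)
  qed
  also have "det (mat 3 3 (\<lambda>(i, j). M $$ (i, ?f j))) = xvar i k * xvar i' l - xvar i' k * xvar i l"
    unfolding det_mat_3 using less_3_cases[OF i(1)] less_3_cases[OF i(2)] k False
    by (elim disjE) (simp_all add: M_J M_var mult.commute del: pick.simps One_nat_def)
  finally show ?thesis .
qed

text \<open>The three unit columns are added to the chosen pairs. What remains are the rows u v, u
  w, v w, with the two factors of each product taken from the columns a and b.\<close>

lemma theta_minor_in_K:
  assumes p: "\<And>j. j < 3 \<Longrightarrow> a j < n \<and> a j \<notin> J \<and> b j < n \<and> b j \<notin> J \<and> group (a j) = group (b j) \<and> group (a j) \<in> {1..r}"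
  shows "det (mat 3 3 (\<lambda>(i, j). xvar (qrow1 (i + 3)) (a j) * xvar (qrow2 (i + 3)) (b j))) \<in> K"
proof -
  define ps where "ps j = (if j < 3 then (pick J j, pick J j) else (a (j - 3), b (j - 3)))" for j
  have ps: "ps j \<in> column_pairs r I (dim_col M)" if "j < 6" for j
  proof (cases "j < 3")
    case True
    then show ?thesis using charts_pick(5)[OF J True] M_carrier by (simp add: ps_def column_pairs_def)
  next
    case False
    then have "j - 3 < 3" using that by simp
    from p[OF this] have q: "a (j - 3) < n" "b (j - 3) < n" "group (a (j - 3)) = group (b (j - 3))" "group (a (j - 3)) \<in> {1..r}"
      by auto
    then have "a (j - 3) \<in> I (group (a (j - 3)))" "b (j - 3) \<in> I (group (a (j - 3)))"
      using group_cases[OF q(1)] group_cases[OF q(2)] by auto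
    with q False M_carrier show ?thesis by (auto simp: ps_def column_pairs_def)
  qed
  have "quad_det M ps \<in> K"
    using quad_det_maximal_minor[where ps = ps, OF ps] chart_ideal_0[OF K] minors_subset of_int_in_polys
    by (auto intro!: chart_ideal_mult[OF K])
  also have "quad_det M ps = det (mat 3 3 (\<lambda>(i, j). M $$ (qrow1 (i + 3), fst (ps (j + 3))) * M $$ (qrow2 (i + 3), snd (ps (j + 3)))))"
    unfolding quad_det_def
  proof (rule det_mat_6_unit_columns)
    fix i j :: nat assume ij: "i < 6" "j < 3"
    have "(qrow1 i = j \<and> qrow2 i = j) = (i = j)"
      using less_6_cases[OF ij(1)] less_3_cases[OF ij(2)] by (auto simp: qrow1_def qrow2_def nth_Cons_numeral)
    then show "M $$ (qrow1 i, fst (ps j)) * M $$ (qrow2 i, snd (ps j)) = (if i = j then 1 else 0)"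
      using ij qrow_lt[of i] by (auto simp: ps_def M_J simp del: pick.simps)
  qed
  also have "mat 3 3 (\<lambda>(i, j). M $$ (qrow1 (i + 3), fst (ps (j + 3))) * M $$ (qrow2 (i + 3), snd (ps (j + 3)))) =
      mat 3 3 (\<lambda>(i, j). xvar (qrow1 (i + 3)) (a j) * xvar (qrow2 (i + 3)) (b j))"
    using p by (intro eq_matI) (auto simp: ps_def M_var qrow_lt)
  finally show ?thesis .
qed

section \<open>Exchange of entries within a group\<close>

definition group_vars :: "(nat \<times> nat) set" where
  "group_vars = {(i, k). i < 3 \<and> k < n \<and> k \<notin> J \<and> group k \<in> {1..r}}"

abbreviation vars :: "(nat \<times> nat) set" where "vars \<equiv> {..<3} \<times> ({..<n} - J)"

definition row_group :: "nat \<times> nat \<Rightarrow> nat \<times> nat" where "row_group = (\<lambda>(i, k). (i, group k))"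

lemma group_vars_subset: "group_vars \<subseteq> vars"
  by (auto simp: group_vars_def)

lemma monomial_mult_in_K: "set_mset E \<subseteq> vars \<Longrightarrow> f \<in> K \<Longrightarrow> monomial E * f \<in> K"
  by (rule chart_ideal_mult[OF K _ monomial_in_polys])

text \<open>Modulo the \<open>2 \<times> 2\<close> minors of each group (the equations of a Segre cone), a monomial is determined
  by its degree in each column and, for each group, its degree in each row.\<close>

lemma monomials_congruent:
  assumes "set_mset E \<subseteq> group_vars" "set_mset E' \<subseteq> group_vars"
    "image_mset snd E = image_mset snd E'" "image_mset row_group E = image_mset row_group E'"
  shows "monomial E - monomial E' \<in> K"
  using assms
proof (induction E arbitrary: E')
  case empty
  then have "E' = {#}" by simp
  then show ?case using chart_ideal_0[OF K] by simp
next
  case (add v E)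
  obtain i k where v: "v = (i, k)" by (cases v)
  have ik: "i < 3" "k < n" "k \<notin> J" "group k \<in> {1..r}" using add.prems(1) v by (auto simp: group_vars_def)
  have "\<exists>F. set_mset (add_mset v F) \<subseteq> group_vars \<and> monomial (add_mset v F) - monomial E' \<in> K \<and>
     image_mset snd (add_mset v F) = image_mset snd E' \<and> image_mset row_group (add_mset v F) = image_mset row_group E'"
  proof (cases "v \<in># E'")
    case True
    then show ?thesis using add.prems chart_ideal_0[OF K]
      by (intro exI[of _ "E' - {#v#}"]) (simp only: insert_DiffM diff_self simp_thms)
  next
    case False
    \<comment> \<open>Exchange: equal columns provide w = (i', k) in \<open>E'\<close>, equal rows
      and groups provide u = (i, k'). A 2 x 2 minor replaces these two by (i, k) and (i', k'), which
      brings v into the monomial and preserves both invariants.\<close>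
    have "snd v \<in># image_mset snd E'" unfolding add.prems(3)[symmetric] by simp
    then obtain w where w: "w \<in># E'" "snd w = k" using v by auto
    obtain i' where i': "w = (i', k)" using w(2) by (cases w) simp
    have "row_group v \<in># image_mset row_group E'" unfolding add.prems(4)[symmetric] by simp
    then obtain u where u: "u \<in># E'" "row_group u = (i, group k)" using v by (auto simp: row_group_def)
    obtain k' where k': "u = (i, k')" "group k' = group k" using u(2) by (cases u) (simp add: row_group_def)
    have "w \<noteq> u" using False w u i' k' v by auto
    have E'w: "E' = add_mset w (E' - {#w#})" using w(1) by simp
    have "u \<in># add_mset w (E' - {#w#})" using u(1) E'w by simp
    with \<open>w \<noteq> u\<close> have "u \<in># E' - {#w#}" by simp
    then have "E' - {#w#} = add_mset u (E' - {#w#} - {#u#})" by (rule insert_DiffM[symmetric])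
    with E'w obtain F where F: "E' = add_mset w (add_mset u F)" by metis
    have mem: "w \<in> group_vars" "u \<in> group_vars" "set_mset F \<subseteq> group_vars"
      using add.prems(2) unfolding F by auto
    then have k'2: "i' < 3" "k' < n" "k' \<notin> J" using i' k' by (auto simp: group_vars_def)
    have "xvar i k * xvar i' k' - xvar i' k * xvar i k' \<in> K"
      by (rule minor_in_K[OF ik(1) k'2(1) ik(2,3) k'2(2,3) k'(2)[symmetric] ik(4)])
    then have "monomial F * (xvar i k * xvar i' k' - xvar i' k * xvar i k') \<in> K"
      using mem(3) group_vars_subset by (intro monomial_mult_in_K) auto
    also have "monomial F * (xvar i k * xvar i' k' - xvar i' k * xvar i k') =
       monomial (add_mset v (add_mset (i', k') F)) - monomial E'"
      unfolding F v i' k'(1) by (simp add: algebra_simps)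
    finally have 1: "monomial (add_mset v (add_mset (i', k') F)) - monomial E' \<in> K" .
    have 2: "set_mset (add_mset v (add_mset (i', k') F)) \<subseteq> group_vars"
      using mem ik k'2 k'(2) unfolding v by (auto simp: group_vars_def)
    have 3: "image_mset snd (add_mset v (add_mset (i', k') F)) = image_mset snd E'"
      unfolding F v i' k'(1) by simp
    have 4: "image_mset row_group (add_mset v (add_mset (i', k') F)) = image_mset row_group E'"
      unfolding F v i' k'(1) by (simp add: row_group_def k'(2))
    from 1 2 3 4 show ?thesis by (intro exI[of _ "add_mset (i', k') F"] conjI)
  qed
  then obtain F where F: "set_mset (add_mset v F) \<subseteq> group_vars" "monomial (add_mset v F) - monomial E' \<in> K"
     "image_mset snd (add_mset v F) = image_mset snd E'" "image_mset row_group (add_mset v F) = image_mset row_group E'"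
    by (elim exE conjE)
  have "monomial E - monomial F \<in> K"
  proof (rule add.IH)
    show "set_mset E \<subseteq> group_vars" "set_mset F \<subseteq> group_vars" using add.prems(1) F(1) by auto
    show "image_mset snd E = image_mset snd F"
      using trans[OF add.prems(3) F(3)[symmetric]] by simp
    show "image_mset row_group E = image_mset row_group F"
      using trans[OF add.prems(4) F(4)[symmetric]] by simp
  qed
  then have "monomial {#v#} * (monomial E - monomial F) \<in> K"
    using ik v by (intro monomial_mult_in_K) auto
  then have "monomial {#v#} * (monomial E - monomial F) + (monomial (add_mset v F) - monomial E') \<in> K"
    using F(2) by (rule chart_ideal_add[OF K])
  then show ?case by (simp add: algebra_simps)
qed

section \<open>Standard monomials span modulo K\<close>

definition free_groups :: "nat set" where "free_groups = {1..r} - special ` {..<3}"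

definition exps :: "(nat \<times> nat) multiset \<Rightarrow> nat \<Rightarrow> nat \<Rightarrow> nat" where
  "exps E s i = count (image_mset row_group E) (i, s)"

text \<open>The entries that survive \<open>variable_in_K\<close>: the group of e_i keeps only row
  i, the free groups keep all three rows.\<close>

definition std_vars :: "(nat \<times> nat) set" where
  "std_vars = {(i, k) \<in> group_vars. group k \<in> free_groups \<or> group k = special i}"

definition standard :: "(nat \<times> nat) multiset \<Rightarrow> bool" where
  "standard E \<longleftrightarrow> set_mset E \<subseteq> std_vars \<and> std3 free_groups (exps E)"

lemma exps_pos: "exps E s i \<noteq> 0 \<Longrightarrow> \<exists>k. (i, k) \<in># E \<and> group k = s"
  unfolding exps_def by (auto simp: row_group_def not_in_iff[symmetric] simp flip: count_greater_zero_iff)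

text \<open>The lists may repeat a monomial, which is why independence is formulated for indexed
  families.\<close>

definition std_span :: "mpoly set" where
  "std_span = {f. \<exists>L. (\<forall>(c, E) \<in> set L. standard E) \<and> f - (\<Sum>(c, E)\<leftarrow>L. const_poly c * monomial E) \<in> K}"

lemma std_span_K: "f \<in> K \<Longrightarrow> f \<in> std_span"
  unfolding std_span_def by (rule CollectI, rule exI[of _ "[]"]) simp

lemma std_span_standard: "standard E \<Longrightarrow> monomial E \<in> std_span"
  unfolding std_span_def using chart_ideal_0[OF K]
  by (intro CollectI exI[of _ "[(1, E)]"]) (simp add: const_poly_def)

lemma std_span_add:
  assumes "f \<in> std_span" "g \<in> std_span"
  shows "f + g \<in> std_span"
proof -
  from assms obtain L L' where L: "\<forall>(c, E) \<in> set L. standard E" "f - (\<Sum>(c, E)\<leftarrow>L. const_poly c * monomial E) \<in> K"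
    and L': "\<forall>(c, E) \<in> set L'. standard E" "g - (\<Sum>(c, E)\<leftarrow>L'. const_poly c * monomial E) \<in> K"
    unfolding std_span_def by auto
  have "f + g - (\<Sum>(c, E)\<leftarrow>L @ L'. const_poly c * monomial E) \<in> K"
    using chart_ideal_add[OF K L(2) L'(2)] by (simp add: algebra_simps)
  then show ?thesis
    unfolding std_span_def using L(1) L'(1) by (intro CollectI exI[of _ "L @ L'"]) auto
qed

lemma const_poly_mult: "const_poly a * const_poly b = const_poly (a * b)"
  by (simp add: const_poly_def mult_single)

lemma std_span_const:
  assumes "f \<in> std_span"
  shows "const_poly a * f \<in> std_span"
proof -
  from assms obtain L where L: "\<forall>(c, E) \<in> set L. standard E" "f - (\<Sum>(c, E)\<leftarrow>L. const_poly c * monomial E) \<in> K"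
    unfolding std_span_def by auto
  have "const_poly a * (f - (\<Sum>(c, E)\<leftarrow>L. const_poly c * monomial E)) \<in> K"
    by (rule chart_ideal_mult[OF K L(2)]) simp
  also have "const_poly a * (\<Sum>(c, E)\<leftarrow>L. const_poly c * monomial E) = (\<Sum>(c, E)\<leftarrow>map (map_prod ((*) a) id) L. const_poly c * monomial E)"
    by (induction L) (auto simp: distrib_left const_poly_mult simp flip: mult.assoc)
  then have "const_poly a * (f - (\<Sum>(c, E)\<leftarrow>L. const_poly c * monomial E)) =
     const_poly a * f - (\<Sum>(c, E)\<leftarrow>map (map_prod ((*) a) id) L. const_poly c * monomial E)"
    by (simp add: algebra_simps)
  finally show ?thesis
    unfolding std_span_def using L(1) by (intro CollectI exI[of _ "map (map_prod ((*) a) id) L"]) auto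
qed

lemma std_span_uminus: "f \<in> std_span \<Longrightarrow> - f \<in> std_span"
  using std_span_const[of f "-1"] by (simp add: const_poly_def single_uminus)

text \<open>Among the terms of the minor for groups \<open>s\<^sub>0 < s\<^sub>1 < s\<^sub>2\<close>, the weight is \<open>s\<^sub>p + 2 s\<^sub>q + 3 s\<^sub>t\<close>, which
  by rearrangement is largest for the diagonal term only.\<close>

definition weight :: "(nat \<times> nat) multiset \<Rightarrow> nat" where
  "weight E = (\<Sum>(i, k)\<in>#E. group k * i)"

lemma weight_plus: "weight (E + F) = weight E + weight F"
  by (simp add: weight_def)

lemma mset_subseteq_if_distinct:
  assumes "distinct xs" "set xs \<subseteq> set_mset E"
  shows "mset xs \<subseteq># E"
proof (rule mset_subset_eqI)
  fix a
  have le1: "count (mset xs) a \<le> 1" using assms(1) by (simp add: distinct_count_atmost_1)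
  show "count (mset xs) a \<le> count E a"
  proof (cases "a \<in> set xs")
    case True
    then have "1 \<le> count E a" using assms(2) by (auto simp: Suc_le_eq)
    with le1 show ?thesis by (rule order_trans)
  next
    case False
    then have "count (mset xs) a = 0" using not_in_iff[of a "mset xs"] by simp
    then show ?thesis by (simp only: le0)
  qed
qed

lemma monomial_in_std_span: "set_mset E \<subseteq> vars \<Longrightarrow> monomial E \<in> std_span"
proof (induction "weight E" arbitrary: E rule: less_induct)
  case less
  consider "\<not> set_mset E \<subseteq> std_vars" | "standard E" | "set_mset E \<subseteq> std_vars" "\<not> std3 free_groups (exps E)"
    unfolding standard_def by blast
  then show ?case
  proof cases
    case 1
    then obtain v where v: "v \<in># E" "v \<notin> std_vars" by blast
    obtain i k where ik: "v = (i, k)" by (cases v)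
    have lt: "i < 3" "k < n" "k \<notin> J" using v(1) less.prems ik by auto
    have "xvar i k \<in> K"
    proof (rule variable_in_K[OF lt])
      have "group k = 0 \<or> group k \<in> {1..r}" using group_cases[OF lt(2)] by blast
      with v(2) lt show "group k = 0 \<or> (\<exists>i'<3. i' \<noteq> i \<and> group k = special i')"
        unfolding ik std_vars_def group_vars_def free_groups_def by auto
    qed
    then have "monomial (E - {#v#}) * xvar i k \<in> K"
      using less.prems by (intro monomial_mult_in_K) (auto dest: in_diffD)
    also have "monomial (E - {#v#}) * xvar i k = monomial (add_mset v (E - {#v#}))"
      unfolding ik by (simp add: mult.commute)
    finally show ?thesis using v(1) by (intro std_span_K) simp
  next
    case 2
    then show ?thesis by (rule std_span_standard)
  next
    case 3
    then obtain s0 s1 s2 where s: "s0 \<in> free_groups" "s1 \<in> free_groups" "s2 \<in> free_groups" "s0 < s1" "s1 < s2"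
      and e: "exps E s0 0 \<noteq> 0" "exps E s0 1 \<noteq> 0" "exps E s1 0 \<noteq> 0" "exps E s1 2 \<noteq> 0" "exps E s2 1 \<noteq> 0" "exps E s2 2 \<noteq> 0"
      unfolding std3_def by blast
    \<comment> \<open>The two factors belonging to one group may sit in different columns a_j and
      b_j; a minor with the mixed columns (a_j, b_j) then has the right multidegree.\<close>
    from exps_pos[OF e(1)] obtain a0 where a0: "(0, a0) \<in># E" "group a0 = s0" by blast
    from exps_pos[OF e(2)] obtain b0 where b0: "(1, b0) \<in># E" "group b0 = s0" by blast
    from exps_pos[OF e(3)] obtain a1 where a1: "(0, a1) \<in># E" "group a1 = s1" by blast
    from exps_pos[OF e(4)] obtain b1 where b1: "(2, b1) \<in># E" "group b1 = s1" by blast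
    from exps_pos[OF e(5)] obtain a2 where a2: "(1, a2) \<in># E" "group a2 = s2" by blast
    from exps_pos[OF e(6)] obtain b2 where b2: "(2, b2) \<in># E" "group b2 = s2" by blast
    let ?xs = "[(0, a0), (1, b0), (0, a1), (2, b1), (1, a2), (2, b2)] :: (nat \<times> nat) list"
    have "distinct ?xs" using s a0 b0 a1 b1 a2 b2 by auto
    then have "mset ?xs \<subseteq># E" by (rule mset_subseteq_if_distinct) (use a0 b0 a1 b1 a2 b2 in auto)
    then obtain F where EF: "E = mset ?xs + F" by (metis subset_mset.le_iff_add)
    define a where "a j = (if j = 0 then a0 else if j = 1 then a1 else a2)" for j :: nat
    define b where "b j = (if j = 0 then b0 else if j = 1 then b1 else b2)" for j :: nat
    define \<sigma> where "\<sigma> j = (if j = 0 then s0 else if j = 1 then s1 else s2)" for j :: nat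
    have \<sigma>: "group (a j) = \<sigma> j" "group (b j) = \<sigma> j" for j
      using a0 b0 a1 b1 a2 b2 by (auto simp: a_def b_def \<sigma>_def)
    have in_vars: "(0, a0) \<in> vars" "(1, b0) \<in> vars" "(0, a1) \<in> vars" "(2, b1) \<in> vars" "(1, a2) \<in> vars" "(2, b2) \<in> vars" "set_mset F \<subseteq> vars"
      using less.prems unfolding EF by auto
    then have ab: "a j < n \<and> a j \<notin> J \<and> b j < n \<and> b j \<notin> J" for j
      by (auto simp: a_def b_def)
    have "\<sigma> j \<in> {1..r}" for j using s by (auto simp: \<sigma>_def free_groups_def)
    with ab \<sigma> have det: "det (mat 3 3 (\<lambda>(i, j). xvar (qrow1 (i + 3)) (a j) * xvar (qrow2 (i + 3)) (b j))) \<in> K" (is "?D \<in> K")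
      by (intro theta_minor_in_K) auto
    define T :: "nat \<Rightarrow> nat \<Rightarrow> nat \<Rightarrow> (nat \<times> nat) multiset" where "T p q t = mset [(0, a p), (1, b p), (0, a q), (2, b q), (1, a t), (2, b t)]" for p q t
    have T_vars: "set_mset (T p q t) \<subseteq> vars" for p q t
      using ab by (auto simp: T_def)
    have T_mono: "monomial (T p q t) = (xvar 0 (a p) * xvar 1 (b p)) * (xvar 0 (a q) * xvar 2 (b q)) * (xvar 1 (a t) * xvar 2 (b t))" for p q t
      by (simp add: T_def mult_ac)
    have T_weight: "weight (T p q t) = \<sigma> p + 2 * \<sigma> q + 3 * \<sigma> t" for p q t
      by (simp add: T_def weight_def \<sigma>)
    have E: "E = T 0 1 2 + F"
      unfolding EF T_def a_def b_def by simp
    have span: "monomial (T p q t + F) \<in> std_span" if "\<sigma> p + 2 * \<sigma> q + 3 * \<sigma> t < \<sigma> 0 + 2 * \<sigma> 1 + 3 * \<sigma> 2" for p q t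
      by (rule less.hyps) (use that T_vars in_vars(7) in \<open>auto simp: E weight_plus T_weight\<close>)
    have \<sigma>lt: "\<sigma> 0 < \<sigma> 1" "\<sigma> 1 < \<sigma> 2" using s by (auto simp: \<sigma>_def)
    have D: "?D = monomial (T 0 1 2) - monomial (T 0 2 1) - monomial (T 1 0 2) + monomial (T 1 2 0) + monomial (T 2 0 1) - monomial (T 2 1 0)"
      unfolding det_mat_3 T_mono by (simp add: qrow1_def qrow2_def nth_Cons_numeral algebra_simps)
    \<comment> \<open>The minor solved for its diagonal term: all other terms have smaller weight
      and are covered by the induction.\<close>
    have "monomial E = monomial F * ?D + (monomial (T 0 2 1 + F) + monomial (T 1 0 2 + F) + (- monomial (T 1 2 0 + F)) + (- monomial (T 2 0 1 + F)) + monomial (T 2 1 0 + F))"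
      unfolding E D by (simp add: algebra_simps)
    also have "\<dots> \<in> std_span"
      using \<sigma>lt det in_vars(7)
      by (intro std_span_add std_span_uminus span std_span_K monomial_mult_in_K) auto
    finally show ?thesis .
  qed
qed

lemma polys_in_std_span:
  assumes "f \<in> polys_in vars"
  shows "f \<in> std_span"
proof -
  obtain L where L: "\<And>c E. (c, E) \<in> set L \<Longrightarrow> set_mset E \<subseteq> vars" "f = (\<Sum>(c, E)\<leftarrow>L. const_poly c * monomial E)"
    using polys_in_monomials[OF assms] by metis
  have "(\<Sum>(c, E)\<leftarrow>L. const_poly c * monomial E) \<in> std_span"
    using L(1)
  proof (induction L)
    case Nil
    show ?case using std_span_K[OF chart_ideal_0[OF K]] by simp
  next
    case (Cons p L)
    obtain c E where p: "p = (c, E)" by (cases p)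
    have "const_poly c * monomial E + (\<Sum>(c, E)\<leftarrow>L. const_poly c * monomial E) \<in> std_span"
      by (intro std_span_add std_span_const monomial_in_std_span Cons.IH) (use Cons.prems p in auto)
    then show ?case by (simp add: p)
  qed
  with L(2) show ?thesis by simp
qed

end

section \<open>Polynomials vanishing at the configurations\<close>

lemma power_product_cong_exps: "(\<And>s i. s \<in> S \<Longrightarrow> i < 3 \<Longrightarrow> e s i = e' s i) \<Longrightarrow> power_product S e Y = power_product S e' Y"
  unfolding power_product_def by (intro prod.cong) auto

lemma power_product_increment:
  assumes "finite S" "s \<in> S" "i < 3"
    and e: "\<And>s' j. e' s' j = (if s' = s \<and> j = i then Suc (e s' j) else e s' j)"
  shows "power_product S e' Y = Y s i * power_product S e Y"
proof -
  have S: "S = insert s (S - {s})" using assms(2) by blast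
  have fin: "finite (S - {s})" "s \<notin> S - {s}" using assms(1) by auto
  have "power_product (S - {s}) e' Y = power_product (S - {s}) e Y"
    by (rule power_product_cong_exps) (auto simp: e)
  moreover have "i = 0 \<or> i = 1 \<or> i = 2" using assms(3) by auto
  moreover have "power_product S f Y = Y s 0 ^ f s 0 * Y s 1 ^ f s 1 * Y s 2 ^ f s 2 * power_product (S - {s}) f Y" for f
    by (subst S) (rule power_product_insert[OF fin])
  ultimately show ?thesis
    by (auto simp: e)
qed

lemma prod_mset_eq_power_product:
  assumes "finite S" "\<And>i s. (i, s) \<in># Q \<Longrightarrow> i < 3"
  shows "(\<Prod>(i, s)\<in>#Q. if s \<in> S then Y s i else 1) = power_product S (\<lambda>s i. count Q (i, s)) Y"
  using assms(2)
proof (induction Q)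
  case empty
  then show ?case by (simp add: power_product_def)
next
  case (add p Q)
  obtain i s where p: "p = (i, s)" by (cases p)
  have i: "i < 3" using add.prems[of i s] p by simp
  have IH: "(\<Prod>(i, s)\<in>#Q. if s \<in> S then Y s i else 1) = power_product S (\<lambda>s i. count Q (i, s)) Y"
    by (rule add.IH) (use add.prems in auto)
  show ?case
  proof (cases "s \<in> S")
    case True
    have "power_product S (\<lambda>s i. count (add_mset p Q) (i, s)) Y = Y s i * power_product S (\<lambda>s i. count Q (i, s)) Y"
      by (rule power_product_increment[OF assms(1) True i]) (auto simp: p)
    then show ?thesis using True IH by (simp add: p)
  next
    case False
    have "power_product S (\<lambda>s i. count (add_mset p Q) (i, s)) Y = power_product S (\<lambda>s i. count Q (i, s)) Y"
      by (rule power_product_cong_exps) (use False in \<open>auto simp: p\<close>)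
    then show ?thesis using False IH by (simp add: p)
  qed
qed

definition good_point :: "nat \<Rightarrow> nat set \<Rightarrow> nat \<Rightarrow> (nat \<Rightarrow> nat set) \<Rightarrow> nat set \<Rightarrow> complex mat \<Rightarrow> bool" where
  "good_point n A0 r I J N \<longleftrightarrow> positroid_point n A0 r I N \<and> submatrix N UNIV J = 1\<^sub>m 3 \<and>
     (\<exists>\<alpha> \<beta> \<gamma>. \<alpha> \<noteq> 0 \<and> \<beta> \<noteq> 0 \<and> \<gamma> \<noteq> 0 \<and> (\<forall>k<n. conic \<alpha> \<beta> \<gamma> (\<lambda>i. N $$ (i, k))))"

lemma count_image_mset_Pair: "count (image_mset (Pair a) Q) (i, s) = (if i = a then count Q s else 0)"
  by (induction Q) auto

text \<open>Independence of ordinary monomials in t. It is read off from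
  \<open>independent_std1\<close> by using coordinate 0 alone: such exponents satisfy
  \<open>std1\<close>, and \<open>axes\<close> does not restrict that coordinate.\<close>

lemma cancels_multisets:
  fixes \<tau> :: "nat \<Rightarrow> nat multiset"
  assumes "finite A" "finite T" "\<And>x. x \<in> A \<Longrightarrow> set_mset (\<tau> x) \<subseteq> T"
    and van: "\<And>t. (\<Sum>x\<in>A. c x * (\<Prod>k\<in>#\<tau> x. t k)) = (0::complex)"
  shows "(\<Sum>x | x \<in> A \<and> \<tau> x = \<mu>. c x) = 0"
proof (cases "set_mset \<mu> \<subseteq> T")
  case False
  then have "{x. x \<in> A \<and> \<tau> x = \<mu>} = {}" using assms(3) by blast
  then show ?thesis by (simp only: sum.empty)
next
  case True
  define e where "e x k i = (if i = 0 then count (\<tau> x) k else 0)" for x k and i :: nat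
  have "cancels T A c e"
  proof (rule independent_onD[OF independent_std1[OF assms(2)] assms(1)])
    show "std1 T (e x)" for x by (simp add: std1_def e_def)
    fix Y
    have "power_product T (e x) Y = (\<Prod>k\<in>#\<tau> x. Y k 0)" if "x \<in> A" for x
    proof -
      have "(\<Prod>k\<in>#\<tau> x. Y k 0) = (\<Prod>(i, s)\<in>#image_mset (Pair 0) (\<tau> x). if s \<in> T then Y s i else 1)"
        using assms(3)[OF that] by (auto simp: multiset.map_comp o_def intro!: arg_cong[of _ _ prod_mset] image_mset_cong)
      also have "\<dots> = power_product T (\<lambda>s i. count (image_mset (Pair 0) (\<tau> x)) (i, s)) Y"
        by (rule prod_mset_eq_power_product[OF assms(2)]) auto
      also have "\<dots> = power_product T (e x) Y"
      proof (rule power_product_cong_exps)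
        fix s i :: nat
        have "count (image_mset (Pair (0::nat)) (\<tau> x)) (i, s) = (if i = 0 then count (\<tau> x) s else 0)"
          by (rule count_image_mset_Pair)
        then show "count (image_mset (Pair 0) (\<tau> x)) (i, s) = e x s i" by (simp add: e_def)
      qed
      finally show ?thesis ..
    qed
    then show "(\<Sum>x\<in>A. c x * power_product T (e x) Y) = 0"
      using van[of "\<lambda>k. Y k 0"] by simp
  qed
  moreover have "{x. x \<in> A \<and> \<tau> x = \<mu>} = {x. x \<in> A \<and> exponent_key T (e x) = (\<lambda>k i. if k \<in> T \<and> i = 0 then count \<mu> k else 0)}"
  proof (intro Collect_cong conj_cong refl)
    fix x assume x: "x \<in> A"
    show "\<tau> x = \<mu> \<longleftrightarrow> exponent_key T (e x) = (\<lambda>k i. if k \<in> T \<and> i = 0 then count \<mu> k else 0)"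
    proof
      assume exponent_key: "exponent_key T (e x) = (\<lambda>k i. if k \<in> T \<and> i = 0 then count \<mu> k else 0)"
      show "\<tau> x = \<mu>"
      proof (rule multiset_eqI)
        fix k
        show "count (\<tau> x) k = count \<mu> k"
        proof (cases "k \<in> T")
          case True
          then show ?thesis using fun_cong[OF fun_cong[OF exponent_key, of k], of 0] by (simp add: exponent_key_def e_def)
        next
          case False
          then have "k \<notin># \<tau> x" "k \<notin># \<mu>" using assms(3)[OF x] True by auto
          then show ?thesis by (simp add: not_in_iff)
        qed
      qed
    qed (auto simp: exponent_key_def e_def fun_eq_iff)
  qed
  ultimately show ?thesis
    by (simp only: cancels_def)
qed

context good_chart
begin

section \<open>Test matrices on a smooth conic\<close>

definition group_point :: "(nat \<Rightarrow> nat \<Rightarrow> complex) \<Rightarrow> nat \<Rightarrow> nat \<Rightarrow> complex" where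
  "group_point Y s i = (if s \<in> free_groups then Y s i else if s = special i then 1 else 0)"

definition point_matrix :: "(nat \<Rightarrow> complex) \<Rightarrow> (nat \<Rightarrow> nat \<Rightarrow> complex) \<Rightarrow> complex mat" where
  "point_matrix t Y = mat 3 n (\<lambda>(i, k). (if k \<in> J then 1 else t k) * group_point Y (group k) i)"

lemma group_point_special:
  assumes "i < 3" "j < 3"
  shows "group_point Y (special j) i = (if i = j then 1 else 0)"
  using assms special_inj[OF assms] by (auto simp: group_point_def free_groups_def)

lemma finite_free_groups: "finite free_groups"
  by (simp add: free_groups_def)

lemma good_point_point_matrix:
  assumes Y: "Y \<in> smooth_conics free_groups"
  shows "good_point n A0 r I J (point_matrix t Y)"
  unfolding good_point_def positroid_point_def
proof (intro conjI ballI)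
  let ?N = "point_matrix t Y"
  show car: "?N \<in> carrier_mat 3 n" by (simp add: point_matrix_def)
  show "\<forall>i<3. ?N $$ (i, k) = 0" if k: "k \<in> A0" for k
  proof (intro allI impI)
    fix i :: nat assume i: "i < 3"
    have "k \<in> A0 \<union> (\<Union>i\<in>{1..r}. I i)" by (rule UnI1[OF k])
    then have "k < n" unfolding cover by simp
    moreover have "group k = 0"
    proof (rule group_cases[OF \<open>k < n\<close>])
      assume "group k \<in> {1..r}" "k \<in> I (group k)"
      with k A0_disjoint show ?thesis by blast
    qed
    moreover have "special i \<noteq> 0" using special_range(1)[OF i] by auto
    ultimately show "?N $$ (i, k) = 0" using i by (simp add: point_matrix_def group_point_def free_groups_def)
  qed
  show "\<exists>t' y. \<forall>k\<in>I s. \<forall>i<3. ?N $$ (i, k) = t' k * y i" if s: "s \<in> {1..r}" for s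
  proof (intro exI ballI allI impI)
    fix k i assume k: "k \<in> I s" and i: "i < (3::nat)"
    have "k \<in> A0 \<union> (\<Union>i\<in>{1..r}. I i)" by (rule UnI2, rule UN_I[OF s], rule k)
    then have "k < n" unfolding cover by simp
    then show "?N $$ (i, k) = (if k \<in> J then 1 else t k) * group_point Y s i"
      using i group_eq[OF s k] by (simp add: point_matrix_def)
  qed
  show "submatrix ?N UNIV J = 1\<^sub>m 3"
    unfolding submatrix_UNIV_cols[OF car charts_pick(3)[OF J]] charts_pick(2)[OF J]
  proof (rule eq_matI)
    fix i j assume "i < dim_row (1\<^sub>m 3 :: complex mat)" "j < dim_col (1\<^sub>m 3 :: complex mat)"
    then have ij: "i < 3" "j < 3" by auto
    have "group (pick J j) = special j" by (simp only: special_def)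
    then show "mat 3 3 (\<lambda>(i, j). ?N $$ (i, pick J j)) $$ (i, j) = 1\<^sub>m 3 $$ (i, j)"
      using ij charts_pick(4,5)[OF J ij(2)] by (simp add: point_matrix_def group_point_special del: pick.simps)
  qed auto
  from Y obtain \<alpha> \<beta> \<gamma> where nz: "\<alpha> \<noteq> 0" "\<beta> \<noteq> 0" "\<gamma> \<noteq> 0" and on: "\<And>s. s \<in> free_groups \<Longrightarrow> conic \<alpha> \<beta> \<gamma> (Y s)"
    unfolding smooth_conics_def by blast
  have gp: "conic \<alpha> \<beta> \<gamma> (group_point Y s)" for s
  proof (cases "s \<in> free_groups")
    case True
    then show ?thesis using on[OF True] by (simp add: conic_def group_point_def)
  next
    case False
    \<comment> \<open>Outside the free groups at most one coordinate is nonzero, so every product in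
      the equation of the conic is 0.\<close>
    have "special 0 \<noteq> special 1" "special 0 \<noteq> special 2" "special 1 \<noteq> special 2"
      using special_inj[of 0 1] special_inj[of 0 2] special_inj[of 1 2] by auto
    then show ?thesis using False by (auto simp: conic_def group_point_def)
  qed
  have "conic \<alpha> \<beta> \<gamma> (\<lambda>i. ?N $$ (i, k))" if k: "k < n" for k
  proof -
    let ?t = "if k \<in> J then 1 else t k"
    have "?t * ?t * (\<alpha> * group_point Y (group k) 0 * group_point Y (group k) 1 +
      \<beta> * group_point Y (group k) 0 * group_point Y (group k) 2 + \<gamma> * group_point Y (group k) 1 * group_point Y (group k) 2) = 0"
      using gp[of "group k"] by (simp only: conic_def mult_zero_right)
    then show ?thesis using k by (simp add: conic_def point_matrix_def algebra_simps)
  qed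
  with nz show "\<exists>\<alpha> \<beta> \<gamma>. \<alpha> \<noteq> 0 \<and> \<beta> \<noteq> 0 \<and> \<gamma> \<noteq> 0 \<and> (\<forall>k<n. conic \<alpha> \<beta> \<gamma> (\<lambda>i. ?N $$ (i, k)))"
    by blast
qed

text \<open>The scalars t record the column degrees. A factor from the group of e_i lies in row i,
  where its point has coordinate 1, so only the free groups contribute coordinates of
  \<open>Y\<close>.\<close>

lemma eval_at_standard:
  assumes E: "set_mset E \<subseteq> std_vars"
  shows "eval_at (monomial E) (point_matrix t Y) = (\<Prod>k\<in>#image_mset snd E. t k) * power_product free_groups (exps E) Y"
proof -
  have "eval_at (monomial E) (point_matrix t Y) =
     (\<Prod>v\<in>#E. t (snd v) * (case row_group v of (i, s) \<Rightarrow> if s \<in> free_groups then Y s i else 1))"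
    unfolding eval_at_monomial
  proof (intro arg_cong[of _ _ prod_mset] image_mset_cong)
    fix v assume "v \<in># E"
    with E have "v \<in> std_vars" by blast
    then show "point_matrix t Y $$ v = t (snd v) * (case row_group v of (i, s) \<Rightarrow> if s \<in> free_groups then Y s i else 1)"
      by (cases v) (auto simp: std_vars_def group_vars_def point_matrix_def group_point_def row_group_def)
  qed
  also have "\<dots> = (\<Prod>k\<in>#image_mset snd E. t k) * (\<Prod>(i, s)\<in>#image_mset row_group E. if s \<in> free_groups then Y s i else 1)"
    by (simp add: prod_mset.distrib multiset.map_comp o_def case_prod_unfold)
  also have "(\<Prod>(i, s)\<in>#image_mset row_group E. if s \<in> free_groups then Y s i else 1) = power_product free_groups (exps E) Y"
    unfolding exps_def
    by (rule prod_mset_eq_power_product[OF finite_free_groups])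
      (use E in \<open>auto simp: row_group_def std_vars_def group_vars_def\<close>)
  finally show ?thesis .
qed

lemma standard_congruent:
  assumes E: "set_mset E \<subseteq> std_vars" and E': "set_mset E' \<subseteq> std_vars"
    and cols: "image_mset snd E = image_mset snd E'" and exponent_key: "exponent_key free_groups (exps E) = exponent_key free_groups (exps E')"
  shows "monomial E - monomial E' \<in> K"
proof (rule monomials_congruent)
  show "set_mset E \<subseteq> group_vars" "set_mset E' \<subseteq> group_vars"
    using E E' by (auto simp: std_vars_def)
  \<comment> \<open>In a group that is not free the group determines the only row allowed by
    \<open>std_vars\<close>; there the column degrees already fix the row degrees, and
    \<open>exponent_key\<close> takes care of the free groups.\<close>
  define row where "row s = (SOME i. i < 3 \<and> special i = s)" for s
  have row: "row (special i) = i" if "i < 3" for i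
    unfolding row_def using that special_inj by (intro some_equality) auto
  have fixed: "filter_mset (\<lambda>p. snd p \<notin> free_groups) (image_mset row_group F) =
      image_mset (\<lambda>k. (row (group k), group k)) (filter_mset (\<lambda>k. group k \<notin> free_groups) (image_mset snd F))"
    if "set_mset F \<subseteq> std_vars" for F
    using that
  proof (induction F)
    case (add v F)
    obtain i k where v: "v = (i, k)" by (cases v)
    have "(i, k) \<in> std_vars" "set_mset F \<subseteq> std_vars" using add.prems v by auto
    then show ?case using add.IH row by (auto simp: v row_group_def std_vars_def group_vars_def)
  qed simp
  have free: "filter_mset (\<lambda>p. snd p \<in> free_groups) (image_mset row_group E) = filter_mset (\<lambda>p. snd p \<in> free_groups) (image_mset row_group E')"
  proof (rule multiset_eqI)
    fix p :: "nat \<times> nat"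
    obtain i s where p: "p = (i, s)" by (cases p)
    have "count (image_mset row_group E) (i, s) = count (image_mset row_group E') (i, s)" if s: "s \<in> free_groups"
    proof (cases "i < 3")
      case True
      with fun_cong[OF fun_cong[OF exponent_key, of s], of i] s show ?thesis by (simp add: exponent_key_def exps_def)
    next
      case False
      then have "(i, s) \<notin># image_mset row_group E" "(i, s) \<notin># image_mset row_group E'"
        using E E' by (auto simp: row_group_def std_vars_def group_vars_def)
      then show ?thesis by (simp only: not_in_iff)
    qed
    then show "count (filter_mset (\<lambda>p. snd p \<in> free_groups) (image_mset row_group E)) p =
       count (filter_mset (\<lambda>p. snd p \<in> free_groups) (image_mset row_group E')) p"
      by (simp add: p)
  qed
  have partition: "image_mset row_group F = filter_mset (\<lambda>p. snd p \<in> free_groups) (image_mset row_group F) +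
      filter_mset (\<lambda>p. snd p \<notin> free_groups) (image_mset row_group F)" for F
    by (rule multiset_partition)
  show "image_mset row_group E = image_mset row_group E'"
    by (rule trans[OF partition trans[OF _ partition[symmetric]]]) (simp only: free fixed[OF E] fixed[OF E'] cols)
qed (rule cols)

text \<open>Modulo K every class of \<open>g\<close> contributes one representative times the sum of
  the coefficients in the class, which is 0.\<close>

lemma combination_in_K:
  assumes "finite A" "\<And>v. (\<Sum>x | x \<in> A \<and> g x = v. c x) = (0::complex)"
    "\<And>x y. x \<in> A \<Longrightarrow> y \<in> A \<Longrightarrow> g x = g y \<Longrightarrow> m x - m y \<in> K"
  shows "(\<Sum>x\<in>A. const_poly (c x) * m x) \<in> K"
proof -
  have "(\<Sum>x | x \<in> A \<and> g x = v. const_poly (c x) * m x) \<in> K" if "v \<in> g ` A" for v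
  proof -
    from that obtain y where y: "y \<in> A" "g y = v" by blast
    have "(\<Sum>x | x \<in> A \<and> g x = v. const_poly (c x) * m x) =
       (\<Sum>x | x \<in> A \<and> g x = v. const_poly (c x) * (m x - m y)) + const_poly (\<Sum>x | x \<in> A \<and> g x = v. c x) * m y"
      by (simp add: const_poly_sum sum_distrib_right right_diff_distrib sum_subtractf)
    also have "\<dots> = (\<Sum>x | x \<in> A \<and> g x = v. const_poly (c x) * (m x - m y))"
      by (simp add: assms(2))
    also have "\<dots> \<in> K"
      by (intro chart_ideal_sum[OF K] chart_ideal_mult[OF K] assms(3)) (use y in auto)
    finally show ?thesis .
  qed
  then have "(\<Sum>v\<in>g ` A. \<Sum>x | x \<in> A \<and> g x = v. const_poly (c x) * m x) \<in> K"
    by (rule chart_ideal_sum[OF K])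
  then show ?thesis by (subst sum.image_gen[OF assms(1), of _ g])
qed

text \<open>Subtracting an element of K turns f into a standard combination, which by
  \<open>van_K\<close> still vanishes at the good points. Independence makes its coefficients cancel
  in classes of monomials that are congruent modulo K.\<close>

lemma vanishing_in_K:
  assumes f: "f \<in> polys_in vars" and van: "\<And>N. good_point n A0 r I J N \<Longrightarrow> eval_at f N = 0"
    and van_K: "\<And>g N. g \<in> K \<Longrightarrow> good_point n A0 r I J N \<Longrightarrow> eval_at g N = 0"
  shows "f \<in> K"
proof -
  from polys_in_std_span[OF f] obtain L where L: "\<And>c E. (c, E) \<in> set L \<Longrightarrow> standard E"
    and fL: "f - (\<Sum>(c, E)\<leftarrow>L. const_poly c * monomial E) \<in> K"
    unfolding std_span_def by auto
  define A where "A = {..<length L}"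
  define c where "c x = fst (L ! x)" for x
  define E where "E x = snd (L ! x)" for x
  have std: "standard (E x)" if "x \<in> A" for x
    using L[of "c x" "E x"] that by (simp add: A_def c_def E_def)
  then have sv: "set_mset (E x) \<subseteq> std_vars" if "x \<in> A" for x
    using that by (simp add: standard_def)
  have fin: "finite A" by (simp add: A_def)
  have sumL: "(\<Sum>(c, E)\<leftarrow>L. const_poly c * monomial E) = (\<Sum>x\<in>A. const_poly (c x) * monomial (E x))"
    by (simp add: A_def c_def E_def sum_list_sum_nth case_prod_beta lessThan_atLeast0)
  have "(\<Sum>x\<in>A. const_poly (c x) * monomial (E x)) \<in> K"
  proof (rule combination_in_K[OF fin, where g = "\<lambda>x. (image_mset snd (E x), exponent_key free_groups (exps (E x)))"])
    fix x y assume "x \<in> A" "y \<in> A" "(image_mset snd (E x), exponent_key free_groups (exps (E x))) = (image_mset snd (E y), exponent_key free_groups (exps (E y)))"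
    then show "monomial (E x) - monomial (E y) \<in> K"
      by (intro standard_congruent sv) auto
  next
    fix v :: "nat multiset \<times> (nat \<Rightarrow> nat \<Rightarrow> nat)"
    obtain \<mu> \<kappa> where v: "v = (\<mu>, \<kappa>)" by (cases v)
    let ?B = "{x. x \<in> A \<and> image_mset snd (E x) = \<mu>}"
    \<comment> \<open>For fixed \<open>Y\<close> the combination is a polynomial in t, so its part
      of column degree \<mu> vanishes by itself. That part is then tested with \<open>Y\<close>
      varying over the smooth conics.\<close>
    have "cancels free_groups ?B c (\<lambda>x. exps (E x))"
    proof (rule independent_onD[OF independent_std3[OF finite_free_groups]])
      fix Y assume Y: "Y \<in> smooth_conics free_groups"
      show "(\<Sum>x\<in>?B. c x * power_product free_groups (exps (E x)) Y) = 0"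
      proof (rule cancels_multisets[OF fin, where T = "{..<n}"])
        show "set_mset (image_mset snd (E x)) \<subseteq> {..<n}" if "x \<in> A" for x
          using sv[OF that] by (auto simp: std_vars_def group_vars_def)
        fix t
        have good: "good_point n A0 r I J (point_matrix t Y)" by (rule good_point_point_matrix[OF Y])
        have "eval_at f (point_matrix t Y) - eval_at (\<Sum>x\<in>A. const_poly (c x) * monomial (E x)) (point_matrix t Y) = 0"
          using van_K[OF fL good] by (simp add: sumL eval_at.hom_minus)
        then have "(\<Sum>x\<in>A. c x * eval_at (monomial (E x)) (point_matrix t Y)) = 0"
          using van[OF good] by (simp add: eval_at_sum eval_at_mult)
        also have "(\<Sum>x\<in>A. c x * eval_at (monomial (E x)) (point_matrix t Y)) =
           (\<Sum>x\<in>A. c x * power_product free_groups (exps (E x)) Y * (\<Prod>k\<in>#image_mset snd (E x). t k))"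
          by (intro sum.cong refl) (simp add: eval_at_standard[OF sv] mult_ac)
        finally show "(\<Sum>x\<in>A. c x * power_product free_groups (exps (E x)) Y * (\<Prod>k\<in>#image_mset snd (E x). t k)) = 0" .
      qed simp
    qed (use fin std in \<open>auto simp: standard_def\<close>)
    then have "(\<Sum>x | x \<in> ?B \<and> exponent_key free_groups (exps (E x)) = \<kappa>. c x) = 0"
      by (simp only: cancels_def)
    also have "{x. x \<in> ?B \<and> exponent_key free_groups (exps (E x)) = \<kappa>} =
        {x. x \<in> A \<and> (image_mset snd (E x), exponent_key free_groups (exps (E x))) = v}"
      by (auto simp: v)
    finally show "(\<Sum>x | x \<in> A \<and> (image_mset snd (E x), exponent_key free_groups (exps (E x))) = v. c x) = 0" .
  qed
  from chart_ideal_add[OF K fL this[folded sumL]] show ?thesis by simp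
qed

end

section \<open>Comparison of the ideals\<close>

lemma chart_idealI:
  assumes sub: "K \<subseteq> polys_in ({..<3} \<times> ({..<n} - J))" and zero: "0 \<in> K"
    and add: "\<And>f g. f \<in> K \<Longrightarrow> g \<in> K \<Longrightarrow> f + g \<in> K"
    and mult: "\<And>f h. f \<in> K \<Longrightarrow> h \<in> polys_in ({..<3} \<times> ({..<n} - J)) \<Longrightarrow> h * f \<in> K"
  shows "ideal K (chart_ring n J)"
proof (rule idealI)
  interpret cring "chart_ring n J" by (rule cring_chart_ring)
  show "ring (chart_ring n J)" by (rule ring_axioms)
  show "subgroup K (add_monoid (chart_ring n J))"
  proof
    fix x assume x: "x \<in> K"
    then have "- x \<in> K" using mult[OF x polys_in_uminus[OF polys_in_one]] by simp
    moreover have "\<ominus>\<^bsub>chart_ring n J\<^esub> x = - x"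
      by (rule minus_equality) (use x \<open>- x \<in> K\<close> sub in \<open>auto simp: chart_ring_def\<close>)
    ultimately show "inv\<^bsub>add_monoid (chart_ring n J)\<^esub> x \<in> K"
      by (simp add: a_inv_def)
  qed (use sub zero add in \<open>auto simp: chart_ring_def\<close>)
qed (use mult in \<open>auto simp: chart_ring_def mult.commute\<close>)

lemma set_add_chart_ring: "X <+>\<^bsub>chart_ring n J\<^esub> Y = {f + g | f g. f \<in> X \<and> g \<in> Y}"
  by (auto simp: set_add_defs chart_ring_def)

lemma chart_ideal_set_add:
  assumes X: "ideal X (chart_ring n J)" and Y: "ideal Y (chart_ring n J)"
  shows "ideal (X <+>\<^bsub>chart_ring n J\<^esub> Y) (chart_ring n J)"
  unfolding set_add_chart_ring
proof (rule chart_idealI)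
  let ?S = "{f + g | f g. f \<in> X \<and> g \<in> Y}"
  show "?S \<subseteq> polys_in ({..<3} \<times> ({..<n} - J))"
    using chart_ideal_subset[OF X] chart_ideal_subset[OF Y] by (auto intro: polys_in_add)
  show "0 \<in> ?S"
    using chart_ideal_0[OF X] chart_ideal_0[OF Y] by (intro CollectI exI[of _ 0]) simp
  show "p + q \<in> ?S" if pq: "p \<in> ?S" "q \<in> ?S" for p q
  proof -
    from pq obtain f g f' g' where "p = f + g" "q = f' + g'" "f \<in> X" "f' \<in> X" "g \<in> Y" "g' \<in> Y" by auto
    then show ?thesis
      using chart_ideal_add[OF X] chart_ideal_add[OF Y]
      by (intro CollectI exI[of _ "f + f'"] exI[of _ "g + g'"]) (auto simp: algebra_simps)
  qed
  show "h * p \<in> ?S" if p: "p \<in> ?S" and h: "h \<in> polys_in ({..<3} \<times> ({..<n} - J))" for p h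
  proof -
    from p obtain f g where "p = f + g" "f \<in> X" "g \<in> Y" by auto
    then show ?thesis
      using chart_ideal_mult[OF X _ h] chart_ideal_mult[OF Y _ h]
      by (intro CollectI exI[of _ "h * f"] exI[of _ "h * g"]) (auto simp: algebra_simps)
  qed
qed

lemma pow_chart_ring: "f [^]\<^bsub>chart_ring n J\<^esub> (k::nat) = f ^ k"
proof -
  interpret cring "chart_ring n J" by (rule cring_chart_ring)
  show ?thesis
    by (induction k) (simp_all add: nat_pow_def chart_ring_def mult.commute)
qed

lemma polys_in_power: "f \<in> polys_in V \<Longrightarrow> f ^ k \<in> polys_in V"
  by (induction k) (auto intro: polys_in_one polys_in_mult)

lemma radical_chart_ring:
  "radical (chart_ring n J) X = {f \<in> polys_in ({..<3} \<times> ({..<n} - J)). \<exists>k. f ^ k \<in> X}"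
  by (simp add: radical_def pow_chart_ring carrier_chart_ring)

lemma chart_ideal_radical:
  assumes X: "ideal X (chart_ring n J)"
  shows "ideal (radical (chart_ring n J) X) (chart_ring n J)"
  unfolding radical_chart_ring
proof (rule chart_idealI)
  let ?V = "{..<3} \<times> ({..<n} - J)"
  let ?S = "{f \<in> polys_in ?V. \<exists>k. f ^ k \<in> X}"
  show "0 \<in> ?S"
    using chart_ideal_0[OF X] by (auto intro: polys_in_zero exI[of _ 1])
  show "f + g \<in> ?S" if fg: "f \<in> ?S" "g \<in> ?S" for f g
  proof -
    from fg obtain a b where ab: "f ^ a \<in> X" "g ^ b \<in> X" and f: "f \<in> polys_in ?V" and g: "g \<in> polys_in ?V" by auto
    have "of_nat (a + b choose k) * f ^ k * g ^ (a + b - k) \<in> X" if k: "k \<le> a + b" for k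
    proof (cases "a \<le> k")
      case True
      have "of_int (int (a + b choose k)) * (f ^ (k - a) * g ^ (a + b - k)) * f ^ a \<in> X"
        by (intro chart_ideal_mult[OF X ab(1)] polys_in_mult polys_in_power f g of_int_in_polys)
      also have "of_int (int (a + b choose k)) * (f ^ (k - a) * g ^ (a + b - k)) * f ^ a =
         of_nat (a + b choose k) * (f ^ (k - a) * f ^ a) * g ^ (a + b - k)"
        by (simp add: mult_ac)
      also have "f ^ (k - a) * f ^ a = f ^ k"
        using True by (simp flip: power_add)
      finally show ?thesis .
    next
      case False
      have "of_int (int (a + b choose k)) * (f ^ k * g ^ (a - k)) * g ^ b \<in> X"
        by (intro chart_ideal_mult[OF X ab(2)] polys_in_mult polys_in_power f g of_int_in_polys)
      also have "of_int (int (a + b choose k)) * (f ^ k * g ^ (a - k)) * g ^ b =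
         of_nat (a + b choose k) * f ^ k * (g ^ (a - k) * g ^ b)"
        by (simp add: mult_ac)
      also have "g ^ (a - k) * g ^ b = g ^ (a + b - k)"
        using False by (simp flip: power_add)
      finally show ?thesis .
    qed
    then have "(f + g) ^ (a + b) \<in> X"
      unfolding binomial_ring by (intro chart_ideal_sum[OF X]) auto
    then show ?thesis using f g by (auto intro: polys_in_add)
  qed
  show "h * f \<in> ?S" if f: "f \<in> ?S" and h: "h \<in> polys_in ?V" for f h
  proof -
    from f obtain k where "f ^ k \<in> X" "f \<in> polys_in ?V" by auto
    then have "(h * f) ^ k \<in> X"
      unfolding power_mult_distrib by (intro chart_ideal_mult[OF X] polys_in_power h)
    then show ?thesis using \<open>f \<in> polys_in ?V\<close> h by (auto intro: polys_in_mult)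
  qed
qed auto

lemma chart_ideal_closure_of_points: "ideal (closure_of_points n Z J) (chart_ring n J)"
  unfolding closure_of_points_def carrier_chart_ring
  by (rule chart_idealI) (auto intro: polys_in_add polys_in_mult polys_in_zero simp: eval_at_add eval_at_mult)

section \<open>Evaluating generators at normalised matrices\<close>

lemma eval_at_chart_matrix:
  assumes J: "J \<in> charts n" and N: "N \<in> carrier_mat 3 n" "submatrix N UNIV J = 1\<^sub>m 3" and ik: "i < 3" "k < n"
  shows "eval_at (chart_matrix n J $$ (i, k)) N = N $$ (i, k)"
proof (cases "k \<in> J")
  case False
  then show ?thesis using ik by (simp add: chart_matrix_def)
next
  case True
  then obtain j where j: "j < 3" "k = pick J j" using charts_pick(7)[OF J] by blast
  have "N $$ (i, pick J j) = submatrix N UNIV J $$ (i, j)"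
    unfolding submatrix_UNIV_cols[OF N(1) charts_pick(3)[OF J]] charts_pick(2)[OF J] using ik j by (simp del: pick.simps)
  also have "\<dots> = (if i = j then 1 else 0)" unfolding N(2) using ik j by simp
  finally show ?thesis
    using True ik j charts_pick(6)[OF J ik(1) j(1)] by (auto simp: chart_matrix_def simp del: pick.simps)
qed

lemma eval_at_quad_det:
  assumes J: "J \<in> charts n" and N: "N \<in> carrier_mat 3 n" "submatrix N UNIV J = 1\<^sub>m 3"
    and ps: "\<And>j. j < 6 \<Longrightarrow> fst (ps j) < n \<and> snd (ps j) < n"
  shows "eval_at (quad_det (chart_matrix n J) ps) N = quad_det N ps"
  unfolding quad_det_def eval_at.hom_det[symmetric]
  by (intro arg_cong[of _ _ det] eq_matI)
    (use ps in \<open>auto simp: eval_at_mult eval_at_chart_matrix[OF J N] qrow_lt\<close>)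

lemma eval_at_minor:
  assumes J: "J \<in> charts n" and N: "N \<in> carrier_mat 3 n" "submatrix N UNIV J = 1\<^sub>m 3"
    and S: "S \<subseteq> {..<n}" "card S = 3"
  shows "eval_at (det (submatrix (chart_matrix n J) UNIV S)) N = det (mat 3 3 (\<lambda>(i, j). N $$ (i, pick S j)))"
proof -
  have M: "chart_matrix n J \<in> carrier_mat 3 n" by (simp add: chart_matrix_def)
  have "pick S j < n" if "j < 3" for j using pick_in_set_le[of j S] that S by auto
  then show ?thesis
    unfolding submatrix_UNIV_cols[OF M S(1)] S(2) eval_at.hom_det[symmetric]
    by (intro arg_cong[of _ _ det] eq_matI) (auto simp: eval_at_chart_matrix[OF J N] simp del: pick.simps)
qed

lemma det_3_proportional_columns:
  fixes F :: "nat \<Rightarrow> nat \<Rightarrow> 'a :: comm_ring_1"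
  assumes "j < 3" "j' < 3" "j \<noteq> j'" "\<And>i. i < 3 \<Longrightarrow> F i j = t * y i" "\<And>i. i < 3 \<Longrightarrow> F i j' = t' * y i"
  shows "det (mat 3 3 (\<lambda>(i, j). F i j)) = 0"
proof -
  have F: "F 0 j = t * y 0" "F 1 j = t * y 1" "F 2 j = t * y 2" "F 0 j' = t' * y 0" "F 1 j' = t' * y 1" "F 2 j' = t' * y 2"
    using assms(4,5) by auto
  consider "j = 0" "j' = 1" | "j = 0" "j' = 2" | "j = 1" "j' = 0" | "j = 1" "j' = 2" | "j = 2" "j' = 0" | "j = 2" "j' = 1"
    using assms(1-3) by (auto simp: less_Suc_eq numeral_3_eq_3 numeral_2_eq_2)
  then show ?thesis
    unfolding det_mat_3 by cases (use F in \<open>simp_all add: algebra_simps\<close>)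
qed

text \<open>All three minors are multiples of one determinant with columns built from y_j; their
  scalars are the products of t_j t'_j, of t_j^2 and of t'_j^2.\<close>

lemma quad_det_product:
  fixes N :: "'a :: comm_ring_1 mat"
  assumes "\<And>j. j < 6 \<Longrightarrow> \<exists>t t' y. (\<forall>i<3. N $$ (i, fst (ps j)) = t * y i) \<and> (\<forall>i<3. N $$ (i, snd (ps j)) = t' * y i)"
  shows "(quad_det N ps)\<^sup>2 = quad_det N (\<lambda>j. (fst (ps j), fst (ps j))) * quad_det N (\<lambda>j. (snd (ps j), snd (ps j)))"
proof -
  from assms obtain t t' y where *: "\<And>j i. j < 6 \<Longrightarrow> i < 3 \<Longrightarrow> N $$ (i, fst (ps j)) = t j * y j i"
    "\<And>j i. j < 6 \<Longrightarrow> i < 3 \<Longrightarrow> N $$ (i, snd (ps j)) = t' j * y j i" by metis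
  define D where "D = det (mat 6 6 (\<lambda>(i, j). y j (qrow1 i) * y j (qrow2 i)))"
  have "quad_det N ps = det (mat 6 6 (\<lambda>(i, j). (t j * t' j) * (y j (qrow1 i) * y j (qrow2 i))))"
    unfolding quad_det_def by (intro arg_cong[of _ _ det] eq_matI) (auto simp: * qrow_lt)
  then have 1: "quad_det N ps = (\<Prod>j<6. t j * t' j) * D" by (simp only: det_scale_columns D_def)
  have "quad_det N (\<lambda>j. (fst (ps j), fst (ps j))) = det (mat 6 6 (\<lambda>(i, j). (t j * t j) * (y j (qrow1 i) * y j (qrow2 i))))"
    unfolding quad_det_def by (intro arg_cong[of _ _ det] eq_matI) (auto simp: * qrow_lt)
  then have 2: "quad_det N (\<lambda>j. (fst (ps j), fst (ps j))) = (\<Prod>j<6. t j * t j) * D" by (simp only: det_scale_columns D_def)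
  have "quad_det N (\<lambda>j. (snd (ps j), snd (ps j))) = det (mat 6 6 (\<lambda>(i, j). (t' j * t' j) * (y j (qrow1 i) * y j (qrow2 i))))"
    unfolding quad_det_def by (intro arg_cong[of _ _ det] eq_matI) (auto simp: * qrow_lt)
  then have 3: "quad_det N (\<lambda>j. (snd (ps j), snd (ps j))) = (\<Prod>j<6. t' j * t' j) * D" by (simp only: det_scale_columns D_def)
  show ?thesis
    unfolding 1 2 3 by (simp add: prod.distrib power2_eq_square mult_ac)
qed

context
  fixes n r :: nat and A0 :: "nat set" and I :: "nat \<Rightarrow> nat set"
  assumes cover: "A0 \<union> (\<Union>i\<in>{1..r}. I i) = {..<n}"
    and A0_disjoint: "A0 \<inter> (\<Union>i\<in>{1..r}. I i) = {}"
    and I_disjoint: "disjoint_family_on I {1..r}"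
begin

lemma A0_subset: "A0 \<subseteq> {..<n}"
  unfolding cover[symmetric] by (rule Un_upper1)

lemma I_subset: "s \<in> {1..r} \<Longrightarrow> I s \<subseteq> {..<n}"
  unfolding cover[symmetric] by (rule subset_trans[OF UN_upper Un_upper2])

lemma in_positroid_variety_iff:
  assumes "J \<in> charts n"
  shows "f \<in> positroid_variety n A0 r I J \<longleftrightarrow> f \<in> carrier (chart_ring n J) \<and>
     (\<forall>N. positroid_point n A0 r I N \<and> submatrix N UNIV J = 1\<^sub>m 3 \<longrightarrow> eval_at f N = 0)"
  by (rule positroid_variety_iff[where I = I, OF assms A0_subset I_subset])

lemma pluecker_coords_in_positroid:
  assumes J: "J \<in> charts n"
  shows "positroid_pluecker_coords A0 r I (chart_matrix n J) \<subseteq> positroid_variety n A0 r I J"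
proof
  fix f assume f: "f \<in> positroid_pluecker_coords A0 r I (chart_matrix n J)"
  then obtain S where S: "S \<subseteq> {..<n}" "card S = 3" "S \<inter> A0 \<noteq> {} \<or> (\<exists>i\<in>{1..r}. 2 \<le> card (S \<inter> I i))"
    and fS: "f = det (submatrix (chart_matrix n J) UNIV S)"
    unfolding positroid_pluecker_coords_def pluecker_coord_def by (auto simp: chart_matrix_def)
  have SC: "S \<in> charts n" using S by (simp add: charts_def)
  have "eval_at f N = 0" if N: "positroid_point n A0 r I N" "submatrix N UNIV J = 1\<^sub>m 3" for N
  proof -
    from N(1) have car: "N \<in> carrier_mat 3 n" and zero: "\<And>k i. k \<in> A0 \<Longrightarrow> i < 3 \<Longrightarrow> N $$ (i, k) = 0"
      and cols: "\<And>s. s \<in> {1..r} \<Longrightarrow> \<exists>t y. \<forall>k\<in>I s. \<forall>i<3. N $$ (i, k) = t k * y i"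
      by (auto simp: positroid_point_def)
    have "det (mat 3 3 (\<lambda>(i, j). N $$ (i, pick S j))) = 0"
      using S(3)
    proof
      assume "S \<inter> A0 \<noteq> {}"
      then obtain k where k: "k \<in> S" "k \<in> A0" by blast
      then obtain j where j: "j < 3" "k = pick S j" using charts_pick(7)[OF SC] by blast
      \<comment> \<open>A zero column is proportional, with factor 0, to any other column; j' is
        such a column.\<close>
      define j' where "j' = (if j = 0 then 1 else 0 :: nat)"
      show ?thesis
        by (rule det_3_proportional_columns[of j j' _ 0 "\<lambda>i. N $$ (i, pick S j')" 1])
          (use j k zero in \<open>auto simp: j'_def simp del: pick.simps\<close>)
    next
      assume "\<exists>i\<in>{1..r}. 2 \<le> card (S \<inter> I i)"
      then obtain s where s: "s \<in> {1..r}" "2 \<le> card (S \<inter> I s)" by blast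
      then have "\<not> is_singleton (S \<inter> I s)" "S \<inter> I s \<noteq> {}" by (auto simp: is_singleton_altdef)
      then obtain k k' where k: "k \<in> S \<inter> I s" "k' \<in> S \<inter> I s" "k \<noteq> k'"
        unfolding is_singleton_def by blast
      then obtain j j' where j: "j < 3" "k = pick S j" "j' < 3" "k' = pick S j'"
        using charts_pick(7)[OF SC, of k] charts_pick(7)[OF SC, of k'] by blast
      from cols[OF s(1)] obtain t y where ty: "\<And>k i. k \<in> I s \<Longrightarrow> i < 3 \<Longrightarrow> N $$ (i, k) = t k * y i" by blast
      show ?thesis
        by (rule det_3_proportional_columns[of j j' _ "t k" y "t k'"])
          (use j k ty in \<open>auto simp del: pick.simps\<close>)
    qed
    then show ?thesis unfolding fS eval_at_minor[OF J car N(2) S(1,2)] .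
  qed
  moreover have "f \<in> carrier (chart_ring n J)"
    using f generators_in_carrier by blast
  ultimately show "f \<in> positroid_variety n A0 r I J"
    unfolding in_positroid_variety_iff[OF J] by blast
qed

lemma quad_det_carrier:
  assumes "\<And>j. j < 6 \<Longrightarrow> fst (ps j) < n \<and> snd (ps j) < n"
  shows "quad_det (chart_matrix n J) ps \<in> carrier (chart_ring n J)"
  unfolding quad_det_def carrier_chart_ring
proof (rule polys_in_det)
  fix i j assume "i < dim_row (mat 6 6 (\<lambda>(i, j). chart_matrix n J $$ (qrow1 i, fst (ps j)) * chart_matrix n J $$ (qrow2 i, snd (ps j))))"
    "j < dim_col (mat 6 6 (\<lambda>(i, j). chart_matrix n J $$ (qrow1 i, fst (ps j)) * chart_matrix n J $$ (qrow2 i, snd (ps j))))"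
  then have ij: "i < 6" "j < 6" by auto
  then show "mat 6 6 (\<lambda>(i, j). chart_matrix n J $$ (qrow1 i, fst (ps j)) * chart_matrix n J $$ (qrow2 i, snd (ps j))) $$ (i, j)
      \<in> polys_in ({..<3} \<times> ({..<n} - J))"
    using assms[OF ij(2)] qrow_lt[OF ij(1)]
      chart_matrix_entry[of "qrow1 i" "fst (ps j)" n J] chart_matrix_entry[of "qrow2 i" "snd (ps j)" n J]
    by (simp add: polys_in_mult carrier_chart_ring)
qed

lemma quad_det_in_ABCT:
  assumes J: "J \<in> charts n" and ps: "\<And>j. j < 6 \<Longrightarrow> fst (ps j) = snd (ps j) \<and> snd (ps j) < n"
  shows "quad_det (chart_matrix n J) ps \<in> ABCT_variety n J"
  unfolding ABCT_variety_def closure_of_points_def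
proof (intro CollectI conjI ballI impI)
  have lt: "fst (ps j) < n \<and> snd (ps j) < n" if "j < 6" for j using ps[OF that] by simp
  show "quad_det (chart_matrix n J) ps \<in> carrier (chart_ring n J)" by (rule quad_det_carrier[OF lt])
  fix P N assume "P \<in> {row_class (veronese A) |A. A \<in> carrier_mat 2 n \<and> vec_space.rank 2 A = 2 \<and> vec_space.rank 3 (veronese A) = 3}"
    and N: "N \<in> P" "submatrix N UNIV J = 1\<^sub>m 3"
  then obtain A where A: "A \<in> carrier_mat 2 n" "N \<in> row_class (veronese A)" by blast
  then have "N \<in> carrier_mat 3 n" using veronese_carrier[OF A(1)] unfolding row_class_def by auto
  then show "eval_at (quad_det (chart_matrix n J) ps) N = 0"
    using eval_at_quad_det[OF J _ N(2) lt] ABCT_quad_det[OF A ps] by simp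
qed

text \<open>On the positroid variety the columns \<open>a\<close> and \<open>b\<close> of a group are proportional, so the square of a
  minor with columns \<open>(a\<^sub>j, b\<^sub>j)\<close> is the product of the minors with columns \<open>(a\<^sub>j, a\<^sub>j)\<close> and \<open>(b\<^sub>j, b\<^sub>j)\<close>,
  which are minors of \<open>theta\<close>.\<close>

lemma minors_squared:
  assumes J: "J \<in> charts n" and m: "m \<in> maximal_minors (theta_tilde r I (chart_matrix n J))"
  shows "m\<^sup>2 \<in> V_boundary n A0 r I J"
proof -
  have "dim_col (chart_matrix n J) = n" by (simp add: chart_matrix_def)
  with maximal_minor_theta_tilde[OF m] obtain ps where
    ps: "\<And>j. j < 6 \<Longrightarrow> ps j \<in> column_pairs r I n" and mps: "m = quad_det (chart_matrix n J) ps" by metis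
  let ?M = "chart_matrix n J"
  let ?a = "\<lambda>j. (fst (ps j), fst (ps j))" and ?b = "\<lambda>j. (snd (ps j), snd (ps j))"
  have lt: "fst (ps j) < n \<and> snd (ps j) < n" if "j < 6" for j
    using ps[OF that] by (auto simp: column_pairs_def)
  have a: "quad_det ?M ?a \<in> ABCT_variety n J" by (rule quad_det_in_ABCT[OF J]) (use lt in auto)
  have car: "m \<in> carrier (chart_ring n J)" "quad_det ?M ?a \<in> carrier (chart_ring n J)" "quad_det ?M ?b \<in> carrier (chart_ring n J)"
    unfolding mps by (rule quad_det_carrier, use lt in simp)+
  have ABCT: "ideal (ABCT_variety n J) (chart_ring n J)"
    unfolding ABCT_variety_def by (rule chart_ideal_closure_of_points)
  have "m\<^sup>2 - quad_det ?M ?a * quad_det ?M ?b \<in> positroid_variety n A0 r I J"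
    unfolding in_positroid_variety_iff[OF J]
  proof (intro conjI allI impI; (elim conjE)?)
    show "m\<^sup>2 - quad_det ?M ?a * quad_det ?M ?b \<in> carrier (chart_ring n J)"
      using car polys_in_add[OF _ polys_in_uminus] unfolding carrier_chart_ring
      by (simp add: power2_eq_square polys_in_mult flip: add_uminus_conv_diff)
    fix N assume N: "positroid_point n A0 r I N" "submatrix N UNIV J = 1\<^sub>m 3"
    from N(1) have carN: "N \<in> carrier_mat 3 n"
      and cols: "\<And>s. s \<in> {1..r} \<Longrightarrow> \<exists>t y. \<forall>k\<in>I s. \<forall>i<3. N $$ (i, k) = t k * y i"
      by (auto simp: positroid_point_def)
    have "\<exists>t t' y. (\<forall>i<3. N $$ (i, fst (ps j)) = t * y i) \<and> (\<forall>i<3. N $$ (i, snd (ps j)) = t' * y i)" if j: "j < 6" for j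
    proof (cases "fst (ps j) = snd (ps j)")
      case True
      then show ?thesis by (intro exI[of _ 1] exI[of _ "\<lambda>i. N $$ (i, fst (ps j))"]) simp
    next
      case False
      then obtain s where s: "s \<in> {1..r}" "fst (ps j) \<in> I s" "snd (ps j) \<in> I s"
        using ps[OF j] by (auto simp: column_pairs_def)
      from cols[OF s(1)] obtain t y where "\<forall>k\<in>I s. \<forall>i<3. N $$ (i, k) = t k * y i" by blast
      with s show ?thesis by blast
    qed
    from quad_det_product[where ps = ps and N = N, OF this]
    show "eval_at (m\<^sup>2 - quad_det ?M ?a * quad_det ?M ?b) N = 0"
      using lt by (simp add: eval_at.hom_minus eval_at_mult eval_at.hom_power mps eval_at_quad_det[OF J carN N(2)])
  qed
  moreover have "quad_det ?M ?a * quad_det ?M ?b \<in> ABCT_variety n J"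
    using chart_ideal_mult[OF ABCT a, of "quad_det ?M ?b"] car(3) by (simp add: carrier_chart_ring mult.commute)
  ultimately show ?thesis
    unfolding V_boundary_def scheme_inter_def set_add_chart_ring
    by (intro CollectI exI[of _ "m\<^sup>2 - quad_det ?M ?a * quad_det ?M ?b"] exI[of _ "quad_det ?M ?a * quad_det ?M ?b"]) simp
qed

context
  fixes J :: "nat set"
  assumes J: "J \<in> charts n"
begin

section \<open>The ideals on one chart\<close>

lemma ideal_positroid: "ideal (positroid_variety n A0 r I J) (chart_ring n J)"
  unfolding positroid_variety_def by (rule chart_ideal_closure_of_points)

lemma ideal_ABCT: "ideal (ABCT_variety n J) (chart_ring n J)"
  unfolding ABCT_variety_def by (rule chart_ideal_closure_of_points)

lemma ideal_V_boundary: "ideal (V_boundary n A0 r I J) (chart_ring n J)"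
  unfolding V_boundary_def scheme_inter_def by (rule chart_ideal_set_add[OF ideal_positroid ideal_ABCT])

lemma positroid_subset_V_boundary: "positroid_variety n A0 r I J \<subseteq> V_boundary n A0 r I J"
proof
  fix f assume "f \<in> positroid_variety n A0 r I J"
  then show "f \<in> V_boundary n A0 r I J"
    unfolding V_boundary_def scheme_inter_def set_add_chart_ring
    using chart_ideal_0[OF ideal_ABCT] by (intro CollectI exI[of _ f] exI[of _ 0]) simp
qed

lemma ideal_reduced: "ideal (reduced_subscheme n (V_boundary n A0 r I) J) (chart_ring n J)"
  unfolding reduced_subscheme_def by (rule chart_ideal_radical[OF ideal_V_boundary])

lemma V_boundary_subset_reduced: "V_boundary n A0 r I J \<subseteq> reduced_subscheme n (V_boundary n A0 r I) J"
  unfolding reduced_subscheme_def radical_chart_ring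
  using chart_ideal_subset[OF ideal_V_boundary] by (auto intro: exI[of _ 1])

abbreviation "full_cut_out \<equiv> cut_out n (\<lambda>M. positroid_pluecker_coords A0 r I M \<union> maximal_minors (theta_tilde r I M))"

lemma ideal_full_cut_out: "ideal (full_cut_out J) (chart_ring n J)"
  unfolding cut_out_def
  by (rule ring.genideal_ideal[OF cring.axioms(1)[OF cring_chart_ring] generators_in_carrier])

lemma gens_subset_full_cut_out:
  "positroid_pluecker_coords A0 r I (chart_matrix n J) \<union> maximal_minors (theta_tilde r I (chart_matrix n J)) \<subseteq> full_cut_out J"
  unfolding cut_out_def
  by (rule ring.genideal_self[OF cring.axioms(1)[OF cring_chart_ring] generators_in_carrier])

lemma full_cut_out_minimal:
  assumes "ideal X (chart_ring n J)" "positroid_pluecker_coords A0 r I (chart_matrix n J) \<subseteq> X"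
    "maximal_minors (theta_tilde r I (chart_matrix n J)) \<subseteq> X"
  shows "full_cut_out J \<subseteq> X"
  unfolding cut_out_def
  by (rule ring.genideal_minimal[OF cring.axioms(1)[OF cring_chart_ring] assms(1)]) (use assms in blast)

lemma full_cut_out_subset_reduced: "full_cut_out J \<subseteq> reduced_subscheme n (V_boundary n A0 r I) J"
proof (rule full_cut_out_minimal[OF ideal_reduced])
  show "positroid_pluecker_coords A0 r I (chart_matrix n J) \<subseteq> reduced_subscheme n (V_boundary n A0 r I) J"
    by (rule subset_trans[OF subset_trans[OF pluecker_coords_in_positroid[OF J] positroid_subset_V_boundary] V_boundary_subset_reduced])
  show "maximal_minors (theta_tilde r I (chart_matrix n J)) \<subseteq> reduced_subscheme n (V_boundary n A0 r I) J"
  proof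
    fix m assume m: "m \<in> maximal_minors (theta_tilde r I (chart_matrix n J))"
    then have "m \<in> carrier (chart_ring n J)" using generators_in_carrier by blast
    with minors_squared[OF J m] show "m \<in> reduced_subscheme n (V_boundary n A0 r I) J"
      unfolding reduced_subscheme_def radical_chart_ring by (auto simp: carrier_chart_ring)
  qed
qed

text \<open>Some power of f is a sum of an element vanishing at positroid points and one vanishing
  at Veronese images; a good point is of both kinds, and a number with a vanishing power is
  0.\<close>

lemma reduced_vanishes:
  assumes f: "f \<in> reduced_subscheme n (V_boundary n A0 r I) J" and N: "good_point n A0 r I J N"
  shows "eval_at f N = 0"
proof -
  from f obtain k p a where k: "f ^ k = p + a" and p: "p \<in> positroid_variety n A0 r I J" and a: "a \<in> ABCT_variety n J"
    unfolding reduced_subscheme_def radical_chart_ring V_boundary_def scheme_inter_def set_add_chart_ring by blast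
  from N have pos: "positroid_point n A0 r I N" and sub: "submatrix N UNIV J = 1\<^sub>m 3" by (auto simp: good_point_def)
  then have car: "N \<in> carrier_mat 3 n" by (simp add: positroid_point_def)
  from p pos sub have "eval_at p N = 0"
    unfolding in_positroid_variety_iff[OF J] by blast
  moreover have "eval_at a N = 0"
  proof -
    from N obtain \<alpha> \<beta> \<gamma> where "\<alpha> \<noteq> 0" "\<beta> \<noteq> 0" "\<gamma> \<noteq> 0" "\<And>k. k < n \<Longrightarrow> conic \<alpha> \<beta> \<gamma> (\<lambda>i. N $$ (i, k))"
      by (auto simp: good_point_def)
    from ABCT_point[OF J car sub this] obtain A where A: "A \<in> carrier_mat 2 n" "vec_space.rank 2 A = 2"
      "vec_space.rank 3 (veronese A) = 3" "N \<in> row_class (veronese A)" by blast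
    then have "row_class (veronese A) \<in> {row_class (veronese A) |A. A \<in> carrier_mat 2 n \<and> vec_space.rank 2 A = 2 \<and> vec_space.rank 3 (veronese A) = 3}"
      by (intro CollectI exI[of _ A]) simp
    with a A(4) sub show ?thesis
      unfolding ABCT_variety_def closure_of_points_def by blast
  qed
  ultimately have "eval_at f N ^ k = 0"
    using arg_cong[OF k, of "\<lambda>f. eval_at f N"] by (simp add: eval_at_add eval_at.hom_power)
  then show ?thesis by simp
qed

lemma reduced_subset_full_cut_out: "reduced_subscheme n (V_boundary n A0 r I) J \<subseteq> full_cut_out J"
proof (cases "J \<inter> A0 = {} \<and> (\<forall>s\<in>{1..r}. card (J \<inter> I s) < 2)")
  case True
  have J_I: "card (J \<inter> I s) < 2" if "s \<in> {1..r}" for s using True that by blast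
  interpret good_chart n r A0 I J "full_cut_out J"
    by (rule good_chart.intro[where I = I, OF J cover A0_disjoint I_disjoint conjunct1[OF True] J_I ideal_full_cut_out
          subset_trans[OF Un_upper1 gens_subset_full_cut_out] subset_trans[OF Un_upper2 gens_subset_full_cut_out]])
  show ?thesis
  proof
    fix f assume f: "f \<in> reduced_subscheme n (V_boundary n A0 r I) J"
    show "f \<in> full_cut_out J"
    proof (rule vanishing_in_K)
      show "f \<in> polys_in ({..<3} \<times> ({..<n} - J))"
        using f chart_ideal_subset[OF ideal_reduced] by blast
      show "eval_at f N = 0" if "good_point n A0 r I J N" for N
        by (rule reduced_vanishes[OF f that])
      \<comment> \<open>The inclusion of the generated ideal in the radical is used here in the
        proof of the reverse inclusion: it makes the generated ideal vanish at the good
        points.\<close>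
      show "eval_at g N = 0" if "g \<in> full_cut_out J" "good_point n A0 r I J N" for g N
        by (rule reduced_vanishes[OF _ that(2)]) (use that(1) full_cut_out_subset_reduced in blast)
    qed
  qed
next
  case False
  then have bad: "J \<inter> A0 \<noteq> {} \<or> (\<exists>s\<in>{1..r}. 2 \<le> card (J \<inter> I s))" by (auto simp: not_less)
  have "pluecker_coord J (chart_matrix n J) \<in> positroid_pluecker_coords A0 r I (chart_matrix n J)"
    unfolding positroid_pluecker_coords_def
    using bad charts_pick(2,3)[OF J] by (intro CollectI exI[of _ J]) (auto simp: chart_matrix_def)
  moreover have "pluecker_coord J (chart_matrix n J) = 1"
    unfolding pluecker_coord_def submatrix_chart_matrix[OF J] by simp
  ultimately have "1 \<in> full_cut_out J" using gens_subset_full_cut_out by auto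
  then have "f \<in> full_cut_out J" if "f \<in> polys_in ({..<3} \<times> ({..<n} - J))" for f
    using chart_ideal_mult[OF ideal_full_cut_out _ that] by fastforce
  then show ?thesis using chart_ideal_subset[OF ideal_reduced] by blast
qed

lemma reduced_eq_full_cut_out: "reduced_subscheme n (V_boundary n A0 r I) J = full_cut_out J"
  by (rule antisym[OF reduced_subset_full_cut_out full_cut_out_subset_reduced])

text \<open>The boundary ideal lies in its radical, which is contained in the ideal of all the
  generators, so adding the minors does not lead out of it. Conversely the Pluecker coordinates lie
  in the positroid ideal, a summand of the boundary ideal.\<close>

lemma V_boundary'_eq_full_cut_out: "V_boundary' n A0 r I J = full_cut_out J"
proof -
  let ?T = "maximal_minors (theta_tilde r I (chart_matrix n J))"
  let ?Y = "Idl\<^bsub>chart_ring n J\<^esub> ?T"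
  note ring = cring.axioms(1)[OF cring_chart_ring]
  have T: "?T \<subseteq> carrier (chart_ring n J)" using generators_in_carrier by blast
  have Y: "ideal ?Y (chart_ring n J)" by (rule ring.genideal_ideal[OF ring T])
  have eq: "V_boundary' n A0 r I J = V_boundary n A0 r I J <+>\<^bsub>chart_ring n J\<^esub> ?Y"
    unfolding V_boundary'_def scheme_inter_def cut_out_def ..
  have id: "ideal (V_boundary' n A0 r I J) (chart_ring n J)"
    unfolding eq by (rule chart_ideal_set_add[OF ideal_V_boundary Y])
  show ?thesis
  proof (rule antisym)
    have "?Y \<subseteq> full_cut_out J"
      by (rule ring.genideal_minimal[OF ring ideal_full_cut_out]) (use gens_subset_full_cut_out in blast)
    moreover have "V_boundary n A0 r I J \<subseteq> full_cut_out J"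
      using V_boundary_subset_reduced reduced_subset_full_cut_out by (rule subset_trans)
    ultimately show "V_boundary' n A0 r I J \<subseteq> full_cut_out J"
      unfolding eq set_add_chart_ring using chart_ideal_add[OF ideal_full_cut_out] by blast
    show "full_cut_out J \<subseteq> V_boundary' n A0 r I J"
    proof (rule full_cut_out_minimal[OF id])
      show "positroid_pluecker_coords A0 r I (chart_matrix n J) \<subseteq> V_boundary' n A0 r I J"
      proof
        fix f assume "f \<in> positroid_pluecker_coords A0 r I (chart_matrix n J)"
        then have "f \<in> V_boundary n A0 r I J"
          using pluecker_coords_in_positroid[OF J] positroid_subset_V_boundary by blast
        then show "f \<in> V_boundary' n A0 r I J"
          unfolding eq set_add_chart_ring using chart_ideal_0[OF Y]
          by (intro CollectI exI[of _ f] exI[of _ 0]) simp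
      qed
      show "?T \<subseteq> V_boundary' n A0 r I J"
      proof
        fix f assume "f \<in> ?T"
        then have "f \<in> ?Y" using ring.genideal_self[OF ring T] by blast
        then show "f \<in> V_boundary' n A0 r I J"
          unfolding eq set_add_chart_ring using chart_ideal_0[OF ideal_V_boundary]
          by (intro CollectI exI[of _ 0] exI[of _ f]) simp
      qed
    qed
  qed
qed

end

end

theorem theorem6p16:
  fixes n r :: nat and A0 :: "nat set" and I :: "nat \<Rightarrow> nat set"
  assumes "A0 \<union> (\<Union>i\<in>{1..r}. I i) = {..<n}"
    and "A0 \<inter> (\<Union>i\<in>{1..r}. I i) = {}"
    and "disjoint_family_on I {1..r}"
    and "\<forall>i\<in>{1..r}. cyclic_interval n (I i)"
  shows "same_subscheme n (reduced_subscheme n (V_boundary n A0 r I)) (V_boundary' n A0 r I) \<and>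
    same_subscheme n (reduced_subscheme n (V_boundary n A0 r I))
      (cut_out n (\<lambda>M. positroid_pluecker_coords A0 r I M \<union> maximal_minors (theta_tilde r I M)))"
  unfolding same_subscheme_def
  using reduced_eq_full_cut_out[OF assms(1-3)] V_boundary'_eq_full_cut_out[OF assms(1-3)] by simp

end
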